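(* Let $E$ be an arbitrary directed graph, $K$ a field, and $L=L_K(E)$ the Leavitt path algebra of $E$ over $K$. The following are equivalent: (a) every proper two-sided ideal of $L$ is a prime ideal; (b) the graph $E$ satisfies Condition (K), and: (i) the set $(\mathbf{H},\le')$ of all admissible pairs $(H,S)$ in $E$ is a chain under the partial order $\le'$; (ii) for each hereditary saturated set $H$ of vertices, $|B_H|\le 1$; and (iii) for each $(H,S)\in\mathbf{H}$, the vertex set $(E\backslash(H,S))^0$ of the quotient graph is downward directed; (c) all the ideals of $L$ are graded and form a chain under set inclusion.
   Context: A directed graph $E=(E^0,E^1,r,s)$ consists of sets $E^0$ (vertices) and $E^1$ (edges), of arbitrary cardinality, with maps $r,s:E^1\to E^0$ (range, source). A vertex $v$ is regular if $s^{-1}(v)$ is finite and non-empty, and an infinite emitter if $s^{-1}(v)$ is infinite. The Leavitt path algebra $L_K(E)$ is the (not necessarily unital) $K$-algebra generated by pairwise orthogonal idempotents $\{v:v\in E^0\}$ and elements $\{e,e^*:e\in E^1\}$ subject to: (1) $s(e)e=e=er(e)$; (2) $r(e)e^*=e^*=e^*s(e)$; (3) $e^*e=r(e)$ and $e^*f=0$ for edges $e\ne f$; (4) $v=\sum_{s(e)=v}ee^*$ for every regular vertex $v$. It is $\mathbb{Z}$-graded, $L=\bigoplus_n L_n$, by $\deg v=0$, $\deg e=1$, $\deg e^*=-1$; an ideal $I$ is graded if $I=\bigoplus_n(I\cap L_n)$. A path of positive length is $\mu=e_1\cdots e_n$ with $r(e_i)=s(e_{i+1})$; vertices are paths of length $0$.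 A path is closed, based at $s(e_1)$, if $r(e_n)=s(e_1)$; a closed path is simple if $s(e_i)\ne s(e_1)$ for all $i\ge2$. $E$ satisfies Condition (K) if every vertex that is the base of a simple closed path $c$ is also the base of a simple closed path $c'\neq c$. Write $u\ge v$ if there is a path from $u$ to $v$. A set $D$ of vertices is downward directed if for all $u,v\in D$ there is $w\in D$ with $u\ge w$ and $v\ge w$ (for the quotient graph, $\ge$ is taken in that graph). A set $H\subseteq E^0$ is hereditary if $v\in H$, $v\ge w$ imply $w\in H$; a hereditary set is saturated if for every regular vertex $v$, $r(s^{-1}(v))\subseteq H$ implies $v\in H$. For $H$ hereditary saturated, $B_H$ (the breaking vertices) is the set of infinite emitters $w\in E^0\setminus H$ with $0<|s^{-1}(w)\cap r^{-1}(E^0\setminus H)|<\infty$. An admissible pair is $(H,S)$ with $H$ hereditary saturated and $S\subseteq B_H$; $(H_1,S_1)\le'(H_2,S_2)$ means $H_1\subseteq H_2$ and $S_1\subseteq H_2\cup S_2$. The quotient graph $E\backslash(H,S)$ has vertices $(E^0\setminus H)\cup\{v':v\in B_H\setminus S\}$ and edges $\{e\in E^1:r(e)\notin H\}\cup\{e':e\in E^1,\ r(e)\in B_H\setminus S\}$, with $r,s$ as in $E$ on the edges $e$, and $s(e')=s(e)$, $r(e')=r(e)'$. Ideals are two-sided and, by convention, proper. A proper ideal $P$ is prime if for all two-sided ideals $A,B$, $AB\subseteq P$ implies $A\subseteq P$ or $B\subseteq P$. *)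

theory Defs
  imports
    "HOL-Algebra.Ideal_Product"
    "HOL-Algebra.QuotRing"
    "HOL-Algebra.Module"
    "HOL-Library.Poly_Mapping"
    "Graph_Theory.Arc_Walk"
begin

section \<open>Graphs\<close>

text \<open>
  Directed graphs are the multigraphs \<^typ>\<open>('v, 'e) pre_digraph\<close> of \<^theory>\<open>Graph_Theory.Digraph\<close>
  satisfying \<^const>\<open>wf_digraph\<close>: \<open>E\<^sup>0\<close> is \<^const>\<open>verts\<close>, \<open>E\<^sup>1\<close> is \<^const>\<open>arcs\<close>, the source map
  is \<^const>\<open>tail\<close> and the range map is \<^const>\<open>head\<close>. No finiteness is assumed. Paths are arc walks,
  where the empty walk at a vertex plays the role of the path of length \<open>0\<close>.
\<close>

definition regular_vertex :: "('v, 'e) pre_digraph \<Rightarrow> 'v \<Rightarrow> bool" where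
  "regular_vertex E v \<longleftrightarrow> v \<in> verts E \<and> finite (out_arcs E v) \<and> out_arcs E v \<noteq> {}"

definition infinite_emitter :: "('v, 'e) pre_digraph \<Rightarrow> 'v \<Rightarrow> bool" where
  "infinite_emitter E v \<longleftrightarrow> v \<in> verts E \<and> infinite (out_arcs E v)"

text \<open>\<open>path_ge E u v\<close> is \<open>u \<ge> v\<close>.\<close>

definition path_ge :: "('v, 'e) pre_digraph \<Rightarrow> 'v \<Rightarrow> 'v \<Rightarrow> bool" where
  "path_ge E u v \<longleftrightarrow> (\<exists>p. pre_digraph.awalk E u p v)"

definition simple_closed_path :: "('v, 'e) pre_digraph \<Rightarrow> 'v \<Rightarrow> 'e list \<Rightarrow> bool" where
  "simple_closed_path E v c \<longleftrightarrow>
     c \<noteq> [] \<and> pre_digraph.awalk E v c v \<and> (\<forall>e \<in> set (tl c). tail E e \<noteq> v)"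

definition condition_K :: "('v, 'e) pre_digraph \<Rightarrow> bool" where
  "condition_K E \<longleftrightarrow>
     (\<forall>v c. simple_closed_path E v c \<longrightarrow> (\<exists>c'. c' \<noteq> c \<and> simple_closed_path E v c'))"

definition downward_directed :: "('v, 'e) pre_digraph \<Rightarrow> 'v set \<Rightarrow> bool" where
  "downward_directed E D \<longleftrightarrow> (\<forall>u\<in>D. \<forall>v\<in>D. \<exists>w\<in>D. path_ge E u w \<and> path_ge E v w)"

definition hereditary :: "('v, 'e) pre_digraph \<Rightarrow> 'v set \<Rightarrow> bool" where
  "hereditary E H \<longleftrightarrow> H \<subseteq> verts E \<and> (\<forall>v\<in>H. \<forall>w. path_ge E v w \<longrightarrow> w \<in> H)"

definition saturated :: "('v, 'e) pre_digraph \<Rightarrow> 'v set \<Rightarrow> bool" where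
  "saturated E H \<longleftrightarrow> (\<forall>v. regular_vertex E v \<and> head E ` out_arcs E v \<subseteq> H \<longrightarrow> v \<in> H)"

definition breaking_vertices :: "('v, 'e) pre_digraph \<Rightarrow> 'v set \<Rightarrow> 'v set" where
  "breaking_vertices E H =
     {w \<in> verts E - H. infinite_emitter E w \<and>
        finite {e \<in> out_arcs E w. head E e \<in> verts E - H} \<and>
        {e \<in> out_arcs E w. head E e \<in> verts E - H} \<noteq> {}}"

definition admissible_pairs :: "('v, 'e) pre_digraph \<Rightarrow> ('v set \<times> 'v set) set" where
  "admissible_pairs E = {(H, S). hereditary E H \<and> saturated E H \<and> S \<subseteq> breaking_vertices E H}"

fun pair_le :: "'v set \<times> 'v set \<Rightarrow> 'v set \<times> 'v set \<Rightarrow> bool" where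
  "pair_le (H1, S1) (H2, S2) \<longleftrightarrow> H1 \<subseteq> H2 \<and> S1 \<subseteq> H2 \<union> S2"

text \<open>\<^const>\<open>Inl\<close> tags the vertices and edges inherited from \<open>E\<close>, \<^const>\<open>Inr\<close> the new ones
  \<open>v'\<close> and \<open>e'\<close>.\<close>

definition quotient_graph ::
    "('v, 'e) pre_digraph \<Rightarrow> 'v set \<Rightarrow> 'v set \<Rightarrow> ('v + 'v, 'e + 'e) pre_digraph" where
  "quotient_graph E H S =
     \<lparr>verts = Inl ` (verts E - H) \<union> Inr ` (breaking_vertices E H - S),
      arcs = Inl ` {e \<in> arcs E. head E e \<notin> H}
           \<union> Inr ` {e \<in> arcs E. head E e \<in> breaking_vertices E H - S},
      tail = case_sum (\<lambda>e. Inl (tail E e)) (\<lambda>e. Inl (tail E e)),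
      head = case_sum (\<lambda>e. Inl (head E e)) (\<lambda>e. Inr (head E e))\<rparr>"


section \<open>Ideals in not necessarily unital rings\<close>

text \<open>
  The locale \<^locale>\<open>ideal\<close> of \<open>HOL-Algebra\<close> requires a ring with unit. The notions below make
  sense for any ring record and never refer to its \<^const>\<open>one\<close> field.
\<close>

definition two_sided_ideal :: "'a set \<Rightarrow> ('a, 'm) ring_scheme \<Rightarrow> bool" where
  "two_sided_ideal I R \<longleftrightarrow> additive_subgroup I R \<and>
     (\<forall>a\<in>I. \<forall>x\<in>carrier R. x \<otimes>\<^bsub>R\<^esub> a \<in> I \<and> a \<otimes>\<^bsub>R\<^esub> x \<in> I)"

definition proper_ideal :: "'a set \<Rightarrow> ('a, 'm) ring_scheme \<Rightarrow> bool" where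
  "proper_ideal I R \<longleftrightarrow> two_sided_ideal I R \<and> I \<noteq> carrier R"

definition prime_ideal :: "'a set \<Rightarrow> ('a, 'm) ring_scheme \<Rightarrow> bool" where
  "prime_ideal P R \<longleftrightarrow> proper_ideal P R \<and>
     (\<forall>A B. two_sided_ideal A R \<and> two_sided_ideal B R \<and> ideal_prod R A B \<subseteq> P \<longrightarrow> A \<subseteq> P \<or> B \<subseteq> P)"

definition algebra_ideal :: "'a set \<Rightarrow> ('k, 'a) module \<Rightarrow> bool" where
  "algebra_ideal I A \<longleftrightarrow> two_sided_ideal I A \<and> (\<forall>c. \<forall>x\<in>I. c \<odot>\<^bsub>A\<^esub> x \<in> I)"

definition internal_direct_sum ::
    "('a, 'm) ring_scheme \<Rightarrow> 'a set \<Rightarrow> ('i \<Rightarrow> 'a set) \<Rightarrow> bool" where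
  "internal_direct_sum R I C \<longleftrightarrow>
     I = {finsum R x N | x N. finite N \<and> x \<in> (\<Pi> n\<in>N. C n)} \<and>
     (\<forall>x N. finite N \<and> x \<in> (\<Pi> n\<in>N. C n) \<and> finsum R x N = \<zero>\<^bsub>R\<^esub> \<longrightarrow> (\<forall>n\<in>N. x n = \<zero>\<^bsub>R\<^esub>))"


section \<open>The free algebra\<close>

text \<open>
  Words under concatenation, written additively because multiplication of
  \<^typ>\<open>'a \<Rightarrow>\<^sub>0 'b\<close> is convolution along the additive structure of \<^typ>\<open>'a\<close>.
\<close>

datatype 'g word = Word (letters: "'g list")

instantiation word :: (type) monoid_add
begin

definition zero_word :: "'a word" where "0 = Word []"

definition plus_word :: "'a word \<Rightarrow> 'a word \<Rightarrow> 'a word" where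
  "u + w = Word (letters u @ letters w)"

instance
  by standard (simp_all add: zero_word_def plus_word_def)

end

text \<open>
  The free associative algebra without unit over the field \<^typ>\<open>'k\<close> on the set \<open>G\<close>: its elements
  are the linear combinations of nonempty words in \<open>G\<close>. The \<^const>\<open>one\<close> field of the record is
  meaningless.
\<close>

definition free_algebra :: "'g set \<Rightarrow> ('k::field, 'g word \<Rightarrow>\<^sub>0 'k) module" where
  "free_algebra G =
     \<lparr>carrier = {f. \<forall>w \<in> Poly_Mapping.keys f. letters w \<noteq> [] \<and> set (letters w) \<subseteq> G},
      mult = (*), one = undefined, zero = 0, add = (+),
      smult = (\<lambda>c. Poly_Mapping.map ((*) c))\<rparr>"

text \<open>
  The quotient of \<open>A\<close> by an ideal \<open>J\<close>, built from the same operations on cosets as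
  \<^const>\<open>FactRing\<close>.
\<close>

definition quotient_algebra :: "('k, 'a) module \<Rightarrow> 'a set \<Rightarrow> ('k, 'a set) module" where
  "quotient_algebra A J =
     \<lparr>carrier = a_rcosets\<^bsub>A\<^esub> J, mult = rcoset_mult A J, one = undefined, zero = J,
      add = set_add A, smult = (\<lambda>c B. \<Union>x\<in>B. J +>\<^bsub>A\<^esub> (c \<odot>\<^bsub>A\<^esub> x))\<rparr>"


section \<open>Leavitt path algebras\<close>

datatype ('v, 'e) lpa_gen = Vert 'v | Edge 'e | Ghost 'e

definition lpa_gens :: "('v, 'e) pre_digraph \<Rightarrow> ('v, 'e) lpa_gen set" where
  "lpa_gens E = Vert ` verts E \<union> Edge ` arcs E \<union> Ghost ` arcs E"

definition gen :: "'g \<Rightarrow> ('g word \<Rightarrow>\<^sub>0 'k::field)" where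
  "gen x = Poly_Mapping.single (Word [x]) 1"

text \<open>A relation \<open>a = b\<close> is represented by the element \<open>a - b\<close> of the free algebra.\<close>

inductive_set lpa_relations ::
    "('v, 'e) pre_digraph \<Rightarrow> (('v, 'e) lpa_gen word \<Rightarrow>\<^sub>0 'k::field) set"
  for E :: "('v, 'e) pre_digraph" where
  vertex_idem: "v \<in> verts E \<Longrightarrow> gen (Vert v) * gen (Vert v) - gen (Vert v) \<in> lpa_relations E"
| vertex_orth: "u \<in> verts E \<Longrightarrow> v \<in> verts E \<Longrightarrow> u \<noteq> v \<Longrightarrow>
    gen (Vert u) * gen (Vert v) \<in> lpa_relations E"
| edge_source: "e \<in> arcs E \<Longrightarrow> gen (Vert (tail E e)) * gen (Edge e) - gen (Edge e) \<in> lpa_relations E"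
| edge_range: "e \<in> arcs E \<Longrightarrow> gen (Edge e) * gen (Vert (head E e)) - gen (Edge e) \<in> lpa_relations E"
| ghost_range: "e \<in> arcs E \<Longrightarrow> gen (Vert (head E e)) * gen (Ghost e) - gen (Ghost e) \<in> lpa_relations E"
| ghost_source: "e \<in> arcs E \<Longrightarrow> gen (Ghost e) * gen (Vert (tail E e)) - gen (Ghost e) \<in> lpa_relations E"
| CK1_same: "e \<in> arcs E \<Longrightarrow> gen (Ghost e) * gen (Edge e) - gen (Vert (head E e)) \<in> lpa_relations E"
| CK1_distinct: "e \<in> arcs E \<Longrightarrow> f \<in> arcs E \<Longrightarrow> e \<noteq> f \<Longrightarrow>
    gen (Ghost e) * gen (Edge f) \<in> lpa_relations E"
| CK2: "regular_vertex E v \<Longrightarrow>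
    gen (Vert v) - (\<Sum>e\<in>out_arcs E v. gen (Edge e) * gen (Ghost e)) \<in> lpa_relations E"

text \<open>
  The ideal generated by the relations. Closure under scalars has to be demanded separately, since
  the free algebra has no unit. For well-formed \<open>E\<close> the relations lie in the free algebra, so
  that the whole carrier is one of the ideals intersected here.
\<close>

definition lpa_ideal :: "('v, 'e) pre_digraph \<Rightarrow> (('v, 'e) lpa_gen word \<Rightarrow>\<^sub>0 'k::field) set" where
  "lpa_ideal E = (\<lambda>I. algebra_ideal I (free_algebra (lpa_gens E))) hull lpa_relations E"

text \<open>The first argument only serves to fix the field of coefficients.\<close>

definition leavitt_path_algebra ::
    "'k itself \<Rightarrow> ('v, 'e) pre_digraph \<Rightarrow> ('k::field, (('v, 'e) lpa_gen word \<Rightarrow>\<^sub>0 'k) set) module" where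
  "leavitt_path_algebra K E = quotient_algebra (free_algebra (lpa_gens E)) (lpa_ideal E)"

fun lpa_gen_degree :: "('v, 'e) lpa_gen \<Rightarrow> int" where
  "lpa_gen_degree (Vert v) = 0"
| "lpa_gen_degree (Edge e) = 1"
| "lpa_gen_degree (Ghost e) = -1"

definition word_degree :: "('v, 'e) lpa_gen word \<Rightarrow> int" where
  "word_degree w = (\<Sum>x\<leftarrow>letters w. lpa_gen_degree x)"

text \<open>\<open>L\<^sub>n\<close> is the image of the linear span of the words of degree \<open>n\<close>.\<close>

definition lpa_component ::
    "'k itself \<Rightarrow> ('v, 'e) pre_digraph \<Rightarrow> int \<Rightarrow> (('v, 'e) lpa_gen word \<Rightarrow>\<^sub>0 'k::field) set set" where
  "lpa_component K E n =
     (\<lambda>f. lpa_ideal E +>\<^bsub>free_algebra (lpa_gens E)\<^esub> f) `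
       {f \<in> carrier (free_algebra (lpa_gens E)). \<forall>w \<in> Poly_Mapping.keys f. word_degree w = n}"

definition graded_ideal ::
    "'k itself \<Rightarrow> ('v, 'e) pre_digraph \<Rightarrow> (('v, 'e) lpa_gen word \<Rightarrow>\<^sub>0 'k::field) set set \<Rightarrow> bool" where
  "graded_ideal K E I \<longleftrightarrow>
     internal_direct_sum (leavitt_path_algebra K E) I (\<lambda>n. I \<inter> lpa_component K E n)"

end

theory Submission
  imports Defs
begin

text \<open>
  The core is a reduction theorem. Write \<open>v\<^sup>H\<close> for the difference of \<open>v\<close> and the sum of the \<open>e e\<^sup>*\<close>
  with \<open>s(e) = v\<close> and \<open>r(e) \<notin> H\<close>. Let \<open>I \<subseteq> B\<close> be ideals and \<open>(H, S)\<close> an admissible pair such that \<open>I\<close>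
  contains \<open>H\<close> and all \<open>v\<^sup>H\<close> with \<open>v \<in> S\<close>. If every closed path outside \<open>H\<close> has an exit outside
  \<open>H\<close>, which Condition (K) guarantees, then \<open>B \<noteq> I\<close> forces \<open>B\<close> to contain a vertex outside
  \<open>H\<close> or some \<open>v\<^sup>H\<close> with \<open>v \<notin> S\<close>. Every ideal \<open>I\<close> determines the pair of all vertices \<open>v\<close> and
  elements \<open>v\<^sup>H\<close> that it contains. For this pair, the theorem applied to \<open>I\<close> and the largest graded
  ideal inside \<open>I\<close> shows that \<open>I\<close> is graded; applied to \<open>I \<inter> J \<subseteq> I\<close> it compares two ideals by
  their pairs; applied to \<open>I \<subseteq> A + I\<close> and \<open>I \<subseteq> B + I\<close> with \<open>A B \<subseteq> I\<close> it shows, by downward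
  directedness, that \<open>I\<close> is prime.

  Conversely, if all ideals are prime they form a chain, as \<open>I J \<subseteq> I \<inter> J\<close>. Representations on
  boundary paths show that every admissible pair is the pair of some ideal, so that the admissible
  pairs form a chain, too; conditions (ii) and (iii) follow from this by pure graph theory. If \<open>v\<close>
  is the base of only one simple closed path \<open>c\<close>, a representation in which \<open>c\<close> acts as an
  involution has a kernel that contains \<open>v - c\<^sup>2\<close> but not \<open>v\<close>, hence is not graded, and that
  contains \<open>(v + c) L (v - c)\<close> but neither factor, hence is not prime.
\<close>

section \<open>The free algebra\<close>

text \<open>The classical route identifies quotients by graded ideals with Leavitt path algebras of
  quotient graphs. Here no quotient is formed: the reduction theorem is relative to an ideal
  \<open>I\<close> containing the vertices of \<open>H\<close>. Exits must survive the removal of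
  \<open>H\<close>, and Condition (K) provides this for all hereditary \<open>H\<close> at once.

  The elements \<open>v\<^sup>H\<close> are forced by infinite emitters. Multiplying on the right by
  edges removes ghosts, but edges into \<open>H\<close> lie in \<open>I\<close>, and
  \<open>v\<^sup>H\<close> annihilates the finitely many others. At a regular vertex the
  Cuntz-Krieger relation puts \<open>v\<^sup>H\<close> into \<open>I\<close>; at an infinite emitter
  nothing does.

  Relations show that elements lie in an ideal, never that they do not. Hence ideals with a
  prescribed pair and non-graded ideals are obtained as kernels of representations, where
  non-membership is a computation.

  Without a unit, ring ideals are not subspaces by definition. Finite sums of vertices serve as
  local units: they supply scalars, and a vertex \<open>w\<close> such that \<open>a w\<close> stays
  outside an ideal when \<open>a\<close> does.\<close>

definition scal :: "'k::field \<Rightarrow> 'g word \<Rightarrow>\<^sub>0 'k" where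
  "scal c = Poly_Mapping.single 0 c"

lemma letters_plus [simp]: "letters (u + w) = letters u @ letters w"
  by (simp add: plus_word_def)

lemma letters_zero [simp]: "letters 0 = []"
  by (simp add: zero_word_def)

lemma scal_add: "scal (c + d) = scal c + scal d"
  by (simp add: scal_def single_add)

lemma scal_mult: "scal (c * d) = scal c * scal d"
  by (simp add: scal_def mult_single)

lemma scal_0 [simp]: "scal 0 = 0"
  by (simp add: scal_def)

lemma scal_1 [simp]: "scal 1 = 1"
  by (simp add: scal_def)

lemma poly_mapping_eq_sum_single:
  "f = (\<Sum>w\<in>Poly_Mapping.keys f. Poly_Mapping.single w (Poly_Mapping.lookup f w))"
proof (rule poly_mapping_eqI)
  fix v
  show "Poly_Mapping.lookup f v =
    Poly_Mapping.lookup (\<Sum>w\<in>Poly_Mapping.keys f. Poly_Mapping.single w (Poly_Mapping.lookup f w)) v"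
    by (auto simp: lookup_sum lookup_single when_def sum.delta in_keys_iff)
qed

lemma scal_commute: "f * scal c = scal c * f"
proof -
  have "Poly_Mapping.single w d * scal c = scal c * Poly_Mapping.single w d" for w :: "'a word" and d
    by (simp add: scal_def mult_single mult.commute)
  then show ?thesis
    by (subst (1 2) poly_mapping_eq_sum_single[of f])
       (simp only: sum_distrib_left sum_distrib_right)
qed

lemma scal_mult_left_commute: "f * (scal c * g) = scal c * (f * g)"
  by (metis mult.assoc scal_commute)

text \<open>The empty word is not in the free algebra, but \<open>scal c\<close> is an element of
  the ambient ring; scalar multiplication thereby becomes a product and obeys the ring laws.\<close>

lemma smult_free_algebra: "c \<odot>\<^bsub>free_algebra X\<^esub> f = scal c * f"
  by (simp add: free_algebra_def scal_def mult_map_scale_conv_mult)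

lemma single_Word_Cons:
  "Poly_Mapping.single (Word (x # xs)) c = gen x * Poly_Mapping.single (Word xs) c"
  by (simp add: gen_def mult_single plus_word_def)

lemma single_Word_single: "Poly_Mapping.single (Word [x]) c = scal c * gen x"
  by (simp add: gen_def scal_def mult_single)

lemma in_free_algebra_iff:
  "f \<in> carrier (free_algebra X) \<longleftrightarrow>
    (\<forall>w \<in> Poly_Mapping.keys f. letters w \<noteq> [] \<and> set (letters w) \<subseteq> X)"
  by (simp add: free_algebra_def)

lemma free_algebra_ops:
  "add (free_algebra X) = (+)" "mult (free_algebra X) = (*)" "zero (free_algebra X) = 0"
  by (simp_all add: free_algebra_def)

lemma free_algebra_zero: "0 \<in> carrier (free_algebra X)"
  by (simp add: in_free_algebra_iff)

lemma free_algebra_add: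
  "f \<in> carrier (free_algebra X) \<Longrightarrow> g \<in> carrier (free_algebra X) \<Longrightarrow> f + g \<in> carrier (free_algebra X)"
  using keys_add[of f g] by (auto simp: in_free_algebra_iff)

lemma free_algebra_uminus:
  "f \<in> carrier (free_algebra X) \<Longrightarrow> - f \<in> carrier (free_algebra X)"
  by (simp add: in_free_algebra_iff in_keys_iff)

lemma free_algebra_diff:
  "f \<in> carrier (free_algebra X) \<Longrightarrow> g \<in> carrier (free_algebra X) \<Longrightarrow> f - g \<in> carrier (free_algebra X)"
  using free_algebra_add[of f X "- g"] free_algebra_uminus[of g] by auto

lemma free_algebra_mult:
  assumes "f \<in> carrier (free_algebra X)" "g \<in> carrier (free_algebra X)"
  shows "f * g \<in> carrier (free_algebra X)"
  unfolding in_free_algebra_iff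
proof
  fix w assume "w \<in> Poly_Mapping.keys (f * g)"
  then obtain u v where "w = u + v" "u \<in> Poly_Mapping.keys f" "v \<in> Poly_Mapping.keys g"
    using keys_mult[of f g] by blast
  with assms show "letters w \<noteq> [] \<and> set (letters w) \<subseteq> X"
    by (auto simp: in_free_algebra_iff)
qed

lemma free_algebra_scal:
  assumes "f \<in> carrier (free_algebra X)"
  shows "scal c * f \<in> carrier (free_algebra X)"
  unfolding in_free_algebra_iff
proof
  fix w assume "w \<in> Poly_Mapping.keys (scal c * f)"
  then obtain u v where "w = u + v" "u \<in> Poly_Mapping.keys (scal c :: 'a word \<Rightarrow>\<^sub>0 'b)" "v \<in> Poly_Mapping.keys f"
    using keys_mult[of "scal c" f] by blast
  with assms show "letters w \<noteq> [] \<and> set (letters w) \<subseteq> X"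
    by (auto simp: in_free_algebra_iff scal_def split: if_splits)
qed

lemma free_algebra_sum:
  "(\<And>i. i \<in> A \<Longrightarrow> f i \<in> carrier (free_algebra X)) \<Longrightarrow> sum f A \<in> carrier (free_algebra X)"
  by (induction A rule: infinite_finite_induct) (auto simp: free_algebra_zero free_algebra_add)

lemma free_algebra_gen: "x \<in> X \<Longrightarrow> gen x \<in> carrier (free_algebra X)"
  by (simp add: in_free_algebra_iff gen_def)

lemmas free_algebra_closed = free_algebra_zero free_algebra_add free_algebra_uminus
  free_algebra_diff free_algebra_mult free_algebra_scal free_algebra_gen

text \<open>Words are built from the left, one letter at a time. With no unit in the algebra, the
  induction starts from single generators instead of the empty word.\<close>

lemma free_algebra_induct [consumes 1, case_names zero add scal gen mult]:
  assumes f: "f \<in> carrier (free_algebra X)"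
    and zero: "P 0"
    and add: "\<And>f g. P f \<Longrightarrow> P g \<Longrightarrow> P (f + g)"
    and scal: "\<And>c f. f \<in> carrier (free_algebra X) \<Longrightarrow> P f \<Longrightarrow> P (scal c * f)"
    and gen: "\<And>x. x \<in> X \<Longrightarrow> P (gen x)"
    and mult: "\<And>x f. x \<in> X \<Longrightarrow> f \<in> carrier (free_algebra X) \<Longrightarrow> P f \<Longrightarrow> P (gen x * f)"
  shows "P f"
proof -
  have word: "P (Poly_Mapping.single (Word xs) c)" if "xs \<noteq> []" "set xs \<subseteq> X" for xs c
    using that
  proof (induction xs)
    case (Cons x xs)
    show ?case
    proof (cases "xs = []")
      case True
      then show ?thesis
        using Cons by (auto simp: single_Word_single intro!: scal gen free_algebra_gen)
    next
      case False
      then have "Poly_Mapping.single (Word xs) c \<in> carrier (free_algebra X)"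
        using Cons.prems by (auto simp: in_free_algebra_iff)
      then show ?thesis
        using Cons False by (auto simp: single_Word_Cons intro!: mult)
    qed
  qed simp
  have "P (\<Sum>w\<in>S. Poly_Mapping.single w (Poly_Mapping.lookup f w))"
    if "finite S" "S \<subseteq> Poly_Mapping.keys f" for S
    using that
  proof (induction S)
    case (insert w S)
    then have "P (Poly_Mapping.single w (Poly_Mapping.lookup f w))"
      using f word[of "letters w" "Poly_Mapping.lookup f w"] by (auto simp: in_free_algebra_iff)
    with insert show ?case by (auto intro: add)
  qed (simp add: zero)
  then show ?thesis
    by (metis finite_keys order_refl poly_mapping_eq_sum_single)
qed

lemma abelian_group_free_algebra: "abelian_group (free_algebra X)"
proof (rule abelian_groupI)
  show "\<And>x. x \<in> carrier (free_algebra X) \<Longrightarrow>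
    \<exists>y\<in>carrier (free_algebra X). y \<oplus>\<^bsub>free_algebra X\<^esub> x = \<zero>\<^bsub>free_algebra X\<^esub>"
    by (metis ab_left_minus free_algebra_ops(1,3) free_algebra_uminus)
qed (auto simp: free_algebra_ops free_algebra_closed algebra_simps)

lemma a_inv_free_algebra:
  assumes "f \<in> carrier (free_algebra X)"
  shows "\<ominus>\<^bsub>free_algebra X\<^esub> f = - f"
  by (rule abelian_group.minus_equality[OF abelian_group_free_algebra])
     (use assms in \<open>auto simp: free_algebra_ops free_algebra_closed\<close>)

lemma additive_subgroup_iff:
  assumes "abelian_group R"
  shows "additive_subgroup I R \<longleftrightarrow> I \<subseteq> carrier R \<and> \<zero>\<^bsub>R\<^esub> \<in> I \<and>
    (\<forall>x\<in>I. \<forall>y\<in>I. x \<oplus>\<^bsub>R\<^esub> y \<in> I) \<and> (\<forall>x\<in>I. \<ominus>\<^bsub>R\<^esub> x \<in> I)"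
  unfolding additive_subgroup_def subgroup_def by (auto simp: a_inv_def)

lemma two_sided_ideal_free_algebra_iff:
  "two_sided_ideal I (free_algebra X) \<longleftrightarrow>
    I \<subseteq> carrier (free_algebra X) \<and> 0 \<in> I \<and> (\<forall>x\<in>I. \<forall>y\<in>I. x + y \<in> I) \<and> (\<forall>x\<in>I. - x \<in> I) \<and>
    (\<forall>a\<in>I. \<forall>x\<in>carrier (free_algebra X). x * a \<in> I \<and> a * x \<in> I)"
  unfolding two_sided_ideal_def additive_subgroup_iff[OF abelian_group_free_algebra]
  by (auto simp: free_algebra_ops a_inv_free_algebra subset_iff)

section \<open>The defining relations and the congruence modulo them\<close>

text \<open>The parameter \<open>K\<close> only fixes the field of coefficients.\<close>

locale lpa = wf_digraph E for E :: "('v, 'e) pre_digraph" +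
  fixes K :: "'k::field itself"
begin

abbreviation alg :: "(('v, 'e) lpa_gen word \<Rightarrow>\<^sub>0 'k) set" where
  "alg \<equiv> carrier (free_algebra (lpa_gens E))"

abbreviation rel :: "(('v, 'e) lpa_gen word \<Rightarrow>\<^sub>0 'k) set" where
  "rel \<equiv> lpa_ideal E"

abbreviation vt :: "'v \<Rightarrow> ('v, 'e) lpa_gen word \<Rightarrow>\<^sub>0 'k" where
  "vt v \<equiv> gen (Vert v)"
abbreviation ed :: "'e \<Rightarrow> ('v, 'e) lpa_gen word \<Rightarrow>\<^sub>0 'k" where
  "ed e \<equiv> gen (Edge e)"
abbreviation gh :: "'e \<Rightarrow> ('v, 'e) lpa_gen word \<Rightarrow>\<^sub>0 'k" where
  "gh e \<equiv> gen (Ghost e)"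

lemma vt_alg [simp]: "v \<in> verts E \<Longrightarrow> vt v \<in> alg"
  by (simp add: free_algebra_gen lpa_gens_def)

lemma ed_alg [simp]: "e \<in> arcs E \<Longrightarrow> ed e \<in> alg"
  by (simp add: free_algebra_gen lpa_gens_def)

lemma gh_alg [simp]: "e \<in> arcs E \<Longrightarrow> gh e \<in> alg"
  by (simp add: free_algebra_gen lpa_gens_def)

lemmas alg_closed [simp] =
  free_algebra_zero[of "lpa_gens E"] free_algebra_add[of _ "lpa_gens E"]
  free_algebra_uminus[of _ "lpa_gens E"] free_algebra_diff[of _ "lpa_gens E"]
  free_algebra_mult[of _ "lpa_gens E"] free_algebra_scal[of _ "lpa_gens E"]

lemmas alg_sum = free_algebra_sum[of _ _ "lpa_gens E"]

lemma relations_subset_alg: "lpa_relations E \<subseteq> alg"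
proof
  fix x :: "('v, 'e) lpa_gen word \<Rightarrow>\<^sub>0 'k"
  assume "x \<in> lpa_relations E"
  then show "x \<in> alg"
  proof cases
    case (CK2 v)
    then show ?thesis
      by (auto simp: regular_vertex_def out_arcs_def intro!: alg_closed alg_sum)
  qed auto
qed

lemma algebra_ideal_rel: "algebra_ideal rel (free_algebra (lpa_gens E))"
proof -
  let ?P = "\<lambda>I. algebra_ideal I (free_algebra (lpa_gens E) :: ('k, ('v, 'e) lpa_gen word \<Rightarrow>\<^sub>0 'k) module)"
  have alg_ideal: "?P alg"
    by (auto simp: algebra_ideal_def two_sided_ideal_free_algebra_iff smult_free_algebra)
  have mem: "x \<in> rel \<longleftrightarrow> (\<forall>I. ?P I \<longrightarrow> lpa_relations E \<subseteq> I \<longrightarrow> x \<in> I)"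
    for x :: "('v, 'e) lpa_gen word \<Rightarrow>\<^sub>0 'k"
    unfolding lpa_ideal_def hull_def by blast
  have P: "?P I \<longleftrightarrow> I \<subseteq> alg \<and> 0 \<in> I \<and> (\<forall>x\<in>I. \<forall>y\<in>I. x + y \<in> I) \<and> (\<forall>x\<in>I. - x \<in> I) \<and>
    (\<forall>a\<in>I. \<forall>x\<in>alg. x * a \<in> I \<and> a * x \<in> I) \<and> (\<forall>c. \<forall>x\<in>I. scal c * x \<in> I)" for I
    unfolding algebra_ideal_def two_sided_ideal_free_algebra_iff smult_free_algebra by blast
  have inI: "x \<in> rel" if "\<And>I. ?P I \<Longrightarrow> rel \<subseteq> I \<Longrightarrow> x \<in> I" for x
  proof -
    have "rel \<subseteq> I" if "?P I" "lpa_relations E \<subseteq> I" for I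
      using that mem by (simp add: subset_iff)
    then show ?thesis
      by (subst mem) (simp add: that)
  qed
  have "rel \<subseteq> alg"
    using mem alg_ideal relations_subset_alg by (metis subsetI)
  moreover have "0 \<in> rel"
    by (rule inI) (simp add: P)
  moreover have "x + y \<in> rel" if "x \<in> rel" "y \<in> rel" for x y
    by (rule inI) (use that in \<open>simp add: P subset_iff\<close>)
  moreover have "- x \<in> rel" if "x \<in> rel" for x
    by (rule inI) (use that in \<open>simp add: P subset_iff\<close>)
  moreover have "z * x \<in> rel \<and> x * z \<in> rel" if "x \<in> rel" "z \<in> alg" for x z
    by (intro conjI; rule inI) (use that in \<open>simp_all add: P subset_iff\<close>)
  moreover have "scal c * x \<in> rel" if "x \<in> rel" for x c
    by (rule inI) (use that in \<open>simp add: P subset_iff\<close>)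
  ultimately show ?thesis
    unfolding P by simp
qed

lemma rel_subset_alg: "rel \<subseteq> alg"
  and rel_0 [simp]: "0 \<in> rel"
  and rel_add: "x \<in> rel \<Longrightarrow> y \<in> rel \<Longrightarrow> x + y \<in> rel"
  and rel_uminus: "x \<in> rel \<Longrightarrow> - x \<in> rel"
  and rel_lmult: "x \<in> rel \<Longrightarrow> z \<in> alg \<Longrightarrow> z * x \<in> rel"
  and rel_rmult: "x \<in> rel \<Longrightarrow> z \<in> alg \<Longrightarrow> x * z \<in> rel"
  and rel_scal: "x \<in> rel \<Longrightarrow> scal c * x \<in> rel"
  using algebra_ideal_rel
  unfolding algebra_ideal_def two_sided_ideal_free_algebra_iff smult_free_algebra by blast+

lemma rel_diff: "x \<in> rel \<Longrightarrow> y \<in> rel \<Longrightarrow> x - y \<in> rel"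
  using rel_add[of x "- y"] rel_uminus[of y] by simp

lemma relation_in_rel: "x \<in> lpa_relations E \<Longrightarrow> x \<in> rel"
  unfolding lpa_ideal_def by (simp add: hull_inc)

text \<open>Replaces equality in the quotient, so that the associative and distributive laws stay
  true equalities of a ring type. Compatibility with products is claimed only for factors in
  \<open>alg\<close>, because \<open>rel\<close> is given as an ideal of \<open>alg\<close>.\<close>

definition eqv :: "(('v, 'e) lpa_gen word \<Rightarrow>\<^sub>0 'k) \<Rightarrow> (('v, 'e) lpa_gen word \<Rightarrow>\<^sub>0 'k) \<Rightarrow> bool"
    (infix "\<approx>" 50) where
  "x \<approx> y \<longleftrightarrow> x - y \<in> rel"

lemma eqv_refl [simp]: "x \<approx> x"
  by (simp add: eqv_def)

lemma eqv_sym: "x \<approx> y \<Longrightarrow> y \<approx> x"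
  using rel_uminus[of "x - y"] by (simp add: eqv_def)

lemma eqv_trans [trans]: "x \<approx> y \<Longrightarrow> y \<approx> z \<Longrightarrow> x \<approx> z"
  using rel_add[of "x - y" "y - z"] by (simp add: eqv_def)

lemma eqv_add: "x \<approx> y \<Longrightarrow> x' \<approx> y' \<Longrightarrow> x + x' \<approx> y + y'"
  using rel_add[of "x - y" "x' - y'"] by (simp add: eqv_def algebra_simps)

lemma eqv_diff: "x \<approx> y \<Longrightarrow> x' \<approx> y' \<Longrightarrow> x - x' \<approx> y - y'"
  using rel_diff[of "x - y" "x' - y'"] by (simp add: eqv_def algebra_simps)

lemma eqv_sum: "(\<And>i. i \<in> A \<Longrightarrow> f i \<approx> g i) \<Longrightarrow> sum f A \<approx> sum g A"
  by (induction A rule: infinite_finite_induct) (auto intro: eqv_add)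

lemma eqv_lmult: "x \<approx> y \<Longrightarrow> z \<in> alg \<Longrightarrow> z * x \<approx> z * y"
  using rel_lmult[of "x - y" z] by (simp add: eqv_def algebra_simps)

lemma eqv_rmult: "x \<approx> y \<Longrightarrow> z \<in> alg \<Longrightarrow> x * z \<approx> y * z"
  using rel_rmult[of "x - y" z] by (simp add: eqv_def algebra_simps)

lemma eqv_scal: "x \<approx> y \<Longrightarrow> scal c * x \<approx> scal c * y"
  using rel_scal[of "x - y" c] by (simp add: eqv_def algebra_simps)

lemma vt_idem: "v \<in> verts E \<Longrightarrow> vt v * vt v \<approx> vt v"
  and vt_orth: "u \<in> verts E \<Longrightarrow> v \<in> verts E \<Longrightarrow> u \<noteq> v \<Longrightarrow> vt u * vt v \<approx> 0"
  and vt_ed: "e \<in> arcs E \<Longrightarrow> vt (tail E e) * ed e \<approx> ed e"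
  and ed_vt: "e \<in> arcs E \<Longrightarrow> ed e * vt (head E e) \<approx> ed e"
  and vt_gh: "e \<in> arcs E \<Longrightarrow> vt (head E e) * gh e \<approx> gh e"
  and gh_vt: "e \<in> arcs E \<Longrightarrow> gh e * vt (tail E e) \<approx> gh e"
  and gh_ed: "e \<in> arcs E \<Longrightarrow> gh e * ed e \<approx> vt (head E e)"
  and gh_ed_distinct: "e \<in> arcs E \<Longrightarrow> f \<in> arcs E \<Longrightarrow> e \<noteq> f \<Longrightarrow> gh e * ed f \<approx> 0"
  and vt_sum: "regular_vertex E v \<Longrightarrow> vt v \<approx> (\<Sum>e\<in>out_arcs E v. ed e * gh e)"
  by (auto simp: eqv_def intro!: relation_in_rel lpa_relations.intros)

lemma vt_ed':
  assumes "e \<in> arcs E" "v \<in> verts E"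
  shows "vt v * ed e \<approx> (if v = tail E e then ed e else 0)"
proof (cases "v = tail E e")
  case False
  have "vt v * ed e \<approx> vt v * (vt (tail E e) * ed e)"
    using assms by (intro eqv_lmult eqv_sym[OF vt_ed]) auto
  also have "\<dots> = vt v * vt (tail E e) * ed e"
    by (simp add: mult.assoc)
  also have "\<dots> \<approx> 0 * ed e"
    using assms False by (intro eqv_rmult vt_orth) auto
  finally show ?thesis using False by simp
qed (use assms vt_ed in auto)

lemma gh_vt':
  assumes "e \<in> arcs E" "v \<in> verts E"
  shows "gh e * vt v \<approx> (if v = tail E e then gh e else 0)"
proof (cases "v = tail E e")
  case False
  have "gh e * vt v \<approx> (gh e * vt (tail E e)) * vt v"
    using assms by (intro eqv_rmult eqv_sym[OF gh_vt]) auto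
  also have "\<dots> = gh e * (vt (tail E e) * vt v)"
    by (simp add: mult.assoc)
  also have "\<dots> \<approx> gh e * 0"
    using assms False by (intro eqv_lmult vt_orth) auto
  finally show ?thesis using False by simp
qed (use assms gh_vt in auto)

section \<open>Paths, ghost paths and their products\<close>

primrec pth :: "'v \<Rightarrow> 'e list \<Rightarrow> ('v, 'e) lpa_gen word \<Rightarrow>\<^sub>0 'k" where
  "pth u [] = vt u"
| "pth u (e # p) = ed e * pth (head E e) p"

text \<open>The element \<open>p\<^sup>*\<close>: ghosts in reverse order. As in \<open>pth\<close>,
  the argument \<open>u\<close> gives the empty path a value, and the final vertex of the path
  remains as a factor.\<close>

primrec gth :: "'v \<Rightarrow> 'e list \<Rightarrow> ('v, 'e) lpa_gen word \<Rightarrow>\<^sub>0 'k" where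
  "gth u [] = vt u"
| "gth u (e # p) = gth (head E e) p * gh e"

lemma pth_alg [simp]: "awalk u p w \<Longrightarrow> pth u p \<in> alg"
  by (induction p arbitrary: u) (auto simp: awalk_simps)

lemma gth_alg [simp]: "awalk u p w \<Longrightarrow> gth u p \<in> alg"
  by (induction p arbitrary: u) (auto simp: awalk_simps)

lemma vt_pth:
  assumes "awalk u p w" "v \<in> verts E"
  shows "vt v * pth u p \<approx> (if v = u then pth u p else 0)"
proof (cases p)
  case Nil
  then show ?thesis using assms vt_idem vt_orth[of v u] by (auto simp: awalk_simps)
next
  case (Cons e q)
  with assms have *: "e \<in> arcs E" "tail E e = u" "awalk (head E e) q w"
    by (auto simp: awalk_simps)
  have "(vt v * ed e) * pth (head E e) q \<approx> (if v = u then ed e else 0) * pth (head E e) q"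
    using * vt_ed'[of e v] assms by (intro eqv_rmult) auto
  then show ?thesis using Cons by (auto simp: mult.assoc)
qed

lemma pth_append:
  assumes "awalk u p w" "awalk w q x"
  shows "pth u p * pth w q \<approx> pth u (p @ q)"
  using assms
proof (induction p arbitrary: u)
  case Nil
  then show ?case using vt_pth[of w q x w] by (auto simp: awalk_simps)
next
  case (Cons e p)
  then have "ed e * (pth (head E e) p * pth w q) \<approx> ed e * pth (head E e) (p @ q)"
    by (intro eqv_lmult Cons.IH) (auto simp: awalk_simps)
  then show ?case by (simp add: mult.assoc)
qed

lemma pth_vt:
  assumes "awalk u p w"
  shows "pth u p * vt w \<approx> pth u p"
  using pth_append[of u p w "[]" w] assms awalk_last_in_verts[of u p w]
  by (auto simp: awalk_simps)

text \<open>Common initial edges cancel by \<open>e\<^sup>* e = r(e)\<close>, and the first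
  difference gives \<open>e\<^sup>* f = 0\<close>; only the rest of the longer path can
  survive.\<close>

lemma gth_pth:
  assumes "awalk u p w" "awalk u q x" "length p \<le> length q"
  shows "gth u p * pth u q \<approx> (if take (length p) q = p then pth w (drop (length p) q) else 0)"
  using assms
proof (induction p arbitrary: u q)
  case Nil
  then show ?case using vt_pth[of u q x u] by (auto simp: awalk_simps)
next
  case (Cons e p)
  then obtain f q' where q: "q = f # q'" by (cases q) auto
  have *: "e \<in> arcs E" "f \<in> arcs E" "awalk (head E e) p w" "awalk (head E f) q' x"
    using Cons.prems q by (auto simp: awalk_simps)
  show ?case
  proof (cases "e = f")
    case True
    have "gth u (e # p) * pth u q = gth (head E e) p * ((gh e * ed e) * pth (head E e) q')"
      using q True by (simp add: mult.assoc)
    also have "\<dots> \<approx> gth (head E e) p * (vt (head E e) * pth (head E e) q')"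
      using * True by (intro eqv_lmult eqv_rmult gh_ed) auto
    also have "\<dots> \<approx> gth (head E e) p * pth (head E e) q'"
      using * True vt_pth[of "head E e" q' x "head E e"] by (intro eqv_lmult) auto
    also have "\<dots> \<approx> (if take (length p) q' = p then pth w (drop (length p) q') else 0)"
      using Cons.prems * q True by (intro Cons.IH) auto
    finally show ?thesis using q True by (simp split: if_splits)
  next
    case False
    have "gth u (e # p) * pth u q = gth (head E e) p * ((gh e * ed f) * pth (head E f) q')"
      using q by (simp add: mult.assoc)
    also have "\<dots> \<approx> gth (head E e) p * (0 * pth (head E f) q')"
      using * False by (intro eqv_lmult eqv_rmult gh_ed_distinct) auto
    finally show ?thesis using q False by auto
  qed
qed

lemma gth_vt:
  assumes "awalk u p w"
  shows "gth u p * vt u \<approx> gth u p"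
proof (cases p)
  case Nil
  then show ?thesis using assms vt_idem by (auto simp: awalk_simps)
next
  case (Cons e q)
  with assms have *: "e \<in> arcs E" "tail E e = u" "awalk (head E e) q w"
    by (auto simp: awalk_simps)
  have "gth (head E e) q * (gh e * vt u) \<approx> gth (head E e) q * gh e"
    using * gh_vt[of e] by (intro eqv_lmult) auto
  then show ?thesis using Cons by (auto simp: mult.assoc)
qed

text \<open>The ideals of the Leavitt path algebra are handled as their preimages in the free algebra, whose
  elements live in a ring type.\<close>

definition idl :: "(('v, 'e) lpa_gen word \<Rightarrow>\<^sub>0 'k) set \<Rightarrow> bool" where
  "idl I \<longleftrightarrow> rel \<subseteq> I \<and> two_sided_ideal I (free_algebra (lpa_gens E))"

lemma
  assumes "idl I"
  shows idl_rel: "rel \<subseteq> I"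
    and idl_alg: "I \<subseteq> alg"
    and idl_0: "0 \<in> I"
    and idl_add: "x \<in> I \<Longrightarrow> y \<in> I \<Longrightarrow> x + y \<in> I"
    and idl_uminus: "x \<in> I \<Longrightarrow> - x \<in> I"
    and idl_lmult: "x \<in> I \<Longrightarrow> z \<in> alg \<Longrightarrow> z * x \<in> I"
    and idl_rmult: "x \<in> I \<Longrightarrow> z \<in> alg \<Longrightarrow> x * z \<in> I"
  using assms unfolding idl_def two_sided_ideal_free_algebra_iff by simp_all

lemma idlI:
  assumes "rel \<subseteq> I" "I \<subseteq> alg" "\<And>x y. x \<in> I \<Longrightarrow> y \<in> I \<Longrightarrow> x + y \<in> I" "\<And>x. x \<in> I \<Longrightarrow> - x \<in> I"
    "\<And>x z. x \<in> I \<Longrightarrow> z \<in> alg \<Longrightarrow> z * x \<in> I" "\<And>x z. x \<in> I \<Longrightarrow> z \<in> alg \<Longrightarrow> x * z \<in> I"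
  shows "idl I"
  using assms rel_0 unfolding idl_def two_sided_ideal_free_algebra_iff by (simp add: subset_iff)

lemma idl_diff: "idl I \<Longrightarrow> x \<in> I \<Longrightarrow> y \<in> I \<Longrightarrow> x - y \<in> I"
  using idl_add[of I x "- y"] idl_uminus[of I y] by simp

lemma idl_sum: "idl I \<Longrightarrow> (\<And>i. i \<in> A \<Longrightarrow> f i \<in> I) \<Longrightarrow> sum f A \<in> I"
  by (induction A rule: infinite_finite_induct) (auto intro: idl_add idl_0)

lemma idl_eqv: "idl I \<Longrightarrow> x \<approx> y \<Longrightarrow> x \<in> I \<longleftrightarrow> y \<in> I"
proof -
  assume I: "idl I" and xy: "x \<approx> y"
  have 1: "x - y \<in> I" using idl_rel[OF I] xy by (auto simp: eqv_def)
  show ?thesis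
    using idl_add[OF I 1, of y] idl_diff[OF I _ 1, of x] by auto
qed

end

section \<open>Spanning sets\<close>

context lpa
begin

lemma eqv_alg: "a \<approx> b \<Longrightarrow> b \<in> alg \<Longrightarrow> a \<in> alg"
  using free_algebra_add[of "a - b" _ b] rel_subset_alg unfolding eqv_def by auto

text \<open>The last letter of a word ends at a vertex that fixes it from the right, while all other
  vertices kill it. Asking for every larger \<open>W'\<close> lets the sets of two summands be
  united.\<close>

lemma right_unit:
  assumes "a \<in> alg"
  shows "\<exists>W. finite W \<and> W \<subseteq> verts E \<and>
    (\<forall>W'. finite W' \<and> W \<subseteq> W' \<and> W' \<subseteq> verts E \<longrightarrow> a * (\<Sum>w\<in>W'. vt w) \<approx> a)"
  using assms
proof (induction rule: free_algebra_induct)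
  case zero
  show ?case by (intro exI[of _ "{}"]) auto
next
  case (add f g)
  from add.IH(1) obtain W1 where W1: "finite W1" "W1 \<subseteq> verts E"
    "\<forall>W'. finite W' \<and> W1 \<subseteq> W' \<and> W' \<subseteq> verts E \<longrightarrow> f * (\<Sum>w\<in>W'. vt w) \<approx> f"
    by (elim exE conjE)
  from add.IH(2) obtain W2 where W2: "finite W2" "W2 \<subseteq> verts E"
    "\<forall>W'. finite W' \<and> W2 \<subseteq> W' \<and> W' \<subseteq> verts E \<longrightarrow> g * (\<Sum>w\<in>W'. vt w) \<approx> g"
    by (elim exE conjE)
  have "(f + g) * (\<Sum>w\<in>W'. vt w) \<approx> f + g"
    if "finite W'" "W1 \<union> W2 \<subseteq> W'" "W' \<subseteq> verts E" for W'
    unfolding distrib_right using that W1(3) W2(3) by (intro eqv_add) auto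
  with W1 W2 show ?case
    by (intro exI[of _ "W1 \<union> W2"]) simp
next
  case (scal c f)
  then show ?case by (metis eqv_scal mult.assoc)
next
  case (gen x)
  define r where "r = (case x of Vert v \<Rightarrow> v | Edge e \<Rightarrow> head E e | Ghost e \<Rightarrow> tail E e)"
  have r: "r \<in> verts E"
    using gen by (auto simp: r_def lpa_gens_def)
  have x: "gen x \<in> alg" "gen x * vt r \<approx> gen x"
    using gen by (auto simp: r_def lpa_gens_def intro!: free_algebra_gen ed_vt gh_vt vt_idem)
  have ne: "gen x * vt w \<approx> 0" if "w \<in> verts E" "w \<noteq> r" for w
  proof -
    have "gen x * vt w \<approx> gen x * vt r * vt w"
      using x that by (intro eqv_rmult eqv_sym[OF x(2)]) auto
    also have "\<dots> = gen x * (vt r * vt w)" by (simp add: mult.assoc)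
    also have "\<dots> \<approx> gen x * 0"
      using x that r by (intro eqv_lmult vt_orth) auto
    finally show ?thesis by simp
  qed
  have "gen x * (\<Sum>w\<in>W'. vt w) \<approx> gen x" if W': "finite W'" "{r} \<subseteq> W'" "W' \<subseteq> verts E" for W'
  proof -
    have "gen x * (\<Sum>w\<in>W'. vt w) = (\<Sum>w\<in>W'. gen x * vt w)"
      by (simp add: sum_distrib_left)
    also have "\<dots> \<approx> (\<Sum>w\<in>W'. if w = r then gen x else 0)"
      using x ne W' by (intro eqv_sum) auto
    also have "\<dots> = gen x"
      using W' by (simp add: sum.delta)
    finally show ?thesis .
  qed
  with r show ?case by (intro exI[of _ "{r}"]) auto
next
  case (mult x f)
  then have "gen x \<in> alg" by (auto simp: free_algebra_gen)
  with mult show ?case by (metis eqv_lmult mult.assoc)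
qed

lemma not_in_idl_vertex:
  assumes I: "idl I" and a: "a \<in> alg" "a \<notin> I"
  obtains w where "w \<in> verts E" "a * vt w \<notin> I"
proof -
  obtain W where W: "W \<subseteq> verts E" "a * (\<Sum>w\<in>W. vt w) \<approx> a"
    using right_unit[OF a(1)] by blast
  have "(\<Sum>w\<in>W. a * vt w) \<notin> I"
    using idl_eqv[OF I W(2)] a(2) by (simp add: sum_distrib_left)
  then obtain w where "w \<in> W" "a * vt w \<notin> I"
    using idl_sum[OF I, of W "\<lambda>w. a * vt w"] by blast
  with W that show ?thesis by blast
qed

text \<open>\<open>rl w\<close> is the span of the paths ending in \<open>w\<close>.\<close>

inductive_set rl :: "'v \<Rightarrow> (('v, 'e) lpa_gen word \<Rightarrow>\<^sub>0 'k) set" for w where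
  zero: "a \<approx> 0 \<Longrightarrow> a \<in> rl w"
| step: "a \<in> rl w \<Longrightarrow> awalk u p w \<Longrightarrow> b \<approx> a + scal c * pth u p \<Longrightarrow> b \<in> rl w"

lemma rl_eqv: "a \<in> rl w \<Longrightarrow> b \<approx> a \<Longrightarrow> b \<in> rl w"
proof (erule rl.cases)
  show "a = x \<Longrightarrow> b \<approx> a \<Longrightarrow> x \<approx> 0 \<Longrightarrow> b \<in> rl w" for x
    using eqv_trans rl.zero by simp
  show "b \<approx> a \<Longrightarrow> a = y \<Longrightarrow> x \<in> rl w \<Longrightarrow> awalk u p w \<Longrightarrow> y \<approx> x + scal c * pth u p \<Longrightarrow> b \<in> rl w"
    for x u p y c
    by (rule rl.step[of x w u p b c]) (auto intro: eqv_trans)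
qed

lemma rl_add:
  assumes "a \<in> rl w" "b \<in> rl w"
  shows "a + b \<in> rl w"
  using assms(2)
proof induction
  case (zero b)
  then have "a + b \<approx> a" using eqv_add[of a a b 0] by simp
  then show ?case using assms(1) rl_eqv by blast
next
  case (step b u p b' c)
  then show ?case
    using eqv_add[of a a b' "b + scal c * pth u p"] by (auto simp: add.assoc intro!: rl.step[OF step(4,2)])
qed

lemma rl_scal:
  assumes "a \<in> rl w"
  shows "scal c * a \<in> rl w"
  using assms
proof induction
  case (zero a)
  then show ?case using eqv_scal[of a 0 c] by (auto intro: rl.zero)
next
  case (step a u p b d)
  then have "scal c * b \<approx> scal c * (a + scal d * pth u p)"
    by (intro eqv_scal)
  also have "\<dots> = scal c * a + scal (c * d) * pth u p"
    by (simp add: distrib_left scal_mult mult.assoc)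
  finally show ?case
    by (rule rl.step[OF step(4,2)])
qed

lemma rl_pth: "awalk u p w \<Longrightarrow> pth u p \<in> rl w"
  using rl.step[OF rl.zero[of 0], of u p w "pth u p" 1] by simp

lemma rl_alg: "a \<in> rl w \<Longrightarrow> a \<in> alg"
  by (induction rule: rl.induct) (auto elim!: eqv_alg)

lemma rl_vt:
  assumes "a \<in> rl w" "v \<in> verts E"
  shows "a * vt v \<approx> (if v = w then a else 0)"
  using assms(1)
proof induction
  case (zero a)
  then have "a * vt v \<approx> 0 * vt v"
    using assms by (intro eqv_rmult) auto
  also have "0 * vt v \<approx> (if v = w then a else 0)"
    using zero by (auto intro: eqv_sym)
  finally show ?case .
next
  case (step a u p b c)
  have w: "w \<in> verts E" using step by auto
  have p: "pth u p * vt v \<approx> (if v = w then pth u p else 0)"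
  proof (cases "v = w")
    case False
    have "pth u p * vt v \<approx> pth u p * vt w * vt v"
      using step assms by (intro eqv_rmult eqv_sym[OF pth_vt]) auto
    also have "\<dots> = pth u p * (vt w * vt v)" by (simp add: mult.assoc)
    also have "\<dots> \<approx> pth u p * 0"
      using step assms False w by (intro eqv_lmult vt_orth) auto
    finally show ?thesis using False by simp
  qed (use step pth_vt in auto)
  have "b * vt v \<approx> (a + scal c * pth u p) * vt v"
    using step assms by (intro eqv_rmult) auto
  also have "\<dots> = a * vt v + scal c * (pth u p * vt v)"
    by (simp add: distrib_right mult.assoc)
  also have "\<dots> \<approx> (if v = w then a else 0) + scal c * (if v = w then pth u p else 0)"
    using step p by (intro eqv_add eqv_scal)
  also have "\<dots> \<approx> (if v = w then b else 0)"
    using step by (auto intro: eqv_sym)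
  finally show ?case .
qed

lemma rl_lmult_vt:
  assumes "a \<in> rl w" "v \<in> verts E"
  shows "vt v * a \<in> rl w"
  using assms(1)
proof induction
  case (zero a)
  then show ?case using eqv_lmult[of a 0 "vt v"] assms by (auto intro: rl.zero)
next
  case (step a u p b c)
  have "vt v * b \<approx> vt v * (a + scal c * pth u p)"
    using step assms by (intro eqv_lmult) auto
  also have "\<dots> = vt v * a + scal c * (vt v * pth u p)"
    by (simp add: distrib_left scal_mult_left_commute)
  finally have b: "vt v * b \<approx> vt v * a + scal c * (vt v * pth u p)" .
  have "vt v * pth u p \<in> rl w"
    using step vt_pth[of u p w v] assms rl_pth[of u p w] rl.zero[of 0 w]
    by (auto intro: rl_eqv rl.zero split: if_splits)
  then show ?case
    using step b by (blast intro: rl_eqv rl_add rl_scal)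
qed

lemma rl_lmult_ed:
  assumes "a \<in> rl w" "f \<in> arcs E"
  shows "ed f * a \<in> rl w"
  using assms(1)
proof induction
  case (zero a)
  then show ?case using eqv_lmult[of a 0 "ed f"] assms by (auto intro: rl.zero)
next
  case (step a u p b c)
  have "ed f * b \<approx> ed f * (a + scal c * pth u p)"
    using step assms by (intro eqv_lmult) auto
  also have "\<dots> = ed f * a + scal c * (ed f * pth u p)"
    by (simp add: distrib_left scal_mult_left_commute)
  finally have b: "ed f * b \<approx> ed f * a + scal c * (ed f * pth u p)" .
  have "ed f * pth u p \<in> rl w"
  proof (cases "head E f = u")
    case True
    then have "ed f * pth u p = pth (tail E f) (f # p)" "awalk (tail E f) (f # p) w"
      using step assms by (auto simp: awalk_simps)
    then show ?thesis by (metis rl_pth)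
  next
    case False
    have "ed f * pth u p \<approx> ed f * vt (head E f) * pth u p"
      using step assms by (intro eqv_rmult eqv_sym[OF ed_vt]) auto
    also have "\<dots> = ed f * (vt (head E f) * pth u p)" by (simp add: mult.assoc)
    also have "\<dots> \<approx> ed f * 0"
      using step assms False vt_pth[of u p w "head E f"] by (intro eqv_lmult) auto
    finally show ?thesis by (auto intro: rl.zero)
  qed
  then show ?case
    using step b by (blast intro: rl_eqv rl_add rl_scal)
qed

text \<open>\<open>gl n w\<close> is the span of the \<open>p q\<^sup>*\<close>, for paths \<open>p\<close>, \<open>q\<close> with the same range, where \<open>q\<close>
  starts in \<open>w\<close> and has length at most \<open>n\<close>.\<close>

primrec gl :: "nat \<Rightarrow> 'v \<Rightarrow> (('v, 'e) lpa_gen word \<Rightarrow>\<^sub>0 'k) set" where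
  "gl 0 = rl"
| "gl (Suc n) = (\<lambda>w. {a. \<exists>a' X g. a' \<in> rl w \<and> finite X \<and> X \<subseteq> out_arcs E w \<and>
     (\<forall>e\<in>X. g e \<in> gl n (head E e)) \<and> a \<approx> a' + (\<Sum>e\<in>X. g e * gh e)})"

lemma gl_SucI:
  "a' \<in> rl w \<Longrightarrow> finite X \<Longrightarrow> X \<subseteq> out_arcs E w \<Longrightarrow> (\<And>e. e \<in> X \<Longrightarrow> g e \<in> gl n (head E e)) \<Longrightarrow>
    a \<approx> a' + (\<Sum>e\<in>X. g e * gh e) \<Longrightarrow> a \<in> gl (Suc n) w"
  unfolding gl.simps
  by (intro CollectI exI[of _ a'] exI[of _ X] exI[of _ g] conjI ballI)

lemma gl_SucE:
  assumes "a \<in> gl (Suc n) w"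
  obtains a' X g where "a' \<in> rl w" "finite X" "X \<subseteq> out_arcs E w"
    "\<forall>e\<in>X. g e \<in> gl n (head E e)" "a \<approx> a' + (\<Sum>e\<in>X. g e * gh e)"
  using assms unfolding gl.simps
  by (elim CollectE exE conjE) (rule that)

declare gl.simps(2) [simp del]

lemma gl_eqv: "a \<in> gl n w \<Longrightarrow> b \<approx> a \<Longrightarrow> b \<in> gl n w"
  by (cases n) (auto elim!: gl_SucE intro: rl_eqv gl_SucI eqv_trans)

lemma rl_subset_gl: "a \<in> rl w \<Longrightarrow> a \<in> gl n w"
  by (cases n) (auto intro: gl_SucI[of a w "{}"])

lemma gl_0: "0 \<in> gl n w"
  by (rule rl_subset_gl, rule rl.zero) simp

lemma gl_alg: "a \<in> gl n w \<Longrightarrow> a \<in> alg"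
proof (induction n arbitrary: a w)
  case (Suc n)
  then show ?case
    by (elim gl_SucE) (erule eqv_alg, auto intro!: alg_sum alg_closed intro: rl_alg)
qed (auto intro: rl_alg)

lemma gl_mono_Suc: "a \<in> gl n w \<Longrightarrow> a \<in> gl (Suc n) w"
proof (induction n arbitrary: a w)
  case (Suc n)
  then show ?case
    by (elim gl_SucE) (rule gl_SucI, auto)
qed (auto intro: gl_SucI[of a w "{}" for a w])

lemma gl_mono: "a \<in> gl n w \<Longrightarrow> n \<le> m \<Longrightarrow> a \<in> gl m w"
  by (induction m) (auto simp: le_Suc_eq intro: gl_mono_Suc)

lemma gl_add: "a \<in> gl n w \<Longrightarrow> b \<in> gl n w \<Longrightarrow> a + b \<in> gl n w"
proof (induction n arbitrary: a b w)
  case 0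
  then show ?case by (auto intro: rl_add)
next
  case (Suc n)
  obtain a1 X1 g1 where 1: "a1 \<in> rl w" "finite X1" "X1 \<subseteq> out_arcs E w"
    "\<forall>e\<in>X1. g1 e \<in> gl n (head E e)" "a \<approx> a1 + (\<Sum>e\<in>X1. g1 e * gh e)"
    using Suc.prems(1) by (rule gl_SucE)
  obtain a2 X2 g2 where 2: "a2 \<in> rl w" "finite X2" "X2 \<subseteq> out_arcs E w"
    "\<forall>e\<in>X2. g2 e \<in> gl n (head E e)" "b \<approx> a2 + (\<Sum>e\<in>X2. g2 e * gh e)"
    using Suc.prems(2) by (rule gl_SucE)
  define g where "g e = (if e \<in> X1 then g1 e else 0) + (if e \<in> X2 then g2 e else 0)" for e
  have "(\<Sum>e\<in>X1 \<union> X2. (if e \<in> X1 then g1 e else 0) * gh e) = (\<Sum>e\<in>X1. g1 e * gh e)"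
    using 1 2 by (intro sum.mono_neutral_cong_right) auto
  moreover have "(\<Sum>e\<in>X1 \<union> X2. (if e \<in> X2 then g2 e else 0) * gh e) = (\<Sum>e\<in>X2. g2 e * gh e)"
    using 1 2 by (intro sum.mono_neutral_cong_right) auto
  ultimately have g: "(\<Sum>e\<in>X1 \<union> X2. g e * gh e) = (\<Sum>e\<in>X1. g1 e * gh e) + (\<Sum>e\<in>X2. g2 e * gh e)"
    by (simp add: g_def distrib_right sum.distrib)
  show ?case
  proof (rule gl_SucI)
    show "a1 + a2 \<in> rl w" using 1 2 by (auto intro: rl_add)
    show "finite (X1 \<union> X2)" "X1 \<union> X2 \<subseteq> out_arcs E w" using 1 2 by auto
    show "g e \<in> gl n (head E e)" if "e \<in> X1 \<union> X2" for e
      using that 1(4) 2(4) unfolding g_def by (intro Suc.IH) (auto simp: gl_0)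
    have "a + b \<approx> (a1 + (\<Sum>e\<in>X1. g1 e * gh e)) + (a2 + (\<Sum>e\<in>X2. g2 e * gh e))"
      using 1 2 by (intro eqv_add)
    then show "a + b \<approx> a1 + a2 + (\<Sum>e\<in>X1 \<union> X2. g e * gh e)"
      unfolding g by (simp add: algebra_simps)
  qed
qed

lemma gl_scal: "a \<in> gl n w \<Longrightarrow> scal c * a \<in> gl n w"
proof (induction n arbitrary: a w)
  case 0
  then show ?case by (auto intro: rl_scal)
next
  case (Suc n)
  obtain a1 X g where 1: "a1 \<in> rl w" "finite X" "X \<subseteq> out_arcs E w"
    "\<forall>e\<in>X. g e \<in> gl n (head E e)" "a \<approx> a1 + (\<Sum>e\<in>X. g e * gh e)"
    using Suc.prems by (rule gl_SucE)
  have "scal c * a \<approx> scal c * (a1 + (\<Sum>e\<in>X. g e * gh e))"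
    using 1 by (intro eqv_scal)
  also have "\<dots> = scal c * a1 + (\<Sum>e\<in>X. (scal c * g e) * gh e)"
    by (simp add: distrib_left sum_distrib_left mult.assoc)
  finally show ?case
    using 1 Suc.IH by (intro gl_SucI[of "scal c * a1"] rl_scal) auto
qed

lemma gl_vt:
  assumes "a \<in> gl n w" "w \<in> verts E"
  shows "a * vt w \<approx> a"
proof (cases n)
  case 0
  then show ?thesis using assms rl_vt[of a w w] by auto
next
  case (Suc m)
  obtain a1 X g where 1: "a1 \<in> rl w" "finite X" "X \<subseteq> out_arcs E w"
    "\<forall>e\<in>X. g e \<in> gl m (head E e)" "a \<approx> a1 + (\<Sum>e\<in>X. g e * gh e)"
    using assms(1)[unfolded Suc] by (rule gl_SucE)
  have gw: "gh e * vt w \<approx> gh e" if "e \<in> X" for e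
    using gh_vt[of e] 1(3) that by auto
  have "a * vt w \<approx> (a1 + (\<Sum>e\<in>X. g e * gh e)) * vt w"
    using 1 assms by (intro eqv_rmult) auto
  also have "\<dots> = a1 * vt w + (\<Sum>e\<in>X. g e * (gh e * vt w))"
    by (simp add: distrib_right sum_distrib_right mult.assoc)
  also have "\<dots> \<approx> a1 + (\<Sum>e\<in>X. g e * gh e)"
  proof (rule eqv_add)
    show "a1 * vt w \<approx> a1" using rl_vt[OF 1(1) assms(2)] by simp
    show "(\<Sum>e\<in>X. g e * (gh e * vt w)) \<approx> (\<Sum>e\<in>X. g e * gh e)"
    proof (rule eqv_sum)
      fix e assume e: "e \<in> X"
      then have "g e \<in> alg" using 1(4) by (auto intro: gl_alg)
      then show "g e * (gh e * vt w) \<approx> g e * gh e" using gw[OF e] by (rule eqv_lmult[rotated])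
    qed
  qed
  also have "\<dots> \<approx> a" using 1(5) by (rule eqv_sym)
  finally show ?thesis .
qed

text \<open>Left multiplication does not touch the ghosts on the right, so closure has to be checked
  only for ghost-free elements.\<close>

lemma gl_lmult:
  assumes z: "z \<in> alg" and rl: "\<And>b v. b \<in> rl v \<Longrightarrow> z * b \<in> rl v"
  shows "a \<in> gl n w \<Longrightarrow> z * a \<in> gl n w"
proof (induction n arbitrary: a w)
  case 0
  then show ?case by (auto intro: rl)
next
  case (Suc n)
  obtain a1 X g where 1: "a1 \<in> rl w" "finite X" "X \<subseteq> out_arcs E w"
    "\<forall>e\<in>X. g e \<in> gl n (head E e)" "a \<approx> a1 + (\<Sum>e\<in>X. g e * gh e)"
    using Suc.prems by (rule gl_SucE)
  have "z * a \<approx> z * (a1 + (\<Sum>e\<in>X. g e * gh e))"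
    using 1 z by (intro eqv_lmult)
  also have "\<dots> = z * a1 + (\<Sum>e\<in>X. (z * g e) * gh e)"
    by (simp add: distrib_left sum_distrib_left mult.assoc)
  finally show ?case
    using 1 Suc.IH by (intro gl_SucI[of "z * a1"] rl) auto
qed

lemma gl_1_gh: "f \<in> arcs E \<Longrightarrow> gh f \<in> gl 1 (tail E f)"
  unfolding One_nat_def
  using vt_gh[of f] rl_pth[of "head E f" "[]" "head E f"]
  by (intro gl_SucI[of 0 _ "{f}" "\<lambda>e. vt (head E e)"]) (auto simp: awalk_simps intro: rl.zero eqv_sym)

text \<open>A ghost cancels the first edge of a path or kills it; only on an empty path can it
  survive as a ghost, which explains the level 1.\<close>

lemma rl_lmult_gh:
  assumes "a \<in> rl w" "f \<in> arcs E"
  shows "gh f * a \<in> gl 1 w"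
  using assms(1)
proof induction
  case (zero a)
  then show ?case
    using eqv_lmult[of a 0 "gh f"] assms gl_eqv[OF gl_0] by auto
next
  case (step a u p b c)
  have "gh f * b \<approx> gh f * (a + scal c * pth u p)"
    using step assms by (intro eqv_lmult) auto
  also have "\<dots> = gh f * a + scal c * (gh f * pth u p)"
    by (simp add: distrib_left scal_mult_left_commute)
  finally have b: "gh f * b \<approx> gh f * a + scal c * (gh f * pth u p)" .
  have "gh f * pth u p \<in> gl 1 w"
  proof (cases p)
    case Nil
    then have "gh f * pth u p \<approx> (if u = tail E f then gh f else 0)" "u = w"
      using gh_vt'[of f u] step assms by (auto simp: awalk_simps)
    then show ?thesis using gl_1_gh[OF assms(2)] gl_0[of 1 w] gl_eqv by (auto split: if_splits)
  next
    case (Cons e q)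
    then have q: "e \<in> arcs E" "awalk (head E e) q w" using step by (auto simp: awalk_simps)
    have "gh f * ed e \<approx> (if f = e then vt (head E e) else 0)"
      using gh_ed gh_ed_distinct q assms by auto
    then have "gh f * ed e * pth (head E e) q \<approx> (if f = e then vt (head E e) else 0) * pth (head E e) q"
      using q by (intro eqv_rmult) auto
    also have "(if f = e then vt (head E e) else 0) * pth (head E e) q \<in> rl w"
      using rl_lmult_vt[OF rl_pth[OF q(2)], of "head E e"] q rl.zero[of 0 w] by auto
    finally (rl_eqv[rotated]) show ?thesis
      using Cons by (auto simp: mult.assoc intro: rl_subset_gl)
  qed
  then show ?case
    using step b by (blast intro: gl_eqv gl_add gl_scal)
qed

lemma gl_lmult_gh:
  assumes "f \<in> arcs E"
  shows "a \<in> gl n w \<Longrightarrow> gh f * a \<in> gl (Suc n) w"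
proof (induction n arbitrary: a w)
  case 0
  then show ?case using rl_lmult_gh assms by auto
next
  case (Suc n)
  obtain a1 X g where 1: "a1 \<in> rl w" "finite X" "X \<subseteq> out_arcs E w"
    "\<forall>e\<in>X. g e \<in> gl n (head E e)" "a \<approx> a1 + (\<Sum>e\<in>X. g e * gh e)"
    using Suc.prems by (rule gl_SucE)
  have "gh f * a \<approx> gh f * (a1 + (\<Sum>e\<in>X. g e * gh e))"
    using 1 assms by (intro eqv_lmult) auto
  also have "\<dots> = gh f * a1 + (\<Sum>e\<in>X. (gh f * g e) * gh e)"
    by (simp add: distrib_left sum_distrib_left mult.assoc)
  finally have *: "gh f * a \<approx> gh f * a1 + (\<Sum>e\<in>X. (gh f * g e) * gh e)" .
  have "(\<Sum>e\<in>X. (gh f * g e) * gh e) \<in> gl (Suc (Suc n)) w"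
    using 1 Suc.IH by (intro gl_SucI[of 0 w X]) (auto intro: rl.zero)
  moreover have "gh f * a1 \<in> gl (Suc (Suc n)) w"
    using rl_lmult_gh[OF 1(1) assms] by (rule gl_mono) simp
  ultimately show ?case using * by (blast intro: gl_eqv gl_add)
qed

text \<open>Every element is a combination of products \<open>p q\<^sup>*\<close>: prepending a
  generator raises the level by at most one.\<close>

lemma alg_gl:
  assumes "a \<in> alg" "w \<in> verts E"
  shows "\<exists>n. a * vt w \<in> gl n w"
proof -
  have gen: "gen x * b \<in> gl (Suc n) w" if "x \<in> lpa_gens E" "b \<in> gl n w" for x b n
    using that gl_lmult_gh[of _ b n w] gl_mono_Suc gl_lmult[OF vt_alg rl_lmult_vt] gl_lmult[OF ed_alg rl_lmult_ed]
    by (auto simp: lpa_gens_def)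
  have vtw: "vt w \<in> gl 0 w"
    using rl_pth[of w "[]" w] assms by (auto simp: awalk_simps)
  from assms(1) show ?thesis
  proof (induction rule: free_algebra_induct)
    case zero
    then show ?case using gl_0[of 0 w] by (intro exI[of _ 0]) (simp only: mult_zero_left)
  next
    case (add f g)
    then obtain n m where "f * vt w \<in> gl n w" "g * vt w \<in> gl m w" by blast
    then have "f * vt w \<in> gl (max n m) w" "g * vt w \<in> gl (max n m) w"
      by (auto intro: gl_mono)
    then show ?case by (auto simp: distrib_right intro: gl_add)
  next
    case (scal c f)
    then show ?case by (auto simp: mult.assoc intro: gl_scal)
  next
    case (gen x)
    then show ?case using gen vtw \<open>\<And>x b n. \<lbrakk>x \<in> lpa_gens E; b \<in> gl n w\<rbrakk> \<Longrightarrow> gen x * b \<in> gl (Suc n) w\<close> by blast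
  next
    case (mult x f)
    then show ?case using gen by (auto simp: mult.assoc)
  qed
qed

text \<open>Walks are collected in a set, so each occurs once, and zero coefficients are dropped.
  Nothing is said about linear independence; later arguments only need the coefficients to be
  non-zero.\<close>

lemma rl_formal:
  assumes "a \<in> rl w"
  obtains P k where "finite P" "\<forall>x\<in>P. awalk (fst x) (snd x) w" "\<forall>x\<in>P. k x \<noteq> 0"
    "a \<approx> (\<Sum>x\<in>P. scal (k x) * pth (fst x) (snd x))"
proof -
  have "\<exists>P k. finite P \<and> (\<forall>x\<in>P. awalk (fst x) (snd x) w) \<and>
      a \<approx> (\<Sum>x\<in>P. scal (k x) * pth (fst x) (snd x))"
    using assms
  proof induction
    case (zero a)
    then show ?case by (intro exI[of _ "{}"]) auto
  next
    case (step a u p b c)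
    then obtain P k where P: "finite P" "\<forall>x\<in>P. awalk (fst x) (snd x) w"
      "a \<approx> (\<Sum>x\<in>P. scal (k x) * pth (fst x) (snd x))" by blast
    define k' where "k' x = (if x \<in> P then k x else 0) + (if x = (u, p) then c else 0)" for x
    have "(\<Sum>x\<in>insert (u, p) P. scal (k' x) * pth (fst x) (snd x)) =
        (\<Sum>x\<in>insert (u, p) P. scal (if x \<in> P then k x else 0) * pth (fst x) (snd x)) +
        (\<Sum>x\<in>insert (u, p) P. scal (if x = (u, p) then c else 0) * pth (fst x) (snd x))"
      by (simp only: k'_def scal_add distrib_right sum.distrib)
    also have "(\<Sum>x\<in>insert (u, p) P. scal (if x \<in> P then k x else 0) * pth (fst x) (snd x)) =
        (\<Sum>x\<in>P. scal (k x) * pth (fst x) (snd x))"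
      using P by (intro sum.mono_neutral_cong_right) auto
    also have "(\<Sum>x\<in>insert (u, p) P. scal (if x = (u, p) then c else 0) * pth (fst x) (snd x)) =
        scal c * pth u p"
      using P by (subst sum.mono_neutral_cong_right[of _ "{(u, p)}" _ "\<lambda>x. scal c * pth (fst x) (snd x)"]) auto
    finally have "a + scal c * pth u p \<approx> (\<Sum>x\<in>insert (u, p) P. scal (k' x) * pth (fst x) (snd x))"
      using P by (auto intro: eqv_add)
    then show ?case
      using P step by (intro exI[of _ "insert (u, p) P"] exI[of _ k']) (auto intro: eqv_trans)
  qed
  then obtain P k where P: "finite P" "\<forall>x\<in>P. awalk (fst x) (snd x) w"
      "a \<approx> (\<Sum>x\<in>P. scal (k x) * pth (fst x) (snd x))" by blast
  have "(\<Sum>x\<in>P. scal (k x) * pth (fst x) (snd x)) = (\<Sum>x\<in>{x\<in>P. k x \<noteq> 0}. scal (k x) * pth (fst x) (snd x))"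
    using P by (intro sum.mono_neutral_cong_right) auto
  with P show ?thesis
    by (intro that[of "{x\<in>P. k x \<noteq> 0}" k]) auto
qed

end

section \<open>The reduction theorem\<close>

context lpa
begin

definition out_off :: "'v set \<Rightarrow> 'v \<Rightarrow> 'e set" where
  "out_off H v = {e \<in> out_arcs E v. head E e \<in> verts E - H}"

text \<open>\<open>gap H v\<close> is the element usually written \<open>v\<^sup>H\<close>.\<close>

definition gap :: "'v set \<Rightarrow> 'v \<Rightarrow> ('v, 'e) lpa_gen word \<Rightarrow>\<^sub>0 'k" where
  "gap H v = vt v - (\<Sum>e\<in>out_off H v. ed e * gh e)"

text \<open>Condition (L) for the graph outside \<open>H\<close>. The splitting of \<open>q\<close>
  marks the edge \<open>e\<close> at whose source the exit \<open>f\<close> leaves.\<close>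

definition has_exits :: "'v set \<Rightarrow> bool" where
  "has_exits H \<longleftrightarrow> (\<forall>w q. w \<in> verts E - H \<longrightarrow> awalk w q w \<longrightarrow> q \<noteq> [] \<longrightarrow>
     (\<exists>p e r f. q = p @ e # r \<and> f \<in> arcs E \<and> f \<noteq> e \<and> tail E f = tail E e \<and> head E f \<notin> H))"

lemma gap_alg [simp]: "v \<in> verts E \<Longrightarrow> gap H v \<in> alg"
  by (auto simp: gap_def out_off_def intro!: alg_closed alg_sum)

text \<open>An ideal absorbs algebra elements rather than scalars, so the inverse of
  \<open>c\<close> is attached to a left unit \<open>u\<close> of \<open>x\<close>.\<close>

lemma idl_inverse_scal:
  assumes I: "idl I" and x: "scal c * x \<in> I" "c \<noteq> 0" "x \<in> alg" "u \<in> alg" "u * x \<approx> x"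
  shows "x \<in> I"
proof -
  have "scal (inverse c) * u * (scal c * x) \<in> I"
    using assms by (intro idl_lmult[OF I x(1)]) auto
  also have "scal (inverse c) * u * (scal c * x) = scal (inverse c * c) * (u * x)"
    by (simp only: scal_mult mult.assoc scal_mult_left_commute[of u])
  also have "\<dots> = u * x" using x by simp
  finally show ?thesis using idl_eqv[OF I x(5)] by simp
qed

text \<open>Multiplying by the ghost of a path of minimal length produces closed paths.\<close>

lemma strip_paths:
  assumes "finite P" "P \<noteq> {}" "\<forall>x\<in>P. awalk (fst x) (snd x) w" "\<forall>x\<in>P. k x \<noteq> 0"
  obtains z Q k' where "z \<in> alg" "finite Q" "[] \<in> Q" "\<forall>q\<in>Q. awalk w q w" "k' [] \<noteq> 0"
    "z * (\<Sum>x\<in>P. scal (k x) * pth (fst x) (snd x)) \<approx> (\<Sum>q\<in>Q. scal (k' q) * pth w q)"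
proof -
  note P = assms(1,2) assms(3,4)[rule_format]
  from P(2) obtain y where "y \<in> P" by blast
  then obtain x0 where x0: "x0 \<in> P" "\<And>x. x \<in> P \<Longrightarrow> length (snd x0) \<le> length (snd x)"
    using ex_has_least_nat[of "\<lambda>x. x \<in> P" y "\<lambda>x. length (snd x)"] by blast
  define u0 p0 where "u0 = fst x0" and "p0 = snd x0"
  have w0: "awalk u0 p0 w" using P x0 by (auto simp: u0_def p0_def)
  \<comment> \<open>The remainders of the walks that start with the shortest walk \<open>p0\<close>;
    that walk itself leaves the empty remainder, whose coefficient is therefore non-zero.\<close>
  define Q where "Q = {q. (u0, p0 @ q) \<in> P}"
  define k' where "k' q = k (u0, p0 @ q)" for q
  have Q_img: "Q \<subseteq> (\<lambda>x. drop (length p0) (snd x)) ` P"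
  proof
    fix q assume "q \<in> Q"
    then have "(u0, p0 @ q) \<in> P" by (simp add: Q_def)
    then show "q \<in> (\<lambda>x. drop (length p0) (snd x)) ` P"
      by (rule rev_image_eqI) simp
  qed
  have Qw: "awalk w q w" if "q \<in> Q" for q
  proof -
    have "awalk u0 (p0 @ q) w" using P(3)[of "(u0, p0 @ q)"] that by (simp add: Q_def)
    then show ?thesis using w0 by auto
  qed
  let ?c = "\<lambda>x. fst x = u0 \<and> take (length p0) (snd x) = p0"
  have summand: "gth u0 p0 * pth (fst x) (snd x) \<approx>
      (if ?c x then pth w (drop (length p0) (snd x)) else 0)" if "x \<in> P" for x
  proof (cases "fst x = u0")
    case True
    then show ?thesis
      using gth_pth[OF w0, of "snd x" w] P(3)[OF that] x0(2)[OF that] by (auto simp: p0_def)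
  next
    case False
    have "gth u0 p0 * pth (fst x) (snd x) \<approx> gth u0 p0 * vt u0 * pth (fst x) (snd x)"
      using P(3)[OF that] w0 by (intro eqv_rmult eqv_sym[OF gth_vt]) auto
    also have "\<dots> = gth u0 p0 * (vt u0 * pth (fst x) (snd x))" by (simp add: mult.assoc)
    also have "\<dots> \<approx> gth u0 p0 * 0"
      using vt_pth[OF P(3)[OF that], of u0] w0 False by (intro eqv_lmult) auto
    finally show ?thesis using False by simp
  qed
  have "gth u0 p0 * (\<Sum>x\<in>P. scal (k x) * pth (fst x) (snd x)) =
      (\<Sum>x\<in>P. scal (k x) * (gth u0 p0 * pth (fst x) (snd x)))"
    by (simp add: sum_distrib_left scal_mult_left_commute)
  also have "\<dots> \<approx> (\<Sum>x\<in>P. scal (k x) * (if ?c x then pth w (drop (length p0) (snd x)) else 0))"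
    using summand by (intro eqv_sum eqv_scal)
  also have "\<dots> = (\<Sum>x\<in>{x\<in>P. ?c x}. scal (k x) * pth w (drop (length p0) (snd x)))"
    using P by (intro sum.mono_neutral_cong_right) auto
  also have "\<dots> = (\<Sum>q\<in>Q. scal (k' q) * pth w q)"
  proof (rule sum.reindex_bij_witness[where i = "\<lambda>q. (u0, p0 @ q)" and j = "\<lambda>x. drop (length p0) (snd x)"])
    fix x assume "x \<in> {x\<in>P. ?c x}"
    then show x: "(u0, p0 @ drop (length p0) (snd x)) = x"
      by (metis (mono_tags, lifting) append_take_drop_id mem_Collect_eq prod.collapse)
    show "drop (length p0) (snd x) \<in> Q"
      using \<open>x \<in> {x\<in>P. ?c x}\<close> by (simp add: Q_def x)
    show "scal (k' (drop (length p0) (snd x))) * pth w (drop (length p0) (snd x)) =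
        scal (k x) * pth w (drop (length p0) (snd x))"
      by (simp add: k'_def x)
  qed (auto simp: Q_def)
  finally have "gth u0 p0 * (\<Sum>x\<in>P. scal (k x) * pth (fst x) (snd x)) \<approx>
      (\<Sum>q\<in>Q. scal (k' q) * pth w q)" .
  moreover have "[] \<in> Q" "k' [] \<noteq> 0"
    using x0 P(4) by (auto simp: Q_def k'_def u0_def p0_def)
  ultimately show ?thesis
    using Qw w0 finite_subset[OF Q_img] P(1) by (intro that[of "gth u0 p0" Q k']) auto
qed

text \<open>Conjugating by a path that leaves one of the closed paths kills it.\<close>

lemma closed_paths_vertex:
  assumes H: "hereditary E H" "has_exits H" and B: "idl B"
  shows "finite Q \<Longrightarrow> [] \<in> Q \<Longrightarrow> w \<in> verts E - H \<Longrightarrow> \<forall>q\<in>Q. awalk w q w \<Longrightarrow> k [] \<noteq> 0 \<Longrightarrow>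
    (\<Sum>q\<in>Q. scal (k q) * pth w q) \<in> B \<Longrightarrow> \<exists>u\<in>verts E - H. vt u \<in> B"
proof (induction "card Q" arbitrary: Q w k rule: less_induct)
  case less
  note Q = less.prems(1,2) and w = less.prems(3) and Qw = less.prems(4)[rule_format]
  show ?case
  proof (cases "Q = {[]}")
    case True
    then have "scal (k []) * vt w \<in> B" using less.prems by simp
    then have "vt w \<in> B"
      using less.prems vt_idem[of w] by (intro idl_inverse_scal[OF B \<open>scal (k []) * vt w \<in> B\<close>, of "vt w"]) auto
    then show ?thesis using w by blast
  next
    case False
    then obtain q1 where q1: "q1 \<in> Q" "q1 \<noteq> []" using Q by blast
    obtain p e r f where f: "q1 = p @ e # r" "f \<in> arcs E" "f \<noteq> e" "tail E f = tail E e" "head E f \<notin> H"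
      using H(2)[unfolded has_exits_def, rule_format, OF w Qw[OF q1(1)] q1(2)] by (elim exE conjE)
    \<comment> \<open>\<open>c\<close> follows \<open>q1\<close> up to its exit and then leaves, so
      \<open>q1 c\<close> does not begin with \<open>c\<close> and conjugation by \<open>c\<close>
      kills the term of \<open>q1\<close>. The term of the empty path turns into a multiple of
      \<open>w'\<close>.\<close>
    define c where "c = p @ [f]"
    define w' where "w' = head E f"
    have w': "w' \<in> verts E - H" using f by (auto simp: w'_def)
    have c: "awalk w c w'"
      using Qw[OF q1(1)] f by (auto simp: c_def w'_def awalk_simps)
    define Q1 where "Q1 = {q\<in>Q. take (length c) (q @ c) = c}"
    define m where "m q = drop (length c) (q @ c)" for q
    \<comment> \<open>A surviving \<open>q\<close> satisfies \<open>q c = c q'\<close> with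
      \<open>q'\<close> as long as \<open>q\<close>, so \<open>q\<close> is an initial segment of
      \<open>c q'\<close>; this makes \<open>m\<close> injective and transports the
      coefficients.\<close>
    define k' where "k' q = k (take (length q) (c @ q))" for q
    have m: "q @ c = c @ m q" "length (m q) = length q" if "q \<in> Q1" for q
    proof -
      have "take (length c) (q @ c) = c"
        using that by (simp only: Q1_def mem_Collect_eq)
      then show "q @ c = c @ m q"
        unfolding m_def by (metis append_take_drop_id)
    qed (simp add: m_def)
    have k': "k' (m q) = k q" and inj: "take (length (m q)) (c @ m q) = q" if "q \<in> Q1" for q
      using m[OF that, symmetric] by (simp_all add: k'_def)
    have inj_m: "inj_on m Q1"
      by (rule inj_on_inverseI[where g = "\<lambda>q'. take (length q') (c @ q')"]) (rule inj)
    have "q1 \<notin> Q1"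
      using f by (simp add: Q1_def c_def take_Cons')
    then have "Q1 \<subset> Q" using q1 by (auto simp: Q1_def)
    then have card: "card (m ` Q1) < card Q"
      using Q card_image[OF inj_m] psubset_card_mono by metis
    have summand: "gth w c * (pth w q * pth w c) \<approx> (if q \<in> Q1 then pth w' (m q) else 0)" if "q \<in> Q" for q
    proof -
      have "gth w c * (pth w q * pth w c) \<approx> gth w c * pth w (q @ c)"
        using c Qw[OF that] by (intro eqv_lmult pth_append) auto
      also have "awalk w (q @ c) w'" using c Qw[OF that] by auto
      then have "gth w c * pth w (q @ c) \<approx> (if take (length c) (q @ c) = c then pth w' (m q) else 0)"
        unfolding m_def by (intro gth_pth[OF c]) auto
      finally show ?thesis using that by (simp add: Q1_def)
    qed
    have "gth w c * (\<Sum>q\<in>Q. scal (k q) * pth w q) * pth w c \<in> B"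
      using less.prems c by (intro idl_rmult[OF B] idl_lmult[OF B]) auto
    moreover have "gth w c * (\<Sum>q\<in>Q. scal (k q) * pth w q) * pth w c \<approx>
        (\<Sum>q\<in>m ` Q1. scal (k' q) * pth w' q)"
    proof -
      have "gth w c * (\<Sum>q\<in>Q. scal (k q) * pth w q) * pth w c =
          (\<Sum>q\<in>Q. scal (k q) * (gth w c * (pth w q * pth w c)))"
        by (simp add: sum_distrib_left sum_distrib_right scal_mult_left_commute mult.assoc)
      also have "\<dots> \<approx> (\<Sum>q\<in>Q. scal (k q) * (if q \<in> Q1 then pth w' (m q) else 0))"
        using summand by (intro eqv_sum eqv_scal)
      also have "\<dots> = (\<Sum>q\<in>Q1. scal (k q) * pth w' (m q))"
        using Q by (intro sum.mono_neutral_cong_right) (auto simp: Q1_def)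
      also have "\<dots> = (\<Sum>q\<in>m ` Q1. scal (k' q) * pth w' q)"
        using inj_m k' by (simp add: sum.reindex)
      finally show ?thesis .
    qed
    ultimately have "(\<Sum>q\<in>m ` Q1. scal (k' q) * pth w' q) \<in> B"
      by (simp only: idl_eqv[OF B])
    moreover have "\<forall>q\<in>m ` Q1. awalk w' q w'"
    proof
      fix q' assume "q' \<in> m ` Q1"
      then obtain q where q: "q \<in> Q1" "q' = m q" by blast
      then have "awalk w (c @ q') w'"
        using c Qw[of q] m(1)[of q] by (metis (no_types, lifting) Q1_def awalk_appendI mem_Collect_eq)
      then show "awalk w' q' w'" using c by auto
    qed
    moreover have "[] \<in> Q1" "m [] = []" using Q by (simp_all add: Q1_def m_def)
    then have "[] \<in> m ` Q1" "k' [] \<noteq> 0"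
      using less.prems(5) by (force, simp add: k'_def)
    moreover have "finite (m ` Q1)" using Q by (simp add: Q1_def)
    ultimately show ?thesis
      by (intro less.hyps[OF card _ _ w'])
  qed
qed

lemma formal_vertex:
  assumes H: "hereditary E H" "has_exits H" and B: "idl B" and w: "w \<in> verts E - H"
    and P: "finite P" "P \<noteq> {}" "\<forall>x\<in>P. awalk (fst x) (snd x) w" "\<forall>x\<in>P. k x \<noteq> 0"
    and sum: "(\<Sum>x\<in>P. scal (k x) * pth (fst x) (snd x)) \<in> B"
  shows "\<exists>u\<in>verts E - H. vt u \<in> B"
proof -
  obtain z Q k' where z: "z \<in> alg" and Q: "finite Q" "[] \<in> Q" "\<forall>q\<in>Q. awalk w q w" "k' [] \<noteq> 0"
    and zP: "z * (\<Sum>x\<in>P. scal (k x) * pth (fst x) (snd x)) \<approx> (\<Sum>q\<in>Q. scal (k' q) * pth w q)"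
    using P by (rule strip_paths)
  have "z * (\<Sum>x\<in>P. scal (k x) * pth (fst x) (snd x)) \<in> B"
    using z sum by (intro idl_lmult[OF B])
  then have "(\<Sum>q\<in>Q. scal (k' q) * pth w q) \<in> B"
    using idl_eqv[OF B zP] by simp
  then show ?thesis
    by (rule closed_paths_vertex[OF H B Q(1,2) w Q(3), of k', OF Q(4)])
qed

lemma rl_formal_nonzero:
  assumes I: "idl I" and a: "a \<in> rl w" "a \<notin> I"
  obtains P k where "finite P" "P \<noteq> {}" "\<forall>x\<in>P. awalk (fst x) (snd x) w" "\<forall>x\<in>P. k x \<noteq> 0"
    "a \<approx> (\<Sum>x\<in>P. scal (k x) * pth (fst x) (snd x))"
proof -
  obtain P k where P: "finite P" "\<forall>x\<in>P. awalk (fst x) (snd x) w" "\<forall>x\<in>P. k x \<noteq> 0"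
    "a \<approx> (\<Sum>x\<in>P. scal (k x) * pth (fst x) (snd x))"
    using a(1) by (rule rl_formal)
  moreover have "P \<noteq> {}"
    using a(2) idl_eqv[OF I P(4)] idl_0[OF I] by auto
  ultimately show ?thesis using that by blast
qed

lemma rl_vertex:
  assumes H: "hereditary E H" "has_exits H" and I: "idl I" and B: "idl B"
    and a: "a \<in> rl w" "a \<notin> I" "a \<in> B" and w: "w \<in> verts E - H"
  shows "\<exists>u\<in>verts E - H. vt u \<in> B"
proof -
  obtain P k where P: "finite P" "P \<noteq> {}" "\<forall>x\<in>P. awalk (fst x) (snd x) w" "\<forall>x\<in>P. k x \<noteq> 0"
    "a \<approx> (\<Sum>x\<in>P. scal (k x) * pth (fst x) (snd x))"
    using I a(1,2) by (rule rl_formal_nonzero)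
  have "(\<Sum>x\<in>P. scal (k x) * pth (fst x) (snd x)) \<in> B"
    using idl_eqv[OF B P(5)] a(3) by simp
  then show ?thesis by (rule formal_vertex[OF H B w P(1-4)])
qed

text \<open>Appending \<open>f\<close> is injective on walks, so a formally non-zero combination
  remains one; \<open>butlast\<close> recovers the old coefficient.\<close>

lemma sum_paths_ed:
  assumes P: "finite P" "\<forall>x\<in>P. awalk (fst x) (snd x) w" and f: "f \<in> out_arcs E w"
  shows "(\<Sum>x\<in>P. scal (k x) * pth (fst x) (snd x)) * ed f \<approx>
    (\<Sum>x\<in>(\<lambda>x. (fst x, snd x @ [f])) ` P. scal (k (fst x, butlast (snd x))) * pth (fst x) (snd x))"
proof -
  have summand: "pth u p * ed f \<approx> pth u (p @ [f])" if p: "awalk u p w" for u p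
  proof -
    have f': "f \<in> arcs E" "tail E f = w" "awalk w [f] (head E f)"
      using f by (auto simp: awalk_simps)
    have "pth u p * ed f \<approx> pth u p * pth w [f]"
      using f' p ed_vt[of f] by (intro eqv_lmult) (auto intro: eqv_sym)
    also have "\<dots> \<approx> pth u (p @ [f])"
      using p f' by (intro pth_append) auto
    finally show ?thesis .
  qed
  have inj: "inj_on (\<lambda>x. (fst x, snd x @ [f])) P" by (auto simp: inj_on_def)
  have "(\<Sum>x\<in>P. scal (k x) * pth (fst x) (snd x)) * ed f = (\<Sum>x\<in>P. scal (k x) * (pth (fst x) (snd x) * ed f))"
    by (simp add: sum_distrib_right mult.assoc)
  also have "\<dots> \<approx> (\<Sum>x\<in>P. scal (k x) * pth (fst x) (snd x @ [f]))"
    using P by (intro eqv_sum eqv_scal summand) auto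
  also have "\<dots> = (\<Sum>x\<in>(\<lambda>x. (fst x, snd x @ [f])) ` P. scal (k (fst x, butlast (snd x))) * pth (fst x) (snd x))"
    by (simp add: sum.reindex[OF inj])
  finally show ?thesis .
qed

lemma sum_paths_rl:
  assumes "finite P" "\<forall>x\<in>P. awalk (fst x) (snd x) w"
  shows "(\<Sum>x\<in>P. scal (k x) * pth (fst x) (snd x)) \<in> rl w"
  using assms
proof (induction P)
  case empty
  then show ?case by (auto intro: rl.zero)
next
  case (insert x P)
  then show ?case by (auto intro!: rl_add rl_scal rl_pth)
qed

section \<open>The idempotents \<open>v\<^sup>H\<close>\<close>

lemma out_off_altdef: "out_off H v = {e \<in> out_arcs E v. head E e \<notin> H}"
  by (auto simp: out_off_def)

text \<open>\<open>w f = f\<close>, and of the subtracted sum only \<open>f f\<^sup>* f = f\<close>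
  survives.\<close>

lemma gap_ed:
  assumes "f \<in> out_off H w" "finite (out_off H w)"
  shows "gap H w * ed f \<approx> 0"
proof -
  have f: "f \<in> arcs E" "tail E f = w" using assms by (auto simp: out_off_def)
  have "gap H w * ed f = vt w * ed f - (\<Sum>e\<in>out_off H w. ed e * (gh e * ed f))"
    by (simp add: gap_def left_diff_distrib sum_distrib_right mult.assoc)
  also have "\<dots> \<approx> ed f - (\<Sum>e\<in>out_off H w. if e = f then ed f else 0)"
  proof (intro eqv_diff eqv_sum)
    show "vt w * ed f \<approx> ed f" using vt_ed f by auto
    fix e assume e: "e \<in> out_off H w"
    then have e': "e \<in> arcs E" by (auto simp: out_off_def)
    show "ed e * (gh e * ed f) \<approx> (if e = f then ed f else 0)"
    proof (cases "e = f")
      case True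
      have "ed e * (gh e * ed f) \<approx> ed e * vt (head E f)"
        using f unfolding True by (intro eqv_lmult gh_ed) auto
      also have "\<dots> \<approx> ed f" using True f ed_vt by auto
      finally show ?thesis using True by simp
    next
      case False
      have "ed e * (gh e * ed f) \<approx> ed e * 0"
        using False e' f by (intro eqv_lmult gh_ed_distinct) auto
      then show ?thesis using False by simp
    qed
  qed
  also have "\<dots> = 0" using assms by (simp add: sum.delta)
  finally show ?thesis .
qed

lemma vt_gap: 
  assumes "w \<in> verts E"
  shows "vt w * gap H w \<approx> gap H w"
proof -
  have "vt w * gap H w = vt w * vt w - (\<Sum>e\<in>out_off H w. vt w * ed e * gh e)"
    by (simp add: gap_def right_diff_distrib sum_distrib_left mult.assoc)
  also have "\<dots> \<approx> gap H w"
    unfolding gap_def using vt_ed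
    by (intro eqv_diff eqv_sum eqv_rmult vt_idem assms) (auto simp: out_off_def)
  finally show ?thesis .
qed

lemma gap_vt: 
  assumes "w \<in> verts E"
  shows "gap H w * vt w \<approx> gap H w"
proof -
  have "gap H w * vt w = vt w * vt w - (\<Sum>e\<in>out_off H w. ed e * (gh e * vt w))"
    by (simp add: gap_def left_diff_distrib sum_distrib_right mult.assoc)
  also have "\<dots> \<approx> gap H w"
    unfolding gap_def using gh_vt
    by (intro eqv_diff eqv_sum eqv_lmult vt_idem assms) (auto simp: out_off_def)
  finally show ?thesis .
qed

lemma gap_idem:
  assumes "w \<in> verts E" "finite (out_off H w)"
  shows "gap H w * gap H w \<approx> gap H w"
proof -
  have "gap H w * gap H w = gap H w * vt w - (\<Sum>e\<in>out_off H w. gap H w * ed e * gh e)"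
    by (subst (2) gap_def) (simp add: right_diff_distrib sum_distrib_left mult.assoc)
  also have "\<dots> \<approx> gap H w - (\<Sum>e\<in>out_off H w. 0 * gh e)"
    using assms by (intro eqv_diff eqv_sum eqv_rmult gap_vt gap_ed) (auto simp: out_off_def)
  finally show ?thesis by simp
qed

text \<open>By heredity, the first edge of a path that ends outside \<open>H\<close> has its range
  outside \<open>H\<close> too, and \<open>gap_ed\<close> kills that edge.\<close>

lemma gap_pth:
  assumes H: "hereditary E H" and w: "w \<in> verts E - H" "finite (out_off H w)"
    and q: "awalk w q v" "v \<notin> H"
  shows "gap H w * pth w q \<approx> (if q = [] then gap H w else 0)"
proof (cases q)
  case Nil
  then show ?thesis using gap_vt w by simp
next
  case (Cons f r)
  then have f: "f \<in> arcs E" "tail E f = w" "awalk (head E f) r v" using q by (auto simp: awalk_simps)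
  then have "head E f \<notin> H"
    using H q unfolding hereditary_def path_ge_def by blast
  then have "f \<in> out_off H w" using f by (auto simp: out_off_def)
  then have "gap H w * ed f * pth (head E f) r \<approx> 0 * pth (head E f) r"
    using f w by (intro eqv_rmult gap_ed) auto
  then show ?thesis using Cons by (simp add: mult.assoc)
qed

lemma idl_edge:
  assumes I: "idl I" and e: "e \<in> arcs E" "vt (head E e) \<in> I"
  shows "ed e \<in> I" "gh e \<in> I"
proof -
  have "ed e * vt (head E e) \<in> I" "vt (head E e) * gh e \<in> I"
    using e by (auto intro: idl_lmult[OF I] idl_rmult[OF I])
  then show "ed e \<in> I" "gh e \<in> I"
    using idl_eqv[OF I ed_vt[OF e(1)]] idl_eqv[OF I vt_gh[OF e(1)]] by simp_all
qed

text \<open>The induction on \<open>n\<close> removes ghost edges by multiplication on the right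
  with edges; where this is impossible, the element is a multiple of a vertex \<open>v\<close> or of \<open>v\<^sup>H\<close>.\<close>

lemma gl_reduction:
  assumes H: "hereditary E H" "has_exits H" and I: "idl I" and B: "idl B" "I \<subseteq> B"
    and HI: "\<And>v. v \<in> H \<Longrightarrow> vt v \<in> I" and SI: "\<And>v. v \<in> S \<Longrightarrow> gap H v \<in> I"
  shows "a \<in> gl n w \<Longrightarrow> w \<in> verts E \<Longrightarrow> a \<in> B \<Longrightarrow> a \<notin> I \<Longrightarrow>
    (\<exists>u\<in>verts E - H. vt u \<in> B) \<or> (\<exists>u\<in>breaking_vertices E H - S. gap H u \<in> B)"
proof (induction n arbitrary: a w)
  case 0
  have "w \<notin> H"
  proof
    assume "w \<in> H"
    then have "a * vt w \<in> I" using 0 HI by (auto intro: idl_lmult[OF I] dest: rl_alg)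
    then show False using idl_eqv[OF I gl_vt[of a 0 w]] 0 by simp
  qed
  then show ?case
    using rl_vertex[OF H I B(1), of a w] 0 by auto
next
  case (Suc n)
  obtain a' X g where a': "a' \<in> rl w" and X: "finite X" "X \<subseteq> out_arcs E w"
    and g: "\<forall>e\<in>X. g e \<in> gl n (head E e)" and a: "a \<approx> a' + (\<Sum>e\<in>X. g e * gh e)"
    using Suc.prems(1) by (rule gl_SucE)
  have a_alg: "a \<in> alg" and a'_alg: "a' \<in> alg" using Suc.prems(1) a' gl_alg rl_alg by auto
  have g_alg: "g e \<in> alg" if "e \<in> X" for e using g that gl_alg by blast
  have arc: "e \<in> arcs E" "tail E e = w" if "e \<in> X" for e using X that by auto
  have wH: "w \<in> verts E - H"
  proof -
    have "a * vt w \<in> I" if "w \<in> H" using that HI a_alg by (auto intro: idl_lmult[OF I])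
    then show ?thesis using idl_eqv[OF I gl_vt[OF Suc.prems(1,2)]] Suc.prems by auto
  qed
  \<comment> \<open>Right multiplication by \<open>f\<close> isolates the coefficient of the ghost
    of \<open>f\<close> and thus lowers the level.\<close>
  have a_ed: "a * ed f \<approx> a' * ed f + (if f \<in> X then g f else 0)" if f: "f \<in> out_arcs E w" for f
  proof -
    have f': "f \<in> arcs E" using f by simp
    have "a * ed f \<approx> (a' + (\<Sum>e\<in>X. g e * gh e)) * ed f"
      using f' a by (intro eqv_rmult) auto
    also have "\<dots> = a' * ed f + (\<Sum>e\<in>X. g e * (gh e * ed f))"
      by (simp add: distrib_right sum_distrib_right mult.assoc)
    also have "\<dots> \<approx> a' * ed f + (\<Sum>e\<in>X. if e = f then g f else 0)"
    proof (intro eqv_add eqv_sum eqv_refl)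
      fix e assume e: "e \<in> X"
      show "g e * (gh e * ed f) \<approx> (if e = f then g f else 0)"
      proof (cases "e = f")
        case True
        have "g e * (gh e * ed f) \<approx> g e * vt (head E e)"
          using True arc[OF e] g_alg[OF e] gh_ed[of e] by (intro eqv_lmult) auto
        also have "\<dots> \<approx> g e"
          using g e arc by (intro gl_vt) auto
        finally show ?thesis using True by simp
      next
        case False
        have "g e * (gh e * ed f) \<approx> g e * 0"
          using False arc[OF e] f' g_alg[OF e] by (intro eqv_lmult gh_ed_distinct) auto
        then show ?thesis using False by simp
      qed
    qed
    also have "\<dots> = a' * ed f + (if f \<in> X then g f else 0)"
      using X by (simp add: sum.delta)
    finally show ?thesis .
  qed
  have a'_ed: "a' * ed f \<in> rl (head E f)" if f: "f \<in> out_arcs E w" for f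
  proof -
    obtain P k where P: "finite P" "\<forall>x\<in>P. awalk (fst x) (snd x) w"
      "a' \<approx> (\<Sum>x\<in>P. scal (k x) * pth (fst x) (snd x))"
      using a' by (rule rl_formal)
    have f': "f \<in> arcs E" "tail E f = w" using f by auto
    have "a' * ed f \<approx> (\<Sum>x\<in>P. scal (k x) * pth (fst x) (snd x)) * ed f"
      using P f' by (intro eqv_rmult) auto
    also note sum_paths_ed[OF P(1,2) f]
    finally show ?thesis
      by (rule rl_eqv[rotated], intro sum_paths_rl)
         (use P f' in \<open>auto simp: awalk_simps intro!: awalk_appendI\<close>)
  qed
  show ?case
  proof (cases "\<exists>e\<in>X. a * ed e \<notin> I")
    case True
    then obtain e where e: "e \<in> X" "a * ed e \<notin> I" by blast
    have "a' * ed e + g e \<in> gl n (head E e)"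
      using e X g by (intro gl_add rl_subset_gl[OF a'_ed]) auto
    then have "a * ed e \<in> gl n (head E e)"
      using a_ed[of e] e X by (elim gl_eqv) auto
    moreover have "a * ed e \<in> B" using Suc.prems arc[OF e(1)] by (intro idl_rmult[OF B(1)]) auto
    ultimately show ?thesis using Suc.IH[of "a * ed e" "head E e"] arc[OF e(1)] e by auto
  next
    case False
    define X' where "X' = {e\<in>X. head E e \<notin> H}"
    have X': "X' \<subseteq> out_off H w" using X by (auto simp: X'_def out_off_altdef)
    \<comment> \<open>When all \<open>a e\<close> lie in \<open>I\<close>, \<open>g e\<close> is
      congruent to \<open>- a' e\<close> modulo \<open>I\<close>; substituting this into
      \<open>a\<close>, and dropping the edges into \<open>H\<close>, leaves
      \<open>t\<close>.\<close>
    define t where "t = a' * (vt w - (\<Sum>e\<in>X'. ed e * gh e))"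
    have ta: "a - t \<in> I"
    proof -
      have 1: "(\<Sum>e\<in>X. g e * gh e) + (\<Sum>e\<in>X'. a' * ed e * gh e) \<in> I"
      proof -
        have "(\<Sum>e\<in>X'. (a' * ed e + g e) * gh e) + (\<Sum>e\<in>X - X'. g e * gh e) \<in> I"
        proof (intro idl_add[OF I] idl_sum[OF I])
          fix e assume "e \<in> X'"
          then have e: "e \<in> X" by (simp add: X'_def)
          have "a' * ed e + g e \<in> I"
            using idl_eqv[OF I a_ed[of e]] False e X by auto
          then show "(a' * ed e + g e) * gh e \<in> I"
            using arc[OF e] by (intro idl_rmult[OF I]) auto
        next
          fix e assume e: "e \<in> X - X'"
          then have "gh e \<in> I"
            using arc[of e] HI by (intro idl_edge[OF I]) (auto simp: X'_def)
          then show "g e * gh e \<in> I" using e g_alg by (intro idl_lmult[OF I]) auto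
        qed
        moreover have "(\<Sum>e\<in>X. g e * gh e) = (\<Sum>e\<in>X - X'. g e * gh e) + (\<Sum>e\<in>X'. g e * gh e)"
          using X by (intro sum.subset_diff) (auto simp: X'_def)
        ultimately show ?thesis
          by (simp add: distrib_right sum.distrib algebra_simps)
      qed
      have "a - t \<approx> (a' + (\<Sum>e\<in>X. g e * gh e)) - (a' - (\<Sum>e\<in>X'. a' * ed e * gh e))"
      proof (intro eqv_diff a)
        have "t = a' * vt w - (\<Sum>e\<in>X'. a' * ed e * gh e)"
          by (simp add: t_def right_diff_distrib sum_distrib_left mult.assoc)
        then show "t \<approx> a' - (\<Sum>e\<in>X'. a' * ed e * gh e)"
          using rl_vt[OF a', of w] wH by (auto intro!: eqv_diff)
      qed
      then show ?thesis using idl_eqv[OF I] 1 by (simp add: algebra_simps)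
    qed
    have t: "t \<notin> I" "t \<in> B"
    proof -
      show "t \<notin> I" using idl_add[OF I ta, of t] Suc.prems by auto
      show "t \<in> B" using idl_diff[OF B(1), of a "a - t"] Suc.prems ta B by auto
    qed
    show ?thesis
    proof (cases "X' = out_off H w")
      case False
      then obtain f where f: "f \<in> out_off H w" "f \<notin> X'" using X' by blast
      then have f': "f \<in> out_arcs E w" "f \<notin> X" "head E f \<in> verts E - H" by (auto simp: X'_def out_off_def)
      \<comment> \<open>The ghost of \<open>f\<close> has no coefficient in \<open>a\<close>, so
        \<open>a f\<close> is ghost-free. Being a formally non-zero combination in \<open>B\<close>
        suffices here; it need not lie outside \<open>I\<close>.\<close>
      have "a' * ed f \<in> B"
        using idl_eqv[OF B(1) a_ed[OF f'(1)]] idl_rmult[OF B(1) Suc.prems(3), of "ed f"] f' by simp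
      have "a' \<notin> I"
      proof
        assume "a' \<in> I"
        then have "t \<in> I" unfolding t_def using X' Suc.prems(2)
          by (intro idl_rmult[OF I] alg_closed alg_sum) (auto simp: out_off_def)
        then show False using t by simp
      qed
      with I a' obtain P k where P: "finite P" "P \<noteq> {}" "\<forall>x\<in>P. awalk (fst x) (snd x) w" "\<forall>x\<in>P. k x \<noteq> 0"
        "a' \<approx> (\<Sum>x\<in>P. scal (k x) * pth (fst x) (snd x))"
        by (rule rl_formal_nonzero)
      have "a' * ed f \<approx> (\<Sum>x\<in>P. scal (k x) * pth (fst x) (snd x)) * ed f"
        using P f' by (intro eqv_rmult) auto
      also note sum_paths_ed[OF P(1,3) f'(1)]
      finally have "(\<Sum>x\<in>(\<lambda>x. (fst x, snd x @ [f])) ` P.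
          scal (k (fst x, butlast (snd x))) * pth (fst x) (snd x)) \<in> B"
        using idl_eqv[OF B(1)] \<open>a' * ed f \<in> B\<close> by simp
      then have "\<exists>u\<in>verts E - H. vt u \<in> B"
        by (rule formal_vertex[OF H B(1) f'(3), rotated 4])
           (use P f' in \<open>auto simp: awalk_simps intro!: awalk_appendI\<close>)
      then show ?thesis ..
    next
      case True
      then have fin: "finite (out_off H w)" using X by (simp add: X'_def flip: True)
      have t_gap: "t = a' * gap H w" by (simp add: t_def True gap_def)
      have gap_I: "gap H w \<notin> I"
        using t a'_alg by (auto simp: t_gap dest: idl_lmult[OF I])
      show ?thesis
      proof (cases "out_off H w = {}")
        case True
        then have "t \<approx> a'" using rl_vt[OF a', of w] wH by (simp add: t_gap gap_def)
        then have "a' \<notin> I" "a' \<in> B" using t idl_eqv[OF I] idl_eqv[OF B(1)] by blast+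
        then show ?thesis using rl_vertex[OF H I B(1) a'] wH by blast
      next
        case ne: False
        \<comment> \<open>At a regular \<open>w\<close> the Cuntz-Krieger relation makes
          \<open>gap H w\<close> congruent to the sum of \<open>e e\<^sup>*\<close> over the edges
          into \<open>H\<close>, hence an element of \<open>I\<close>.\<close>
        have "infinite (out_arcs E w)"
        proof
          assume fin: "finite (out_arcs E w)"
          then have "regular_vertex E w" using ne wH by (auto simp: regular_vertex_def out_off_def)
          then have 1: "vt w - (\<Sum>e\<in>out_arcs E w. ed e * gh e) \<in> I"
            using vt_sum idl_rel[OF I] by (auto simp: eqv_def)
          have "(\<Sum>e\<in>out_arcs E w. ed e * gh e) =
              (\<Sum>e\<in>out_arcs E w - out_off H w. ed e * gh e) + (\<Sum>e\<in>out_off H w. ed e * gh e)"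
            using fin by (intro sum.subset_diff) (auto simp: out_off_def)
          then have 2: "gap H w = vt w - (\<Sum>e\<in>out_arcs E w. ed e * gh e) +
              (\<Sum>e\<in>out_arcs E w - out_off H w. ed e * gh e)"
            by (simp add: gap_def algebra_simps)
          have "gap H w \<in> I"
            unfolding 2
          proof (intro idl_add[OF I 1] idl_sum[OF I])
            fix e assume e: "e \<in> out_arcs E w - out_off H w"
            then show "ed e * gh e \<in> I"
              using HI by (intro idl_lmult[OF I] idl_edge[OF I]) (auto simp: out_off_altdef)
          qed
          then show False using gap_I by simp
        qed
        then have "w \<in> breaking_vertices E H"
          using wH fin ne unfolding breaking_vertices_def infinite_emitter_def out_off_def by auto
        moreover have "w \<notin> S" using gap_I SI by blast
        moreover have "gap H w \<in> B"
        proof -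
          have "a' \<notin> I" using t idl_rmult[OF I, of a' "gap H w"] wH by (auto simp: t_gap)
          with I a' obtain P k where P: "finite P" "P \<noteq> {}" "\<forall>x\<in>P. awalk (fst x) (snd x) w" "\<forall>x\<in>P. k x \<noteq> 0"
            "a' \<approx> (\<Sum>x\<in>P. scal (k x) * pth (fst x) (snd x))"
            by (rule rl_formal_nonzero)
          \<comment> \<open>Stripping \<open>a'\<close> leaves closed paths at \<open>w\<close> with
            a non-zero constant term. Between two factors \<open>gap H w\<close> all non-empty ones
            vanish.\<close>
          obtain z Q k' where z: "z \<in> alg" and Q: "finite Q" "[] \<in> Q" "\<forall>q\<in>Q. awalk w q w" "k' [] \<noteq> 0"
            and zP: "z * (\<Sum>x\<in>P. scal (k x) * pth (fst x) (snd x)) \<approx> (\<Sum>q\<in>Q. scal (k' q) * pth w q)"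
            using P(1-4) by (rule strip_paths)
          have g: "gap H w \<in> alg" using wH by simp
          have Q_alg: "(\<Sum>q\<in>Q. scal (k' q) * pth w q) \<in> alg"
            using Q by (intro alg_sum alg_closed) auto
          have "z * a' \<approx> (\<Sum>q\<in>Q. scal (k' q) * pth w q)"
            using eqv_lmult[OF P(5) z] zP by (rule eqv_trans)
          then have "gap H w * (z * a') * gap H w \<approx> gap H w * (\<Sum>q\<in>Q. scal (k' q) * pth w q) * gap H w"
            by (rule eqv_rmult[OF eqv_lmult[OF _ g] g])
          also have "\<dots> = (\<Sum>q\<in>Q. scal (k' q) * (gap H w * pth w q * gap H w))"
            by (simp add: sum_distrib_left sum_distrib_right scal_mult_left_commute mult.assoc)
          also have "\<dots> \<approx> (\<Sum>q\<in>Q. scal (k' q) * ((if q = [] then gap H w else 0) * gap H w))"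
            using Q(3) wH fin by (intro eqv_sum eqv_scal eqv_rmult[OF _ g] gap_pth[OF H(1)]) auto
          also have "\<dots> = (\<Sum>q\<in>{[]}. scal (k' q) * (gap H w * gap H w))"
            using Q by (intro sum.mono_neutral_cong_right) auto
          also have "\<dots> = scal (k' []) * (gap H w * gap H w)"
            by simp
          also have "\<dots> \<approx> scal (k' []) * gap H w"
            using wH fin by (intro eqv_scal gap_idem) auto
          finally have *: "gap H w * (z * a') * gap H w \<approx> scal (k' []) * gap H w" .
          have "gap H w * (z * t) \<in> B"
            using t z g by (intro idl_lmult[OF B(1)])
          also have "gap H w * (z * t) = gap H w * (z * a') * gap H w"
            by (simp add: t_gap mult.assoc)
          finally have "scal (k' []) * gap H w \<in> B"
            using idl_eqv[OF B(1) *] by simp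
          then show ?thesis
            using Q(4) g by (rule idl_inverse_scal[OF B(1)]) (use g gap_idem wH fin in auto)
        qed
        ultimately show ?thesis by blast
      qed
    qed
  qed
qed

theorem reduction:
  assumes H: "hereditary E H" "has_exits H" and I: "idl I" and B: "idl B" "I \<subseteq> B" "\<not> B \<subseteq> I"
    and HI: "\<And>v. v \<in> H \<Longrightarrow> vt v \<in> I" and SI: "\<And>v. v \<in> S \<Longrightarrow> gap H v \<in> I"
  shows "(\<exists>u\<in>verts E - H. vt u \<in> B) \<or> (\<exists>u\<in>breaking_vertices E H - S. gap H u \<in> B)"
proof -
  obtain a where a: "a \<in> B" "a \<notin> I" using B(3) by blast
  then have "a \<in> alg" using idl_alg[OF B(1)] by blast
  then obtain w where w: "w \<in> verts E" "a * vt w \<notin> I"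
    using not_in_idl_vertex[OF I] a(2) by blast
  obtain n where "a * vt w \<in> gl n w"
    using alg_gl[OF \<open>a \<in> alg\<close> w(1)] by blast
  moreover have "a * vt w \<in> B"
    using a w by (intro idl_rmult[OF B(1)]) auto
  ultimately show ?thesis
    using gl_reduction[OF H I B(1,2) HI SI] w by blast
qed

end

section \<open>Condition (K)\<close>

context wf_digraph
begin

lemma path_ge_refl: "v \<in> verts G \<Longrightarrow> path_ge G v v"
  unfolding path_ge_def using awalk_Nil_iff by blast

lemma path_ge_trans: "path_ge G u v \<Longrightarrow> path_ge G v w \<Longrightarrow> path_ge G u w"
  unfolding path_ge_def by (blast intro: awalk_appendI)

lemma path_ge_arc: "e \<in> arcs G \<Longrightarrow> path_ge G (tail G e) (head G e)"
  unfolding path_ge_def by (blast intro: arc_implies_awalk)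

lemma path_ge_verts: "path_ge G u v \<Longrightarrow> u \<in> verts G \<and> v \<in> verts G"
  unfolding path_ge_def by (auto simp: awalk_hd_in_verts awalk_last_in_verts)

lemma hereditaryD: "hereditary G H \<Longrightarrow> path_ge G u v \<Longrightarrow> u \<in> H \<Longrightarrow> v \<in> H"
  unfolding hereditary_def by blast

lemma hereditary_arc: "hereditary G H \<Longrightarrow> e \<in> arcs G \<Longrightarrow> tail G e \<in> H \<Longrightarrow> head G e \<in> H"
  by (rule hereditaryD[OF _ path_ge_arc])

lemma hereditaryI:
  assumes "H \<subseteq> verts G" "\<And>e. e \<in> arcs G \<Longrightarrow> tail G e \<in> H \<Longrightarrow> head G e \<in> H"
  shows "hereditary G H"
proof -
  have "w \<in> H" if "awalk v p w" "v \<in> H" for v p w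
    using that by (induction p arbitrary: v) (auto simp: awalk_simps intro: assms(2))
  then show ?thesis using assms(1) unfolding hereditary_def path_ge_def by blast
qed

text \<open>Cut at the first return to \<open>w\<close>. The start \<open>u\<close> varies in the
  induction while the vertex to return to stays fixed.\<close>

lemma ex_simple_closed_prefix:
  assumes "awalk w q w" "q \<noteq> []"
  obtains c r where "simple_closed_path G w c" "q = c @ r"
proof -
  have "\<exists>c r. c \<noteq> [] \<and> awalk u c w \<and> (\<forall>e\<in>set (tl c). tail G e \<noteq> w) \<and> q = c @ r"
    if "awalk u q w" "q \<noteq> []" for u q
    using that
  proof (induction q arbitrary: u)
    case (Cons e q)
    show ?case
    proof (cases "head G e = w")
      case True
      then show ?thesis
        using Cons.prems by (intro exI[of _ "[e]"] exI[of _ q]) (auto simp: awalk_simps)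
    next
      case False
      then have "q \<noteq> []" "awalk (head G e) q w" using Cons.prems by (auto simp: awalk_simps)
      then obtain c r where c: "c \<noteq> []" "awalk (head G e) c w" "\<forall>e\<in>set (tl c). tail G e \<noteq> w" "q = c @ r"
        using Cons.IH by blast
      then have "tail G (hd c) = head G e" by (cases c) (auto simp: awalk_simps)
      then have "\<forall>e\<in>set c. tail G e \<noteq> w"
        using c False by (cases c) auto
      then show ?thesis
        using c Cons.prems by (intro exI[of _ "e # c"] exI[of _ r]) (auto simp: awalk_simps)
    qed
  qed simp
  then show ?thesis
    using assms that unfolding simple_closed_path_def by blast
qed

text \<open>Neither path is a proper prefix of the other, since the longer one would return to
  \<open>w\<close> too early; hence they part at some edge.\<close>

lemma simple_closed_paths_diverge:
  assumes c: "simple_closed_path G w c" and c': "simple_closed_path G w c'" and "c \<noteq> c'"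
  obtains p e r f r' where "c = p @ e # r" "c' = p @ f # r'" "e \<noteq> f"
proof -
  have no_prefix: "a' = []" if "simple_closed_path G w a" "simple_closed_path G w (a @ a')" for a a'
  proof (rule ccontr)
    assume "a' \<noteq> []"
    then obtain e b where "a' = e # b" by (cases a') auto
    moreover have "awalk w a w" "a \<noteq> []" using that by (auto simp: simple_closed_path_def)
    moreover from this have "awalk w a' w" using that by (auto simp: simple_closed_path_def)
    ultimately show False using that by (cases a) (auto simp: simple_closed_path_def awalk_simps)
  qed
  have "(\<exists>p e r f r'. c = p @ e # r \<and> c' = p @ f # r' \<and> e \<noteq> f) \<or> (\<exists>a. c = c' @ a) \<or> (\<exists>a. c' = c @ a)"
  proof (induction c arbitrary: c')
    case (Cons x c)
    show ?case
    proof (cases c')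
      case (Cons y d)
      show ?thesis
      proof (cases "x = y")
        case True
        then show ?thesis
          using Cons.IH[of d] \<open>c' = y # d\<close> by (metis append_Cons)
      next
        case False
        then show ?thesis using Cons by (metis append_Nil)
      qed
    qed simp
  qed simp
  then show ?thesis
    using no_prefix assms that by (metis append_Nil2)
qed

end

context lpa
begin

text \<open>The initial simple closed path of \<open>q\<close> and a second one part at some edge
  \<open>f\<close>. The second path leads from \<open>f\<close> back to \<open>w\<close>, which lies
  outside \<open>H\<close>, so heredity keeps the range of \<open>f\<close> outside
  \<open>H\<close>.\<close>

lemma condition_K_has_exits:
  assumes K: "condition_K E" and H: "hereditary E H"
  shows "has_exits H"
  unfolding has_exits_def
proof (intro allI impI)
  fix w q assume w: "w \<in> verts E - H" and q: "awalk w q w" "q \<noteq> []"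
  obtain c r where c: "simple_closed_path E w c" "q = c @ r"
    using q by (rule ex_simple_closed_prefix)
  obtain c' where c': "c \<noteq> c'" "simple_closed_path E w c'"
    using K c(1) unfolding condition_K_def by metis
  obtain p e s f s' where d: "c = p @ e # s" "c' = p @ f # s'" "e \<noteq> f"
    using c(1) c'(2,1) by (rule simple_closed_paths_diverge)
  have 1: "awalk w (p @ e # s) w" and 2: "awalk w (p @ f # s') w"
    using c(1) c'(2) d by (auto simp: simple_closed_path_def)
  have "f \<in> arcs E" "tail E f = tail E e" "awalk (head E f) s' w"
    using 1 2 by (auto simp: awalk_simps)
  moreover from this have "head E f \<notin> H"
    using w hereditaryD[OF H, of "head E f" w] by (auto simp: path_ge_def)
  ultimately show "\<exists>p e r f. q = p @ e # r \<and> f \<in> arcs E \<and> f \<noteq> e \<and> tail E f = tail E e \<and> head E f \<notin> H"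
    using c(2) d by (intro exI[of _ p] exI[of _ e] exI[of _ "s @ r"] exI[of _ f]) auto
qed

end

section \<open>Representations\<close>

text \<open>
  A set with a partition indexed by the vertices, where every edge \<open>e\<close> acts as a bijection \<open>cn e\<close> from
  \<open>D (head e)\<close> onto a subset of \<open>D (tail e)\<close>, these subsets being the fibres of \<open>lab\<close>. The Leavitt
  path algebra acts on the functions on such a set.
\<close>

locale branching_system = lpa E K for E :: "('v, 'e) pre_digraph" and K :: "'k::field itself" +
  fixes D :: "'v \<Rightarrow> 'x set" and lab :: "'x \<Rightarrow> 'e option" and sh :: "'x \<Rightarrow> 'x" and cn :: "'e \<Rightarrow> 'x \<Rightarrow> 'x"
  assumes D_disjoint: "x \<in> D u \<Longrightarrow> x \<in> D v \<Longrightarrow> u = v"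
    and cn: "e \<in> arcs E \<Longrightarrow> x \<in> D (head E e) \<Longrightarrow> cn e x \<in> D (tail E e)"
    and lab_cn: "e \<in> arcs E \<Longrightarrow> x \<in> D (head E e) \<Longrightarrow> lab (cn e x) = Some e"
    and sh_cn: "e \<in> arcs E \<Longrightarrow> x \<in> D (head E e) \<Longrightarrow> sh (cn e x) = x"
    and sh: "e \<in> arcs E \<Longrightarrow> x \<in> D (tail E e) \<Longrightarrow> lab x = Some e \<Longrightarrow> sh x \<in> D (head E e)"
    and cn_sh: "e \<in> arcs E \<Longrightarrow> x \<in> D (tail E e) \<Longrightarrow> lab x = Some e \<Longrightarrow> cn e (sh x) = x"
    and regular_lab: "regular_vertex E v \<Longrightarrow> x \<in> D v \<Longrightarrow> \<exists>e\<in>out_arcs E v. lab x = Some e"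
begin

text \<open>All operators are pull-backs along partial maps, so they are defined on arbitrary
  functions and no finiteness of supports has to be checked.\<close>

primrec act :: "('v, 'e) lpa_gen \<Rightarrow> ('x \<Rightarrow> 'k) \<Rightarrow> 'x \<Rightarrow> 'k" where
  "act (Vert v) \<phi> = (\<lambda>x. if x \<in> D v then \<phi> x else 0)"
| "act (Edge e) \<phi> = (\<lambda>x. if x \<in> D (tail E e) \<and> lab x = Some e then \<phi> (sh x) else 0)"
| "act (Ghost e) \<phi> = (\<lambda>x. if x \<in> D (head E e) then \<phi> (cn e x) else 0)"

definition rep :: "(('v, 'e) lpa_gen word \<Rightarrow>\<^sub>0 'k) \<Rightarrow> ('x \<Rightarrow> 'k) \<Rightarrow> 'x \<Rightarrow> 'k" where
  "rep f \<phi> x = (\<Sum>w\<in>Poly_Mapping.keys f. Poly_Mapping.lookup f w * foldr act (letters w) \<phi> x)"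

lemma act_sum: "act g (\<lambda>x. \<Sum>i\<in>A. h i x) = (\<lambda>x. \<Sum>i\<in>A. act g (h i) x)"
  by (rule ext, cases g) (auto intro!: sum.neutral)

lemma act_scale: "act g (\<lambda>x. c * \<phi> x) = (\<lambda>x. c * act g \<phi> x)"
  by (rule ext, cases g) simp_all

lemma foldr_act_sum: "foldr act l (\<lambda>x. \<Sum>i\<in>A. h i x) = (\<lambda>x. \<Sum>i\<in>A. foldr act l (h i) x)"
  by (induction l) (simp_all add: act_sum)

lemma foldr_act_scale: "foldr act l (\<lambda>x. c * \<phi> x) = (\<lambda>x. c * foldr act l \<phi> x)"
  by (induction l) (simp_all add: act_scale)

lemma rep_superset:
  assumes "finite S" "Poly_Mapping.keys f \<subseteq> S"
  shows "rep f \<phi> x = (\<Sum>w\<in>S. Poly_Mapping.lookup f w * foldr act (letters w) \<phi> x)"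
  unfolding rep_def using assms by (intro sum.mono_neutral_left) (auto simp: in_keys_iff)

lemma rep_0 [simp]: "rep 0 \<phi> x = 0"
  by (simp add: rep_def)

lemma rep_add: "rep (f + g) \<phi> x = rep f \<phi> x + rep g \<phi> x"
proof -
  let ?S = "Poly_Mapping.keys f \<union> Poly_Mapping.keys g"
  have "rep h \<phi> x = (\<Sum>w\<in>?S. Poly_Mapping.lookup h w * foldr act (letters w) \<phi> x)"
    if "h \<in> {f, g, f + g}" for h
    using that keys_add[of f g] by (intro rep_superset) auto
  then show ?thesis
    by (simp add: lookup_add distrib_right sum.distrib)
qed

lemma rep_uminus: "rep (- f) \<phi> x = - rep f \<phi> x"
  using rep_add[of f "- f" \<phi> x] by (simp add: eq_neg_iff_add_eq_0 add.commute)

lemma rep_diff: "rep (f - g) \<phi> x = rep f \<phi> x - rep g \<phi> x"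
  using rep_add[of f "- g" \<phi> x] by (simp add: rep_uminus)

lemma rep_sum: "rep (sum f A) \<phi> x = (\<Sum>i\<in>A. rep (f i) \<phi> x)"
  by (induction A rule: infinite_finite_induct) (simp_all add: rep_add)

lemma rep_single: "rep (Poly_Mapping.single w c) \<phi> x = c * foldr act (letters w) \<phi> x"
  by (subst rep_superset[of "{w}"]) (auto simp: lookup_single)

lemma rep_arg_sum: "rep f (\<lambda>x. \<Sum>i\<in>A. h i x) x = (\<Sum>i\<in>A. rep f (h i) x)"
  unfolding rep_def foldr_act_sum sum_distrib_left by (rule sum.swap)

lemma rep_arg_scale: "rep f (\<lambda>x. c * \<phi> x) x = c * rep f \<phi> x"
  unfolding rep_def foldr_act_scale sum_distrib_left by (simp add: mult.left_commute)

lemma rep_mult: "rep (f * g) \<phi> x = rep f (rep g \<phi>) x"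
proof -
  have 1: "rep (Poly_Mapping.single u c * Poly_Mapping.single v d) \<phi> x =
      rep (Poly_Mapping.single u c) (rep (Poly_Mapping.single v d) \<phi>) x" for u v c d
    by (simp add: mult_single rep_single[abs_def] foldr_act_scale mult.assoc)
  let ?s = "\<lambda>f w. Poly_Mapping.single w (Poly_Mapping.lookup f w)"
  have g: "rep g \<phi> = (\<lambda>x. \<Sum>v\<in>Poly_Mapping.keys g. rep (?s g v) \<phi> x)"
    by (rule ext) (subst poly_mapping_eq_sum_single[of g], rule rep_sum)
  have "f * g = (\<Sum>u\<in>Poly_Mapping.keys f. \<Sum>v\<in>Poly_Mapping.keys g. ?s f u * ?s g v)"
    by (subst poly_mapping_eq_sum_single[of f], subst poly_mapping_eq_sum_single[of g])
       (rule sum_product)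
  then have "rep (f * g) \<phi> x =
      (\<Sum>u\<in>Poly_Mapping.keys f. \<Sum>v\<in>Poly_Mapping.keys g. rep (?s f u) (rep (?s g v) \<phi>) x)"
    by (simp only: rep_sum 1)
  also have "\<dots> = (\<Sum>u\<in>Poly_Mapping.keys f. rep (?s f u) (rep g \<phi>) x)"
    by (simp only: g rep_arg_sum)
  also have "\<dots> = rep f (rep g \<phi>) x"
    by (subst (2) poly_mapping_eq_sum_single[of f]) (rule rep_sum[symmetric])
  finally show ?thesis .
qed

lemma rep_gen: "rep (gen g) \<phi> = act g \<phi>"
  by (rule ext) (simp add: gen_def rep_single)

lemma rep_ed_gh:
  assumes "e \<in> arcs E"
  shows "rep (ed e * gh e) \<phi> x = (if x \<in> D (tail E e) \<and> lab x = Some e then \<phi> x else 0)"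
  using assms by (auto simp: rep_mult rep_gen sh cn_sh)

definition annihilator :: "(('v, 'e) lpa_gen word \<Rightarrow>\<^sub>0 'k) set" where
  "annihilator = {f \<in> alg. \<forall>\<phi> x. rep f \<phi> x = 0}"

lemma relations_annihilator: "lpa_relations E \<subseteq> annihilator"
proof
  fix r :: "('v, 'e) lpa_gen word \<Rightarrow>\<^sub>0 'k"
  assume r: "r \<in> lpa_relations E"
  have "rep r \<phi> x = 0" for \<phi> x
    using r
  proof cases
    case (CK2 v)
    have "(\<Sum>e\<in>out_arcs E v. rep (ed e * gh e) \<phi> x) =
        (\<Sum>e\<in>out_arcs E v. if x \<in> D v \<and> lab x = Some e then \<phi> x else 0)"
      by (intro sum.cong refl) (auto simp: rep_ed_gh)
    also have "\<dots> = (if x \<in> D v then \<phi> x else 0)"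
    proof (cases "x \<in> D v")
      case True
      with CK2 obtain e where e: "e \<in> out_arcs E v" "lab x = Some e"
        using regular_lab by blast
      have "finite (out_arcs E v)" using CK2 by (simp add: regular_vertex_def)
      then have "(\<Sum>e'\<in>out_arcs E v. if e = e' then \<phi> x else 0) = \<phi> x"
        using e(1) by (simp add: sum.delta)
      with True e show ?thesis by simp
    qed simp
    finally show ?thesis
      by (simp add: CK2 rep_diff rep_sum rep_gen)
  qed (use D_disjoint in \<open>auto simp: rep_diff rep_mult rep_gen cn lab_cn sh_cn sh cn_sh\<close>)
  then show "r \<in> annihilator"
    using r relations_subset_alg by (auto simp: annihilator_def)
qed

lemma idl_annihilator: "idl annihilator"
proof -
  have z: "rep f (\<lambda>x. 0) x = 0" for f x
    using rep_arg_scale[of f 0 "\<lambda>x. 0" x] by simp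
  have "rep a \<phi> = (\<lambda>x. 0)" if "a \<in> annihilator" for a \<phi>
    using that by (auto simp: annihilator_def)
  then have "z * a \<in> annihilator" "a * z \<in> annihilator" "scal c * a \<in> annihilator"
    if "a \<in> annihilator" "z \<in> alg" for a z c
    using that by (auto simp: annihilator_def rep_mult z)
  then have ideal: "algebra_ideal annihilator (free_algebra (lpa_gens E))"
    unfolding algebra_ideal_def two_sided_ideal_free_algebra_iff smult_free_algebra
    by (auto simp: annihilator_def rep_add rep_uminus)
  then have "rel \<subseteq> annihilator"
    unfolding lpa_ideal_def using relations_annihilator by (intro hull_minimal)
  with ideal show ?thesis
    by (simp add: idl_def algebra_ideal_def)
qed

lemma vt_annihilator_iff:
  assumes "v \<in> verts E"
  shows "vt v \<in> annihilator \<longleftrightarrow> D v = {}"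
proof
  assume "vt v \<in> annihilator"
  then have "rep (vt v) (\<lambda>x. 1) x = 0" for x by (simp add: annihilator_def)
  then have "x \<notin> D v" for x by (metis rep_gen act.simps(1) zero_neq_one)
  then show "D v = {}" by blast
qed (use assms in \<open>simp add: annihilator_def rep_gen\<close>)

lemma rep_gap:
  assumes "v \<in> verts E" "finite (out_off H v)"
  shows "rep (gap H v) \<phi> x =
    (if x \<in> D v \<and> (\<forall>e\<in>out_off H v. lab x \<noteq> Some e) then \<phi> x else 0)"
proof -
  have "(\<Sum>e\<in>out_off H v. rep (ed e * gh e) \<phi> x) =
      (\<Sum>e\<in>out_off H v. if x \<in> D v \<and> lab x = Some e then \<phi> x else 0)"
    by (intro sum.cong refl) (auto simp: rep_ed_gh out_off_def)
  also have "\<dots> = (if x \<in> D v \<and> (\<exists>e\<in>out_off H v. lab x = Some e) then \<phi> x else 0)"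
  proof (cases "x \<in> D v \<and> (\<exists>e\<in>out_off H v. lab x = Some e)")
    case True
    then obtain e where e: "e \<in> out_off H v" "lab x = Some e" by blast
    then have "(\<Sum>e'\<in>out_off H v. if e = e' then \<phi> x else 0) = \<phi> x"
      using assms by (simp add: sum.delta)
    with True e show ?thesis by simp
  next
    case False
    then show ?thesis by (intro trans[OF sum.neutral]) auto
  qed
  finally show ?thesis
    by (auto simp: gap_def rep_diff rep_sum rep_gen)
qed

lemma gap_annihilator_iff:
  assumes "v \<in> verts E" "finite (out_off H v)"
  shows "gap H v \<in> annihilator \<longleftrightarrow> (\<forall>x\<in>D v. \<exists>e\<in>out_off H v. lab x = Some e)"
proof
  assume "gap H v \<in> annihilator"
  then have "rep (gap H v) (\<lambda>x. 1) x = 0" for x by (simp add: annihilator_def)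
  then show "\<forall>x\<in>D v. \<exists>e\<in>out_off H v. lab x = Some e"
    by (metis (mono_tags, lifting) rep_gap[OF assms] zero_neq_one)
qed (use assms in \<open>auto simp: annihilator_def rep_gap\<close>)

end

section \<open>Boundary paths and ideals with a prescribed admissible pair\<close>

codatatype 'e bpath = BNil | BCons 'e "'e bpath"

primcorec boundary_walk :: "('v \<Rightarrow> 'e option) \<Rightarrow> ('e \<Rightarrow> 'v) \<Rightarrow> 'v \<Rightarrow> 'e bpath" where
  "boundary_walk n h v = (case n v of None \<Rightarrow> BNil | Some e \<Rightarrow> BCons e (boundary_walk n h (h e)))"

context lpa
begin

text \<open>The boundary paths of the quotient graph by \<open>(H, S)\<close>: infinite paths outside \<open>H\<close>, and finite
  ones that end in a vertex without a Cuntz-Krieger relation.\<close>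

coinductive boundary :: "'v set \<Rightarrow> 'v set \<Rightarrow> 'v \<Rightarrow> 'e bpath \<Rightarrow> bool" for H S where
  nil: "v \<in> verts E - H \<Longrightarrow> \<not> regular_vertex E v \<Longrightarrow> v \<notin> S \<Longrightarrow> boundary H S v BNil"
| cons: "e \<in> arcs E \<Longrightarrow> tail E e \<notin> H \<Longrightarrow> boundary H S (head E e) p \<Longrightarrow> boundary H S (tail E e) (BCons e p)"

lemma boundary_not_H: "boundary H S v p \<Longrightarrow> v \<in> verts E - H"
  by (erule boundary.cases) auto

text \<open>Saturation gives a regular vertex outside \<open>H\<close> an edge with range outside
  \<open>H\<close>, and a breaking vertex has one by definition. Following such edges, one either
  continues forever or meets a vertex where a boundary path may stop.\<close>

lemma ex_boundary:
  assumes "saturated E H" "S \<subseteq> breaking_vertices E H" "v \<in> verts E - H"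
  shows "\<exists>p. boundary H S v p"
proof -
  define n where "n u = (if regular_vertex E u \<or> u \<in> S
    then Some (SOME e. e \<in> out_arcs E u \<and> head E e \<notin> H) else None)" for u
  have n: "e \<in> out_arcs E u \<and> head E e \<notin> H" if "u \<in> verts E - H" "n u = Some e" for u e
  proof -
    have "\<exists>e. e \<in> out_arcs E u \<and> head E e \<notin> H"
    proof (cases "u \<in> S")
      case True
      then show ?thesis using assms(2) by (auto simp: breaking_vertices_def)
    next
      case False
      then have "regular_vertex E u" using that by (auto simp: n_def split: if_splits)
      then show ?thesis using assms(1) that unfolding saturated_def by blast
    qed
    from someI_ex[OF this] show ?thesis using that by (auto simp: n_def split: if_splits)
  qed
  have "boundary H S v (boundary_walk n (head E) v)"
    using assms(3)
  proof (coinduction arbitrary: v)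
    case boundary
    show ?case
    proof (cases "n v")
      case None
      then show ?thesis
        using boundary by (subst boundary_walk.code) (auto simp: n_def split: if_splits)
    next
      case (Some e)
      then show ?thesis
        using boundary n[OF boundary Some]
        by (intro disjI2 exI[of _ e] exI[of _ "boundary_walk n (head E) (head E e)"])
           (auto simp: boundary_walk.code[of n _ v])
    qed
  qed
  then show ?thesis ..
qed

text \<open>The kernel of the action on boundary paths. \<open>gap H v\<close> projects onto the
  boundary paths from \<open>v\<close> that do not start with an edge to a vertex outside
  \<open>H\<close>; the only candidate is the trivial path, which exists exactly when
  \<open>v\<close> is not in \<open>S\<close>.\<close>

lemma ex_idl_pair:
  assumes "hereditary E H" "saturated E H" "S \<subseteq> breaking_vertices E H"
  obtains I where "idl I" "\<And>v. v \<in> verts E \<Longrightarrow> vt v \<in> I \<longleftrightarrow> v \<in> H"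
    "\<And>v. v \<in> breaking_vertices E H \<Longrightarrow> gap H v \<in> I \<longleftrightarrow> v \<in> S"
proof -
  \<comment> \<open>Points carry their source, since \<open>BNil\<close> does not determine it. On
    \<open>BNil\<close> the value of \<open>sh\<close> is a dummy.\<close>
  define D where "D v = {(u, p). u = v \<and> boundary H S v p}" for v
  define lab :: "'v \<times> 'e bpath \<Rightarrow> 'e option"
    where "lab x = (case snd x of BNil \<Rightarrow> None | BCons e p \<Rightarrow> Some e)" for x
  define sh where "sh x = (case snd x of BNil \<Rightarrow> x | BCons e p \<Rightarrow> (head E e, p))" for x
  define cn where "cn e x = (tail E e, BCons e (snd x))" for e and x :: "'v \<times> 'e bpath"
  interpret branching_system E K D lab sh cn
  proof
    fix e x assume e: "e \<in> arcs E" "x \<in> D (head E e)"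
    then have "tail E e \<notin> H"
      using hereditary_arc[OF assms(1) e(1)] by (auto simp: D_def dest: boundary_not_H)
    with e show "cn e x \<in> D (tail E e)"
      by (auto simp: D_def cn_def intro: boundary.intros)
    show "sh (cn e x) = x" "lab (cn e x) = Some e"
      using e by (auto simp: D_def cn_def sh_def lab_def)
  next
    fix e x assume e: "e \<in> arcs E" "x \<in> D (tail E e)" "lab x = Some e"
    then show "sh x \<in> D (head E e)" "cn e (sh x) = x"
      by (auto simp: D_def sh_def cn_def lab_def split: bpath.splits elim: boundary.cases)
  next
    fix v x assume "regular_vertex E v" "x \<in> D v"
    then show "\<exists>e\<in>out_arcs E v. lab x = Some e"
      by (auto simp: D_def lab_def elim: boundary.cases)
  qed (auto simp: D_def)
  show ?thesis
  proof
    show "idl annihilator" by (rule idl_annihilator)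
    show "vt v \<in> annihilator \<longleftrightarrow> v \<in> H" if "v \<in> verts E" for v
      using that ex_boundary[OF assms(2,3), of v] boundary_not_H[of H S v]
      by (auto simp: vt_annihilator_iff D_def)
    fix v assume v: "v \<in> breaking_vertices E H"
    then have v': "v \<in> verts E - H" "finite (out_off H v)" "\<not> regular_vertex E v"
      by (auto simp: breaking_vertices_def out_off_def infinite_emitter_def regular_vertex_def)
    show "gap H v \<in> annihilator \<longleftrightarrow> v \<in> S"
      unfolding gap_annihilator_iff[OF _ v'(2), simplified, OF conjunct1[OF v'(1)[simplified]]]
    proof
      assume *: "\<forall>x\<in>D v. \<exists>e\<in>out_off H v. lab x = Some e"
      show "v \<in> S"
      proof (rule ccontr)
        assume "v \<notin> S"
        then have "(v, BNil) \<in> D v" using v' by (auto simp: D_def intro: boundary.intros)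
        with * show False by (force simp: lab_def)
      qed
    next
      assume "v \<in> S"
      show "\<forall>x\<in>D v. \<exists>e\<in>out_off H v. lab x = Some e"
      proof
        fix x assume "x \<in> D v"
        then obtain p where p: "x = (v, p)" "boundary H S v p" by (auto simp: D_def)
        from p(2) show "\<exists>e\<in>out_off H v. lab x = Some e"
        proof cases
          case (cons e q)
          then show ?thesis
            using p(1) boundary_not_H[of H S "head E e" q]
            by (intro bexI[of _ e]) (auto simp: lab_def out_off_altdef)
        qed (use \<open>v \<in> S\<close> in simp)
      qed
    qed
  qed
qed

end

section \<open>Graphs without Condition (K)\<close>

context lpa
begin

text \<open>If a vertex \<open>v\<close> is the base of only one simple closed path \<open>c\<close>, the paths that reach \<open>v\<close> only at
  their end form a branching system where \<open>c\<close> acts on the empty path as the identity. On two copies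
  of it, \<open>c\<close> can be made to act as an involution exchanging the copies; then \<open>v - c\<close> and \<open>v + c\<close>
  annihilate each other.\<close>

lemma not_condition_K_idl:
  assumes "\<not> condition_K E"
  obtains P A B v c where "idl P" "idl A" "idl B" "\<And>a b. a \<in> A \<Longrightarrow> b \<in> B \<Longrightarrow> b * a \<in> P"
    "\<not> A \<subseteq> P" "\<not> B \<subseteq> P" "c \<noteq> []" "awalk v c v" "vt v - pth v c * pth v c \<in> P" "vt v \<notin> P"
proof -
  obtain v c where vc: "simple_closed_path E v c" and unique: "\<And>c'. simple_closed_path E v c' \<Longrightarrow> c' = c"
    using assms unfolding condition_K_def by blast
  have c: "c \<noteq> []" "awalk v c v" "\<And>e. e \<in> set (tl c) \<Longrightarrow> tail E e \<noteq> v"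
    using vc by (auto simp: simple_closed_path_def)
  have v: "v \<in> verts E" using c(2) by auto
  have hd_c: "hd c \<in> arcs E" "tail E (hd c) = v" "awalk (head E (hd c)) (tl c) v"
    using c(1,2) by (cases c; simp add: awalk_simps)+
  \<comment> \<open>Walks that meet \<open>v\<close> only at their end, in two copies told apart by
    the flag. The empty walk at \<open>v\<close> plays the part of the periodic path
    \<open>c c c ...\<close>, so its label is the first edge of \<open>c\<close>.\<close>
  define D :: "'v \<Rightarrow> ('e list \<times> bool) set" where
    "D w = {x. awalk w (fst x) v \<and> (\<forall>a\<in>set (fst x). tail E a \<noteq> v)}" for w
  define lab :: "'e list \<times> bool \<Rightarrow> 'e option" where
    "lab x = Some (if fst x = [] then hd c else hd (fst x))" for x
  define sh where "sh x = (if fst x = [] then (tl c, \<not> snd x) else (tl (fst x), snd x))" for x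
  \<comment> \<open>Prepending an edge with source \<open>v\<close> closes up to \<open>c\<close>,
    as \<open>loop\<close> shows; the result is identified with the empty walk, and the flag flips,
    so that one turn around \<open>c\<close> exchanges the copies.\<close>
  define cn where "cn e x = (if tail E e = v then ([], \<not> snd x) else (e # fst x, snd x))" for e x
  have sh_Nil: "sh x = (tl c, \<not> snd x)" if "fst x = []" for x
    using that by (simp add: sh_def)
  have sh_Cons: "sh x = (tl (fst x), snd x)" if "fst x \<noteq> []" for x
    using that by (simp add: sh_def)
  have D_v: "x \<in> D v \<longleftrightarrow> fst x = []" for x
    using v by (cases "fst x") (auto simp: D_def awalk_simps)
  \<comment> \<open>Such an edge and walk form a simple closed path at \<open>v\<close>; this is
    where the uniqueness of \<open>c\<close> enters.\<close>
  have loop: "e # fst x = c" if "e \<in> arcs E" "x \<in> D (head E e)" "tail E e = v" for e x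
    using that by (intro unique) (auto simp: simple_closed_path_def D_def awalk_simps)
  interpret branching_system E K D lab sh cn
  proof
    fix x u w assume "x \<in> D u" "x \<in> D w"
    then show "u = w" by (cases "fst x") (auto simp: D_def awalk_simps)
  next
    fix e x assume e: "e \<in> arcs E" "x \<in> D (head E e)"
    show "cn e x \<in> D (tail E e)"
      using e v by (auto simp: D_def cn_def awalk_simps)
    show "lab (cn e x) = Some e" "sh (cn e x) = x"
      using loop[OF e] by (auto simp: lab_def sh_def cn_def prod_eq_iff)
  next
    fix e x assume e: "e \<in> arcs E" "x \<in> D (tail E e)" "lab x = Some e"
    show "sh x \<in> D (head E e)" "cn e (sh x) = x"
    proof -
      consider "fst x = []" "e = hd c" | p where "fst x = e # p" "tail E e \<noteq> v"
        using e by (cases "fst x") (auto simp: lab_def D_def)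
      then have "sh x \<in> D (head E e) \<and> cn e (sh x) = x"
        by cases (use e hd_c c in \<open>auto simp: D_def sh_def cn_def awalk_simps prod_eq_iff\<close>)
      then show "sh x \<in> D (head E e)" "cn e (sh x) = x" by auto
    qed
  next
    fix w x assume "regular_vertex E w" "x \<in> D w"
    then show "\<exists>e\<in>out_arcs E w. lab x = Some e"
      using hd_c by (cases "fst x") (auto simp: D_def lab_def awalk_simps)
  qed

  define \<tau> :: "'e list \<times> bool \<Rightarrow> 'e list \<times> bool" where "\<tau> x = (fst x, \<not> snd x)" for x
  have \<tau>: "\<tau> x \<in> D w \<longleftrightarrow> x \<in> D w" "lab (\<tau> x) = lab x" "sh (\<tau> x) = \<tau> (sh x)" "cn e (\<tau> x) = \<tau> (cn e x)"
    "\<tau> (\<tau> x) = x" for x w e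
    by (auto simp: \<tau>_def D_def lab_def sh_def cn_def)
  have act_\<tau>: "act g \<phi> (\<tau> x) = act g (\<lambda>x. \<phi> (\<tau> x)) x" for g \<phi> x
    by (cases g) (simp_all add: \<tau>)
  have "foldr act l \<phi> (\<tau> x) = foldr act l (\<lambda>x. \<phi> (\<tau> x)) x" for l \<phi> x
  proof (induction l arbitrary: x)
    case (Cons g l)
    then show ?case by (simp add: act_\<tau>)
  qed simp
  then have rep_\<tau>: "rep f \<phi> (\<tau> x) = rep f (\<lambda>x. \<phi> (\<tau> x)) x" for f \<phi> x
    by (simp add: rep_def)

  \<comment> \<open>Elements whose action sends every function to one that \<open>\<tau>\<close>
    multiplies by \<open>s\<close>. As \<open>\<tau>\<close> commutes with the action, they form an
    ideal.\<close>
  define T where "T s = {f \<in> alg. \<forall>\<phi> x. rep f \<phi> (\<tau> x) = s * rep f \<phi> x}" for s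
  have TD: "rep f \<phi> (\<tau> x) = s * rep f \<phi> x" if "f \<in> T s" for f s \<phi> x
    using that unfolding T_def by blast
  have T: "idl (T s)" for s
  proof (rule idlI)
    show "rel \<subseteq> T s"
    proof
      fix f assume "f \<in> rel"
      then have "f \<in> annihilator" using idl_rel[OF idl_annihilator] by blast
      then have "f \<in> alg" "rep f \<phi> x = 0" for \<phi> x unfolding annihilator_def by blast+
      then show "f \<in> T s" by (simp add: T_def)
    qed
    show "T s \<subseteq> alg" by (auto simp: T_def)
    show "f + g \<in> T s" if "f \<in> T s" "g \<in> T s" for f g
      using that by (auto simp: T_def rep_add distrib_left)
    show "- f \<in> T s" if "f \<in> T s" for f
      using that by (auto simp: T_def rep_uminus)
    show "f * z \<in> T s" if "f \<in> T s" "z \<in> alg" for f z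
      using that by (auto simp: T_def rep_mult)
    show "z * f \<in> T s" if "f \<in> T s" "z \<in> alg" for f z
    proof -
      have "(\<lambda>x. rep f \<phi> (\<tau> x)) = (\<lambda>x. s * rep f \<phi> x)" for \<phi>
        using TD[OF that(1)] by blast
      then have "rep (z * f) \<phi> (\<tau> x) = s * rep (z * f) \<phi> x" for \<phi> x
        by (simp only: rep_mult rep_\<tau>[of z] rep_arg_scale)
      then show ?thesis using that by (simp add: T_def)
    qed
  qed
  have BA: "b * a \<in> annihilator" if "a \<in> T (- 1)" "b \<in> T 1" for a b
  proof -
    have "rep b (rep a \<phi>) x = 0" for \<phi> x
    proof -
      \<comment> \<open>The part of \<open>rep a \<phi>\<close> on one copy; an anti-invariant
        function is the difference of this part and its mirror image. No division by 2 occurs, so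
        characteristic 2 is covered.\<close>
      define \<psi> where "\<psi> y = (if snd y then rep a \<phi> y else 0)" for y
      have "rep a \<phi> y = \<psi> y + - 1 * \<psi> (\<tau> y)" for y
      proof -
        have "rep a \<phi> (\<tau> y) = - 1 * rep a \<phi> y" using that(1) by (rule TD)
        moreover have "snd (\<tau> y) \<longleftrightarrow> \<not> snd y" by (simp add: \<tau>_def)
        ultimately show ?thesis by (simp add: \<psi>_def)
      qed
      then have "rep a \<phi> = (\<lambda>y. \<Sum>i\<in>{True, False}. if i then \<psi> y else - 1 * \<psi> (\<tau> y))"
        by (intro ext) simp
      then have "rep b (rep a \<phi>) x = rep b (\<lambda>y. \<Sum>i\<in>{True, False}. if i then \<psi> y else - 1 * \<psi> (\<tau> y)) x"
        by (rule arg_cong)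
      also have "\<dots> = rep b \<psi> x + rep b (\<lambda>y. - 1 * \<psi> (\<tau> y)) x"
        unfolding rep_arg_sum by simp
      also have "\<dots> = rep b \<psi> x - rep b \<psi> (\<tau> x)"
        unfolding rep_arg_scale rep_\<tau>[symmetric] by simp
      also have "\<dots> = 0" using TD[OF that(2), of \<psi> x] by simp
      finally show ?thesis .
    qed
    then show ?thesis using that by (simp add: annihilator_def T_def rep_mult)
  qed

  have rep_tl: "rep (pth u p) \<phi> x = (if fst x = p then \<phi> ([], snd x) else 0)"
    if "awalk u p v" "\<forall>a\<in>set p. tail E a \<noteq> v" for u p \<phi> x
    using that
  proof (induction p arbitrary: u x)
    case Nil
    then show ?case by (auto simp: rep_gen D_v awalk_simps prod_eq_iff intro!: arg_cong[of _ _ \<phi>])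
  next
    case (Cons e p)
    then have IH: "rep (pth (head E e) p) \<phi> x = (if fst x = p then \<phi> ([], snd x) else 0)" for x
      by (auto simp: awalk_simps)
    have "x \<in> D (tail E e) \<and> lab x = Some e \<and> fst (sh x) = p \<longleftrightarrow> fst x = e # p"
      using Cons.prems by (cases "fst x") (auto simp: D_def lab_def sh_def awalk_simps)
    moreover have "snd (sh x) = snd x" if "fst x = e # p"
      using that by (simp add: sh_Cons)
    ultimately show ?case
      by (auto simp: rep_mult rep_gen IH)
  qed
  have rep_c: "rep (pth v c) \<phi> x = (if fst x = [] then \<phi> (\<tau> x) else 0)" for \<phi> x
  proof -
    obtain e p where ep: "c = e # p" using c(1) by (cases c) auto
    then have "rep (pth (head E e) p) \<phi> x = (if fst x = p then \<phi> ([], snd x) else 0)" for x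
      using hd_c c(3) by (intro rep_tl) auto
    then show ?thesis
      using hd_c ep by (simp add: rep_mult rep_gen D_v lab_def sh_Nil \<tau>_def)
  qed
  have rep_v: "rep (vt v) \<phi> x = (if fst x = [] then \<phi> x else 0)" for \<phi> x
    by (simp add: rep_gen D_v)
  have fst_\<tau>: "fst (\<tau> x) = fst x" "\<tau> (\<tau> x) = x" for x by (simp_all add: \<tau>_def)

  show ?thesis
  proof
    show "idl annihilator" by (rule idl_annihilator)
    show "idl (T (- 1))" "idl (T 1)" by (rule T)+
    show "b * a \<in> annihilator" if "a \<in> T (- 1)" "b \<in> T 1" for a b
      using that by (rule BA)
    \<comment> \<open>A point mass on one of the two empty walks keeps \<open>v\<close> and
      \<open>c\<close> apart even in characteristic 2, where \<open>v - c\<close> and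
      \<open>v + c\<close> agree.\<close>
    define \<delta> :: "'e list \<times> bool \<Rightarrow> 'k" where "\<delta> x = (if x = ([], True) then 1 else 0)" for x
    have "vt v - pth v c \<in> T (- 1)" "vt v + pth v c \<in> T 1"
      using v c by (auto simp: T_def rep_diff rep_add rep_v rep_c fst_\<tau>)
    moreover have "rep (vt v - pth v c) \<delta> ([], True) = 1" "rep (vt v + pth v c) \<delta> ([], True) = 1"
      by (simp_all add: rep_diff rep_add rep_v rep_c \<delta>_def \<tau>_def)
    ultimately show "\<not> T (- 1) \<subseteq> annihilator" "\<not> T 1 \<subseteq> annihilator"
      by (auto simp: annihilator_def subset_iff) (metis zero_neq_one)+
    show "c \<noteq> []" "awalk v c v" by fact+
    show "vt v - pth v c * pth v c \<in> annihilator"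
      using v c by (auto simp: annihilator_def rep_diff rep_mult rep_v rep_c fst_\<tau>)
    have "([], True) \<in> D v" by (simp add: D_v)
    then show "vt v \<notin> annihilator"
      using v by (auto simp: vt_annihilator_iff)
  qed
qed

end

section \<open>Chains of admissible pairs\<close>

context wf_digraph
begin

inductive_set sat_closure :: "'a set \<Rightarrow> 'a set" for X where
  base: "v \<in> X \<Longrightarrow> v \<in> sat_closure X"
| sat: "regular_vertex G v \<Longrightarrow> (\<And>e. e \<in> out_arcs G v \<Longrightarrow> head G e \<in> sat_closure X) \<Longrightarrow> v \<in> sat_closure X"

lemma hereditary_sat_closure:
  assumes "hereditary G X"
  shows "hereditary G (sat_closure X)"
proof (rule hereditaryI)
  show "sat_closure X \<subseteq> verts G"
  proof
    fix v assume "v \<in> sat_closure X"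
    then show "v \<in> verts G"
      by cases (use assms in \<open>auto simp: hereditary_def regular_vertex_def\<close>)
  qed
  fix e assume e: "e \<in> arcs G" "tail G e \<in> sat_closure X"
  from e(2) show "head G e \<in> sat_closure X"
    by cases (use e(1) hereditary_arc[OF assms e(1)] in \<open>auto intro: sat_closure.base\<close>)
qed

lemma saturated_sat_closure: "saturated G (sat_closure X)"
  unfolding saturated_def by (auto intro: sat_closure.sat)

text \<open>Saturating adds only regular vertices. For a breaking vertex, membership in a closure
  thus becomes membership in the generating set.\<close>

lemma sat_closure_infinite_emitter:
  "v \<in> sat_closure X \<Longrightarrow> infinite (out_arcs G v) \<Longrightarrow> v \<in> X"
  by (erule sat_closure.cases) (auto simp: regular_vertex_def)

text \<open>A vertex outside \<open>H\<close> that is added by saturation has an edge with range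
  outside \<open>H\<close>, because \<open>H\<close> is saturated; the induction continues from that
  range.\<close>

lemma sat_closure_reaches:
  assumes H: "saturated G H" "v \<in> sat_closure (H \<union> T)" "T \<subseteq> verts G"
  shows "v \<in> H \<or> (\<exists>w\<in>T. path_ge G v w)"
  using H(2)
proof induction
  case (base v)
  then show ?case using H(3) path_ge_refl by blast
next
  case (sat v)
  show ?case
  proof (cases "head G ` out_arcs G v \<subseteq> H")
    case True
    then show ?thesis using H(1) sat(1) by (auto simp: saturated_def)
  next
    case False
    then obtain e where "e \<in> out_arcs G v" "head G e \<notin> H" by blast
    with sat.IH obtain w where "w \<in> T" "path_ge G (head G e) w" by blast
    then show ?thesis
      using \<open>e \<in> out_arcs G v\<close> path_ge_trans path_ge_arc by (metis in_out_arcs_conv)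
  qed
qed

definition desc :: "'a set \<Rightarrow> 'a \<Rightarrow> 'a set" where
  "desc H u = {w. path_ge G u w \<and> w \<notin> H}"

lemma hereditary_Un_desc:
  assumes "hereditary G H"
  shows "hereditary G (H \<union> desc H u)"
proof (rule hereditaryI)
  show "H \<union> desc H u \<subseteq> verts G"
    using assms path_ge_verts[of u] by (auto simp: hereditary_def desc_def)
  show "head G e \<in> H \<union> desc H u" if "e \<in> arcs G" "tail G e \<in> H \<union> desc H u" for e
    using that hereditary_arc[OF assms] path_ge_trans[OF _ path_ge_arc[OF that(1)]]
    by (auto simp: desc_def)
qed

lemma admissible_desc:
  assumes "hereditary G H"
  shows "(sat_closure (H \<union> desc H u), {}) \<in> admissible_pairs G"
  using hereditary_sat_closure[OF hereditary_Un_desc[OF assms]] saturated_sat_closure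
  by (simp add: admissible_pairs_def)

text \<open>Reachability in the quotient graph, read off in the original graph: the new vertices are sinks.\<close>

definition quot_ge :: "'a set \<Rightarrow> 'a + 'a \<Rightarrow> 'a + 'a \<Rightarrow> bool" where
  "quot_ge H x y \<longleftrightarrow> (case y of
     Inl w \<Rightarrow> (\<exists>u. x = Inl u \<and> path_ge G u w)
   | Inr w \<Rightarrow> x = Inr w \<or> (\<exists>u e. x = Inl u \<and> path_ge G u (tail G e) \<and> e \<in> arcs G \<and> head G e = w))"

lemma wf_quotient_graph:
  assumes "hereditary G H"
  shows "wf_digraph (quotient_graph G H S)"
  using hereditary_arc[OF assms]
  by unfold_locales (auto simp: quotient_graph_def breaking_vertices_def)

lemma quotient_path_ge:
  assumes H: "hereditary G H" and x: "x \<in> verts (quotient_graph G H S)"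
    and y: "y \<in> verts (quotient_graph G H S)"
  shows "path_ge (quotient_graph G H S) x y \<longleftrightarrow> quot_ge H x y"
proof
  interpret Q: wf_digraph "quotient_graph G H S" using H by (rule wf_quotient_graph)
  let ?Q = "quotient_graph G H S"
  have "quot_ge H x y" if "Q.awalk x p y" for x p
    using that
  proof (induction p arbitrary: x)
    case Nil
    then have "x = y" "x \<in> verts ?Q" using Q.awalk_Nil_iff by auto
    then show ?case
      using path_ge_refl by (auto simp: quot_ge_def quotient_graph_def)
  next
    case (Cons f p)
    then have f: "f \<in> arcs ?Q" "tail ?Q f = x" and IH: "quot_ge H (head ?Q f) y"
      by (auto simp: Q.awalk_simps)
    show ?case
    proof (cases f)
      case (Inl e)
      then have e: "e \<in> arcs G" "x = Inl (tail G e)" "head ?Q f = Inl (head G e)"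
        using f by (auto simp: quotient_graph_def)
      then show ?thesis
        using IH path_ge_trans[OF path_ge_arc[OF e(1)]]
        by (auto simp: quot_ge_def split: sum.splits)
    next
      case (Inr e)
      then have e: "e \<in> arcs G" "x = Inl (tail G e)" "head ?Q f = Inr (head G e)"
        using f by (auto simp: quotient_graph_def)
      then show ?thesis
        using IH path_ge_refl[of "tail G e"] by (auto simp: quot_ge_def split: sum.splits)
    qed
  qed
  then show "quot_ge H x y" if "path_ge ?Q x y"
    using that unfolding path_ge_def by blast
  \<comment> \<open>A walk that ends outside a hereditary set never meets it, so all its edges are
    edges of the quotient graph.\<close>
  have lift: "path_ge ?Q (Inl u) (Inl w)" if "awalk u p w" "w \<notin> H" for u p w
    using that
  proof (induction p arbitrary: u)
    case Nil
    then have "u = w" "u \<in> verts G" using awalk_Nil_iff by auto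
    then show ?case using Nil Q.path_ge_refl[of "Inl u"] by (auto simp: quotient_graph_def)
  next
    case (Cons e p)
    then have e: "e \<in> arcs G" "tail G e = u" "awalk (head G e) p w" by (auto simp: awalk_simps)
    then have "head G e \<notin> H"
      using Cons.prems hereditaryD[OF H, of "head G e" w] by (auto simp: path_ge_def)
    then have "Inl e \<in> arcs ?Q" using e by (simp add: quotient_graph_def)
    then have "path_ge ?Q (Inl u) (Inl (head G e))"
      using Q.path_ge_arc[of "Inl e"] e by (simp add: quotient_graph_def)
    then show ?case using Cons.IH[OF e(3)] Cons.prems by (blast intro: Q.path_ge_trans)
  qed
  show "path_ge ?Q x y" if xy: "quot_ge H x y"
  proof (cases y)
    case (Inl w)
    then have "w \<notin> H" using y by (auto simp: quotient_graph_def)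
    then show ?thesis using xy lift Inl by (auto simp: quot_ge_def path_ge_def[of G])
  next
    case (Inr w)
    show ?thesis
    proof (cases "x = Inr w")
      case True
      then show ?thesis using Inr y Q.path_ge_refl by simp
    next
      case False
      then obtain u e where u: "x = Inl u" "path_ge G u (tail G e)" "e \<in> arcs G" "head G e = w"
        using xy Inr by (auto simp: quot_ge_def)
      have w: "w \<in> breaking_vertices G H - S" using y Inr by (auto simp: quotient_graph_def)
      then have "tail G e \<notin> H"
        using u hereditary_arc[OF H, of e] by (auto simp: breaking_vertices_def)
      then have "path_ge ?Q x (Inl (tail G e))"
        using u lift by (auto simp: path_ge_def[of G])
      moreover have "Inr e \<in> arcs ?Q" using u w by (simp add: quotient_graph_def)
      then have "path_ge ?Q (Inl (tail G e)) y"
        using Q.path_ge_arc[of "Inr e"] Inr u by (simp add: quotient_graph_def)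
      ultimately show ?thesis by (rule Q.path_ge_trans)
    qed
  qed
qed

text \<open>Compare \<open>(H, {u})\<close> with \<open>(H, {v})\<close>; breaking vertices lie
  outside \<open>H\<close>, so neither can be absorbed there.\<close>

lemma chain_breaking_vertices:
  assumes chain: "\<forall>p \<in> admissible_pairs G. \<forall>q \<in> admissible_pairs G. pair_le p q \<or> pair_le q p"
    and H: "hereditary G H" "saturated G H" and u: "u \<in> breaking_vertices G H" and v: "v \<in> breaking_vertices G H"
  shows "u = v"
proof -
  have "(H, {u}) \<in> admissible_pairs G" "(H, {v}) \<in> admissible_pairs G"
    using H u v by (auto simp: admissible_pairs_def)
  then have "pair_le (H, {u}) (H, {v}) \<or> pair_le (H, {v}) (H, {u})" using chain by blast
  then show ?thesis using u v by (auto simp: breaking_vertices_def)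
qed

text \<open>Two old vertices have a common descendant because the closures of their descendants are
  comparable. Every old vertex lies above every new one, and there is at most one new
  vertex.\<close>

lemma chain_downward_directed:
  assumes chain: "\<forall>p \<in> admissible_pairs G. \<forall>q \<in> admissible_pairs G. pair_le p q \<or> pair_le q p"
    and HS: "(H, S) \<in> admissible_pairs G"
  shows "downward_directed (quotient_graph G H S) (verts (quotient_graph G H S))"
proof -
  let ?Q = "quotient_graph G H S"
  have H: "hereditary G H" "saturated G H" and S: "S \<subseteq> breaking_vertices G H"
    using HS by (auto simp: admissible_pairs_def)
  have ll: "\<exists>w\<in>verts G - H. path_ge G u w \<and> path_ge G v w"
    if uv: "u \<in> verts G - H" "v \<in> verts G - H" for u v
  proof -
    have *: "\<exists>w\<in>verts G - H. path_ge G u w \<and> path_ge G v w"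
      if "pair_le (sat_closure (H \<union> desc H u), {}) (sat_closure (H \<union> desc H v), {})"
        "u \<in> verts G - H" for u v
    proof -
      have "u \<in> desc H u" using that path_ge_refl by (auto simp: desc_def)
      then have "u \<in> sat_closure (H \<union> desc H v)"
        using that(1) sat_closure.base[of u "H \<union> desc H u"] by auto
      moreover have "desc H v \<subseteq> verts G" using path_ge_verts by (auto simp: desc_def)
      ultimately obtain w where "w \<in> desc H v" "path_ge G u w"
        using sat_closure_reaches[OF H(2)] \<open>u \<in> verts G - H\<close> by blast
      then show ?thesis using path_ge_verts by (auto simp: desc_def)
    qed
    show ?thesis
      using chain admissible_desc[OF H(1), of u] admissible_desc[OF H(1), of v] *[of u v] *[of v u] uv
      by blast
  qed
  have lr: "quot_ge H (Inl u) (Inr v)" if u: "u \<in> verts G - H" and v: "v \<in> breaking_vertices G H - S" for u v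
  proof -
    have v_inf: "infinite (out_arcs G v)" "v \<notin> H" and v_out: "\<exists>e\<in>out_arcs G v. head G e \<in> verts G - H"
      using v by (auto simp: breaking_vertices_def infinite_emitter_def)
    have reach: "path_ge G u v" if "u \<in> verts G - H" for u
    proof -
      \<comment> \<open>The closure generated by \<open>u\<close> is not below
        \<open>(H, S \<union> {v})\<close>, as it contains \<open>u\<close>; so it contains the
        infinite emitter \<open>v\<close>, which must be a descendant of \<open>u\<close>.\<close>
      have "(H, S \<union> {v}) \<in> admissible_pairs G"
        using H S v by (auto simp: admissible_pairs_def)
      moreover have "\<not> pair_le (sat_closure (H \<union> desc H u), {}) (H, S \<union> {v})"
        using that path_ge_refl[of u] sat_closure.base[of u "H \<union> desc H u"] by (auto simp: desc_def)
      ultimately have "pair_le (H, S \<union> {v}) (sat_closure (H \<union> desc H u), {})"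
        using chain admissible_desc[OF H(1), of u] by blast
      then have "v \<in> sat_closure (H \<union> desc H u)" by auto
      then have "v \<in> H \<union> desc H u"
        by (rule sat_closure_infinite_emitter[OF _ v_inf(1)])
      then show ?thesis using v_inf by (auto simp: desc_def)
    qed
    obtain e where e: "e \<in> out_arcs G v" "head G e \<in> verts G - H" using v_out by blast
    obtain p where p: "awalk (head G e) p v" using reach[OF e(2)] by (auto simp: path_ge_def)
    \<comment> \<open>From another vertex, the sink \<open>v'\<close> is reached only through copies
      of edges into \<open>v\<close>. Leaving \<open>v\<close> by \<open>e\<close> and returning
      provides such an edge even when \<open>u = v\<close>.\<close>
    have "\<exists>f\<in>arcs G. head G f = v \<and> path_ge G v (tail G f)"
    proof (cases p rule: rev_cases)
      case Nil
      then show ?thesis using p e path_ge_refl[of v] by (intro bexI[of _ e]) (auto simp: awalk_simps)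
    next
      case (snoc r f)
      then have "path_ge G (head G e) (tail G f)" "f \<in> arcs G" "head G f = v"
        using p by (auto simp: awalk_simps path_ge_def)
      then show ?thesis using e path_ge_trans[OF path_ge_arc[of e]] by auto
    qed
    then obtain f where f: "f \<in> arcs G" "head G f = v" "path_ge G v (tail G f)" by blast
    then have "path_ge G u (tail G f)" using path_ge_trans[OF reach[OF u]] by blast
    then show ?thesis using f by (auto simp: quot_ge_def)
  qed
  show ?thesis
    unfolding downward_directed_def
  proof (intro ballI)
    fix x y assume x: "x \<in> verts ?Q" and y: "y \<in> verts ?Q"
    have "\<exists>z\<in>verts ?Q. quot_ge H x z \<and> quot_ge H y z"
    proof (cases x; cases y)
      fix u v assume uv: "x = Inl u" "y = Inl v"
      then obtain w where "w \<in> verts G - H" "path_ge G u w" "path_ge G v w"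
        using ll[of u v] x y by (auto simp: quotient_graph_def)
      then show ?thesis
        using uv by (intro bexI[of _ "Inl w"]) (auto simp: quot_ge_def quotient_graph_def)
    next
      fix u v assume "x = Inl u" "y = Inr v"
      then show ?thesis
        using lr[of u v] x y by (intro bexI[of _ y]) (auto simp: quot_ge_def quotient_graph_def)
    next
      fix u v assume "x = Inr u" "y = Inl v"
      then show ?thesis
        using lr[of v u] x y by (intro bexI[of _ x]) (auto simp: quot_ge_def quotient_graph_def)
    next
      fix u v assume "x = Inr u" "y = Inr v"
      then show ?thesis
        using chain_breaking_vertices[OF chain H, of u v] x y
        by (intro bexI[of _ x]) (auto simp: quot_ge_def quotient_graph_def)
    qed
    then show "\<exists>z\<in>verts ?Q. path_ge ?Q x z \<and> path_ge ?Q y z"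
      using quotient_path_ge[OF H(1)] x y by blast
  qed
qed

end

section \<open>Ideals of graphs with Condition (K)\<close>

context lpa
begin

section \<open>The admissible pair of an ideal\<close>

definition vset :: "(('v, 'e) lpa_gen word \<Rightarrow>\<^sub>0 'k) set \<Rightarrow> 'v set" where
  "vset I = {v \<in> verts E. vt v \<in> I}"

definition gapset :: "(('v, 'e) lpa_gen word \<Rightarrow>\<^sub>0 'k) set \<Rightarrow> 'v set" where
  "gapset I = {v \<in> breaking_vertices E (vset I). gap (vset I) v \<in> I}"

text \<open>For a path \<open>p\<close> from \<open>u\<close> to \<open>w\<close>,
  \<open>p\<^sup>* u p = w\<close>.\<close>

lemma idl_path:
  assumes I: "idl I" and u: "vt u \<in> I" and uw: "path_ge E u w"
  shows "vt w \<in> I"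
proof -
  obtain p where p: "awalk u p w" using uw by (auto simp: path_ge_def)
  have "vt u * pth u p \<in> I" using u p by (intro idl_rmult[OF I]) auto
  then have "pth u p \<in> I" using idl_eqv[OF I vt_pth[OF p, of u]] p by auto
  then have "gth u p * pth u p \<in> I" using p by (intro idl_lmult[OF I]) auto
  moreover have "gth u p * pth u p \<approx> vt w" using gth_pth[OF p p] by simp
  ultimately show ?thesis using idl_eqv[OF I] by simp
qed

lemma hereditary_vset: "idl I \<Longrightarrow> hereditary E (vset I)"
  unfolding hereditary_def using idl_path path_ge_verts by (auto simp: vset_def)

lemma saturated_vset:
  assumes I: "idl I"
  shows "saturated E (vset I)"
  unfolding saturated_def
proof (intro allI impI)
  fix v assume v: "regular_vertex E v \<and> head E ` out_arcs E v \<subseteq> vset I"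
  have "vt (head E e) \<in> I" if "e \<in> out_arcs E v" for e
    using v that unfolding vset_def by blast
  then have "(\<Sum>e\<in>out_arcs E v. ed e * gh e) \<in> I"
    by (intro idl_sum[OF I] idl_lmult[OF I] idl_edge[OF I]) auto
  then have "vt v \<in> I" using idl_eqv[OF I vt_sum] v by simp
  then show "v \<in> vset I" using v by (simp add: vset_def regular_vertex_def)
qed

lemma admissible_vset: "idl I \<Longrightarrow> (vset I, gapset I) \<in> admissible_pairs E"
  by (auto simp: admissible_pairs_def hereditary_vset saturated_vset gapset_def)

lemma breaking_out_off:
  "v \<in> breaking_vertices E H \<longleftrightarrow>
    v \<in> verts E - H \<and> infinite_emitter E v \<and> finite (out_off H v) \<and> out_off H v \<noteq> {}"
  by (auto simp: breaking_vertices_def out_off_def)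

definition elt :: "'v set \<Rightarrow> 'v + 'v \<Rightarrow> ('v, 'e) lpa_gen word \<Rightarrow>\<^sub>0 'k" where
  "elt H x = (case x of Inl v \<Rightarrow> vt v | Inr v \<Rightarrow> gap H v)"

text \<open>Ideals propagate along paths of the quotient graph, with \<open>v\<^sup>H\<close>
  standing for the new vertex \<open>v'\<close>. Downward directedness can thus produce a common
  element of two ideals.\<close>

lemma elt_quot_ge:
  assumes A: "idl A" and x: "elt H x \<in> A" and xy: "quot_ge H x y" and y: "y \<in> verts (quotient_graph E H S)"
  shows "elt H y \<in> A"
proof (cases y)
  case (Inl w)
  then show ?thesis using xy x idl_path[OF A] by (auto simp: quot_ge_def elt_def)
next
  case (Inr w)
  show ?thesis
  proof (cases "x = Inr w")
    case False
    then obtain u e where u: "x = Inl u" "path_ge E u (tail E e)" "e \<in> arcs E" "head E e = w"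
      using xy Inr by (auto simp: quot_ge_def)
    then have w: "w \<in> verts E" by auto
    have "vt w \<in> A"
      using x u path_ge_trans[OF u(2) path_ge_arc[OF u(3)]] idl_path[OF A] by (auto simp: elt_def)
    then have "vt w * gap H w \<in> A" using w by (intro idl_rmult[OF A]) auto
    then show ?thesis using idl_eqv[OF A vt_gap[OF w]] Inr by (simp add: elt_def)
  qed (use x Inr in simp)
qed

lemma elt_idem:
  assumes "y \<in> verts (quotient_graph E H S)"
  shows "elt H y * elt H y \<approx> elt H y"
  using assms by (auto simp: quotient_graph_def elt_def breaking_out_off intro!: vt_idem gap_idem)

lemma elt_alg: "y \<in> verts (quotient_graph E H S) \<Longrightarrow> elt H y \<in> alg"
  by (auto simp: quotient_graph_def elt_def breaking_out_off)

lemma idl_plus: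
  assumes I: "idl I" and A: "idl A"
  shows "idl {a + i | a i. a \<in> A \<and> i \<in> I}"
proof (rule idlI)
  show "rel \<subseteq> {a + i | a i. a \<in> A \<and> i \<in> I}"
  proof
    fix r assume "r \<in> rel"
    then have "r \<in> A" using idl_rel[OF A] by blast
    moreover have "r = r + 0" by simp
    ultimately show "r \<in> {a + i | a i. a \<in> A \<and> i \<in> I}" using idl_0[OF I] by blast
  qed
  show "{a + i | a i. a \<in> A \<and> i \<in> I} \<subseteq> alg"
    using idl_alg[OF I] idl_alg[OF A] by (auto intro: free_algebra_add)
  fix x assume "x \<in> {a + i | a i. a \<in> A \<and> i \<in> I}"
  then obtain a i where x: "x = a + i" "a \<in> A" "i \<in> I" by blast
  have "- x = - a + - i" using x by simp
  then show "- x \<in> {a + i | a i. a \<in> A \<and> i \<in> I}"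
    using idl_uminus[OF I x(3)] idl_uminus[OF A x(2)] by blast
  show "z * x \<in> {a + i | a i. a \<in> A \<and> i \<in> I}" "x * z \<in> {a + i | a i. a \<in> A \<and> i \<in> I}" if z: "z \<in> alg" for z
    using x idl_lmult[OF I x(3) z] idl_lmult[OF A x(2) z] idl_rmult[OF I x(3) z] idl_rmult[OF A x(2) z]
    by (auto simp: distrib_left distrib_right)
  fix y assume "y \<in> {a + i | a i. a \<in> A \<and> i \<in> I}"
  then obtain b j where y: "y = b + j" "b \<in> A" "j \<in> I" by blast
  have "x + y = (a + b) + (i + j)" using x y by (simp add: algebra_simps)
  then show "x + y \<in> {a + i | a i. a \<in> A \<and> i \<in> I}"
    using idl_add[OF I x(3) y(3)] idl_add[OF A x(2) y(2)] by blast
qed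

lemma ex_elt_plus:
  assumes K: "condition_K E" and I: "idl I" and A: "idl A" "\<not> A \<subseteq> I"
  obtains x where "x \<in> verts (quotient_graph E (vset I) (gapset I))"
    "elt (vset I) x \<in> {a + i | a i. a \<in> A \<and> i \<in> I}"
proof -
  let ?H = "vset I" and ?S = "gapset I" and ?A = "{a + i | a i. a \<in> A \<and> i \<in> I}"
  have "I \<subseteq> ?A"
  proof
    fix i assume "i \<in> I"
    moreover have "i = 0 + i" by simp
    ultimately show "i \<in> ?A" using idl_0[OF A(1)] by blast
  qed
  moreover have "A \<subseteq> ?A"
  proof
    fix a assume "a \<in> A"
    moreover have "a = a + 0" by simp
    ultimately show "a \<in> ?A" using idl_0[OF I] by blast
  qed
  then have "\<not> ?A \<subseteq> I" using A(2) by (metis (no_types, lifting) subset_trans)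
  ultimately have "(\<exists>u\<in>verts E - ?H. vt u \<in> ?A) \<or> (\<exists>u\<in>breaking_vertices E ?H - ?S. gap ?H u \<in> ?A)"
    by (intro reduction[OF hereditary_vset[OF I] condition_K_has_exits[OF K hereditary_vset[OF I]] I
          idl_plus[OF I A(1)]]) (simp_all add: vset_def gapset_def)
  then consider u where "u \<in> verts E - ?H" "vt u \<in> ?A"
    | u where "u \<in> breaking_vertices E ?H - ?S" "gap ?H u \<in> ?A"
    by blast
  then show ?thesis
  proof cases
    case 1
    then show ?thesis by (intro that[of "Inl u"]) (simp_all add: quotient_graph_def elt_def)
  next
    case 2
    then show ?thesis by (intro that[of "Inr u"]) (simp_all add: quotient_graph_def elt_def)
  qed
qed

text \<open>A common element \<open>e\<close> of \<open>A + I\<close> and \<open>B + I\<close> that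
  belongs to a vertex of the quotient graph is idempotent, so \<open>e = e e\<close> lies in
  \<open>A B + I\<close> and hence in \<open>I\<close>. But the quotient graph has no vertex whose
  element lies in \<open>I\<close>.\<close>

lemma condition_b_prime:
  assumes K: "condition_K E"
    and dd: "\<forall>(H, S) \<in> admissible_pairs E. downward_directed (quotient_graph E H S) (verts (quotient_graph E H S))"
    and I: "idl I" and A: "idl A" and B: "idl B" and AB: "\<And>a b. a \<in> A \<Longrightarrow> b \<in> B \<Longrightarrow> a * b \<in> I"
  shows "A \<subseteq> I \<or> B \<subseteq> I"
proof (rule ccontr)
  assume not: "\<not> (A \<subseteq> I \<or> B \<subseteq> I)"
  let ?H = "vset I" and ?S = "gapset I"
  let ?A = "{a + i | a i. a \<in> A \<and> i \<in> I}" and ?B = "{b + i | b i. b \<in> B \<and> i \<in> I}"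
  let ?Q = "quotient_graph E ?H ?S"
  obtain x where x: "x \<in> verts ?Q" "elt ?H x \<in> ?A"
    using ex_elt_plus[OF K I A] not by blast
  obtain y where y: "y \<in> verts ?Q" "elt ?H y \<in> ?B"
    using ex_elt_plus[OF K I B] not by blast
  have "downward_directed ?Q (verts ?Q)"
    using dd admissible_vset[OF I] by blast
  then obtain w where w: "w \<in> verts ?Q" "path_ge ?Q x w" "path_ge ?Q y w"
    using x y unfolding downward_directed_def by blast
  then have "elt ?H w \<in> ?A" "elt ?H w \<in> ?B"
    using elt_quot_ge[OF idl_plus[OF I A] x(2) _ w(1)] elt_quot_ge[OF idl_plus[OF I B] y(2) _ w(1)]
      quotient_path_ge[OF hereditary_vset[OF I]] x y by blast+
  then obtain a i b j where ab: "elt ?H w = a + i" "a \<in> A" "i \<in> I" "elt ?H w = b + j" "b \<in> B" "j \<in> I"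
    by blast
  have "a \<in> alg" using ab(2) idl_alg[OF A] by blast
  have "elt ?H w * elt ?H w = a * (b + j) + i * elt ?H w"
    by (metis ab(1,4) distrib_right)
  also have "\<dots> = a * b + a * j + i * elt ?H w"
    by (simp only: distrib_left)
  also have "\<dots> \<in> I"
    by (intro idl_add[OF I] AB[OF ab(2,5)] idl_lmult[OF I ab(6) \<open>a \<in> alg\<close>]
      idl_rmult[OF I ab(3) elt_alg[OF w(1)]])
  finally have "elt ?H w \<in> I"
    using idl_eqv[OF I elt_idem[OF w(1)]] by simp
  then show False
    using w(1) by (auto simp: quotient_graph_def elt_def vset_def gapset_def)
qed

text \<open>The two elements differ by terms \<open>e e\<^sup>*\<close> where the range of
  \<open>e\<close> has moved into \<open>H2\<close>, and these lie in \<open>I\<close>.\<close>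

lemma gap_diff:
  assumes I: "idl I" "\<And>w. w \<in> H2 \<Longrightarrow> vt w \<in> I" and H: "H1 \<subseteq> H2" "finite (out_off H1 v)"
  shows "gap H2 v - gap H1 v \<in> I"
proof -
  have sub: "out_off H2 v \<subseteq> out_off H1 v" using H by (auto simp: out_off_def)
  then have "(\<Sum>e\<in>out_off H1 v. ed e * gh e) =
      (\<Sum>e\<in>out_off H1 v - out_off H2 v. ed e * gh e) + (\<Sum>e\<in>out_off H2 v. ed e * gh e)"
    using H by (intro sum.subset_diff) auto
  then have "gap H2 v - gap H1 v = (\<Sum>e\<in>out_off H1 v - out_off H2 v. ed e * gh e)"
    by (simp add: gap_def)
  also have "\<dots> \<in> I"
    using I(2) by (intro idl_sum[OF I(1)] idl_lmult[OF I(1)] idl_edge[OF I(1)]) (auto simp: out_off_def)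
  finally show ?thesis .
qed

lemma idl_Int: "idl I \<Longrightarrow> idl J \<Longrightarrow> idl (I \<inter> J)"
  using idl_rel[of I] idl_rel[of J] idl_alg[of I]
  by (intro idlI) (auto intro: idl_add idl_uminus idl_lmult idl_rmult)

lemma pair_le_subset:
  assumes K: "condition_K E" and I: "idl I" and J: "idl J"
    and le: "pair_le (vset I, gapset I) (vset J, gapset J)"
  shows "I \<subseteq> J"
proof (rule ccontr)
  assume "\<not> I \<subseteq> J"
  then have not: "\<not> I \<subseteq> I \<inter> J" by blast
  have HI: "vt v \<in> I \<inter> J" if "v \<in> vset I" for v
    using that le by (auto simp: vset_def)
  have SI: "gap (vset I) v \<in> I \<inter> J" if v: "v \<in> gapset I" for v
  proof -
    have v': "v \<in> verts E" "finite (out_off (vset I) v)"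
      using v by (auto simp: gapset_def breaking_out_off)
    have "gap (vset I) v \<in> J"
    \<comment> \<open>The order on pairs allows \<open>v\<close> to be absorbed as a vertex of
      \<open>J\<close> or to stay breaking for the larger set; in the second case
      \<open>gap_diff\<close> converts the element.\<close>
    proof (cases "v \<in> vset J")
      case True
      then have "gap (vset I) v * vt v \<in> J"
        using v' by (intro idl_lmult[OF J]) (auto simp: vset_def)
      then show ?thesis using idl_eqv[OF J gap_vt[OF v'(1)]] by simp
    next
      case False
      then have "gap (vset J) v \<in> J" using le v by (auto simp: gapset_def)
      moreover have "gap (vset J) v - gap (vset I) v \<in> J"
        using le v' by (intro gap_diff[OF J]) (auto simp: vset_def)
      ultimately show ?thesis using idl_diff[OF J] by fastforce
    qed
    then show ?thesis using v by (simp add: gapset_def)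
  qed
  show False
    using reduction[OF hereditary_vset[OF I] condition_K_has_exits[OF K hereditary_vset[OF I]]
        idl_Int[OF I J] I _ not HI SI] by (auto simp: vset_def gapset_def)
qed

lemma condition_b_chain:
  assumes "condition_K E" "\<forall>p \<in> admissible_pairs E. \<forall>q \<in> admissible_pairs E. pair_le p q \<or> pair_le q p"
    "idl I" "idl J"
  shows "I \<subseteq> J \<or> J \<subseteq> I"
  using assms pair_le_subset admissible_vset by blast

text \<open>The point is that a vertex of \<open>S1\<close> outside \<open>H2\<close> remains
  breaking for \<open>H2\<close>: if all its edges led into \<open>H2\<close>, then
  \<open>gap H2 v = vt v\<close> would lie in \<open>I2\<close>.\<close>

lemma subset_pair_le:
  assumes adm1: "(H1, S1) \<in> admissible_pairs E"
    and I1: "\<And>v. v \<in> verts E \<Longrightarrow> vt v \<in> I1 \<longleftrightarrow> v \<in> H1"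
      "\<And>v. v \<in> breaking_vertices E H1 \<Longrightarrow> gap H1 v \<in> I1 \<longleftrightarrow> v \<in> S1"
    and I2: "idl I2" "\<And>v. v \<in> verts E \<Longrightarrow> vt v \<in> I2 \<longleftrightarrow> v \<in> H2"
      "\<And>v. v \<in> breaking_vertices E H2 \<Longrightarrow> gap H2 v \<in> I2 \<longleftrightarrow> v \<in> S2"
    and H2: "H2 \<subseteq> verts E" and le: "I1 \<subseteq> I2"
  shows "pair_le (H1, S1) (H2, S2)"
proof -
  have "H1 \<subseteq> verts E" "S1 \<subseteq> breaking_vertices E H1"
    using adm1 by (auto simp: admissible_pairs_def hereditary_def)
  then have H: "H1 \<subseteq> H2" using I1 I2 le by blast
  have "v \<in> S2" if v: "v \<in> S1" "v \<notin> H2" for v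
  proof -
    have b: "v \<in> breaking_vertices E H1" using v \<open>S1 \<subseteq> breaking_vertices E H1\<close> by blast
    then have v': "v \<in> verts E" "infinite_emitter E v" "finite (out_off H1 v)"
      by (auto simp: breaking_out_off)
    have "gap H1 v \<in> I2" using b I1(2) v le by blast
    moreover have "gap H2 v - gap H1 v \<in> I2"
      using I2(2) H2 H v' by (intro gap_diff[OF I2(1)]) auto
    ultimately have g: "gap H2 v \<in> I2" using idl_add[OF I2(1)] by fastforce
    have "out_off H2 v \<noteq> {}"
    proof
      assume "out_off H2 v = {}"
      then have "vt v \<in> I2" using g by (simp add: gap_def)
      then show False using I2(2) v v' by blast
    qed
    moreover have "finite (out_off H2 v)"
      using H by (intro finite_subset[OF _ v'(3)]) (auto simp: out_off_def)
    ultimately have "v \<in> breaking_vertices E H2" using v v' by (simp add: breaking_out_off)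
    then show ?thesis using g I2(3) by blast
  qed
  then show ?thesis using H by auto
qed

lemma chain_idl_chain_pairs:
  assumes chain: "\<And>I J. idl I \<Longrightarrow> idl J \<Longrightarrow> I \<subseteq> J \<or> J \<subseteq> I"
    and p: "p \<in> admissible_pairs E" and q: "q \<in> admissible_pairs E"
  shows "pair_le p q \<or> pair_le q p"
proof -
  obtain H1 S1 H2 S2 where pq: "p = (H1, S1)" "q = (H2, S2)" by (cases p, cases q)
  have H: "hereditary E H1" "saturated E H1" "S1 \<subseteq> breaking_vertices E H1"
    "hereditary E H2" "saturated E H2" "S2 \<subseteq> breaking_vertices E H2"
    using p q pq by (auto simp: admissible_pairs_def)
  obtain I1 where I1: "idl I1" "\<And>v. v \<in> verts E \<Longrightarrow> vt v \<in> I1 \<longleftrightarrow> v \<in> H1"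
    "\<And>v. v \<in> breaking_vertices E H1 \<Longrightarrow> gap H1 v \<in> I1 \<longleftrightarrow> v \<in> S1"
    using ex_idl_pair[OF H(1-3)] by metis
  obtain I2 where I2: "idl I2" "\<And>v. v \<in> verts E \<Longrightarrow> vt v \<in> I2 \<longleftrightarrow> v \<in> H2"
    "\<And>v. v \<in> breaking_vertices E H2 \<Longrightarrow> gap H2 v \<in> I2 \<longleftrightarrow> v \<in> S2"
    using ex_idl_pair[OF H(4-6)] by metis
  have "H1 \<subseteq> verts E" "H2 \<subseteq> verts E" using H by (auto simp: hereditary_def)
  then show ?thesis
    using chain[OF I1(1) I2(1)] subset_pair_le[of H1 S1 I1 I2 H2 S2] subset_pair_le[of H2 S2 I2 I1 H1 S1]
      p q I1 I2 unfolding pq by blast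
qed

end

section \<open>Homogeneous components and graded ideals\<close>

definition hcomp :: "int \<Rightarrow> (('v, 'e) lpa_gen word \<Rightarrow>\<^sub>0 'k::field) \<Rightarrow> (('v, 'e) lpa_gen word \<Rightarrow>\<^sub>0 'k)" where
  "hcomp n f = (\<Sum>w\<in>{w\<in>Poly_Mapping.keys f. word_degree w = n}.
     Poly_Mapping.single w (Poly_Mapping.lookup f w))"

lemma lookup_hcomp:
  "Poly_Mapping.lookup (hcomp n f) w = (if word_degree w = n then Poly_Mapping.lookup f w else 0)"
proof -
  have "Poly_Mapping.lookup (hcomp n f) w =
      (\<Sum>u\<in>{w\<in>Poly_Mapping.keys f. word_degree w = n}. if u = w then Poly_Mapping.lookup f w else 0)"
    by (simp add: hcomp_def lookup_sum lookup_single when_def)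
  also have "\<dots> = (if word_degree w = n then Poly_Mapping.lookup f w else 0)"
    by (simp add: sum.delta in_keys_iff)
  finally show ?thesis .
qed

lemma hcomp_add: "hcomp n (f + g) = hcomp n f + hcomp n g"
  by (rule poly_mapping_eqI) (simp add: lookup_hcomp lookup_add)

lemma hcomp_uminus: "hcomp n (- f) = - hcomp n f"
  by (rule poly_mapping_eqI) (simp add: lookup_hcomp)

lemma hcomp_diff: "hcomp n (f - g) = hcomp n f - hcomp n g"
  by (rule poly_mapping_eqI) (simp add: lookup_hcomp lookup_minus)

lemma hcomp_0: "hcomp n 0 = 0"
  by (rule poly_mapping_eqI) (simp add: lookup_hcomp)

lemma hcomp_sum: "hcomp n (sum f A) = (\<Sum>i\<in>A. hcomp n (f i))"
  by (induction A rule: infinite_finite_induct) (simp_all add: hcomp_add hcomp_0)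

lemma hcomp_single: "hcomp n (Poly_Mapping.single w c) = (if word_degree w = n then Poly_Mapping.single w c else 0)"
  by (rule poly_mapping_eqI) (auto simp: lookup_hcomp lookup_single when_def)

lemma word_degree_plus: "word_degree (u + w) = word_degree u + word_degree w"
  by (simp add: word_degree_def)

lemma hcomp_single_mult:
  "hcomp n (Poly_Mapping.single u c * f) = Poly_Mapping.single u c * hcomp (n - word_degree u) f"
  by (subst (1 2) poly_mapping_eq_sum_single[of f])
     (auto simp: sum_distrib_left hcomp_sum mult_single hcomp_single word_degree_plus intro!: sum.cong)

lemma hcomp_mult_single:
  "hcomp n (f * Poly_Mapping.single u c) = hcomp (n - word_degree u) f * Poly_Mapping.single u c"
  by (subst (1 2) poly_mapping_eq_sum_single[of f])
     (auto simp: sum_distrib_right hcomp_sum mult_single hcomp_single word_degree_plus intro!: sum.cong)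

lemma hcomp_gen_mult: "hcomp n (gen x * f) = gen x * hcomp (n - lpa_gen_degree x) f"
  by (simp add: gen_def hcomp_single_mult word_degree_def)

lemma hcomp_mult_gen: "hcomp n (f * gen x) = hcomp (n - lpa_gen_degree x) f * gen x"
  by (simp add: gen_def hcomp_mult_single word_degree_def)

lemma hcomp_scal: "hcomp n (scal c * f) = scal c * hcomp n f"
  by (simp add: scal_def hcomp_single_mult word_degree_def)

lemma hcomp_gen: "hcomp n (gen x) = (if lpa_gen_degree x = n then gen x else 0)"
  by (simp add: gen_def hcomp_single word_degree_def)

lemma sum_hcomp: "(\<Sum>n\<in>word_degree ` Poly_Mapping.keys f. hcomp n f) = f"
proof (rule poly_mapping_eqI)
  fix w
  show "Poly_Mapping.lookup (\<Sum>n\<in>word_degree ` Poly_Mapping.keys f. hcomp n f) w = Poly_Mapping.lookup f w"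
    by (auto simp: lookup_sum lookup_hcomp in_keys_iff)
qed

context lpa
begin

text \<open>A scalar is moved onto a local unit of \<open>x\<close>, so ring ideals are subspaces
  automatically.\<close>

lemma idl_scal:
  assumes I: "idl I" and x: "x \<in> I"
  shows "scal c * x \<in> I"
proof -
  have "x \<in> alg" using idl_alg[OF I] x by blast
  obtain W where W: "W \<subseteq> verts E" "x * (\<Sum>w\<in>W. vt w) \<approx> x"
    using right_unit[OF \<open>x \<in> alg\<close>] by blast
  have "x * (scal c * (\<Sum>w\<in>W. vt w)) \<in> I"
    using W by (intro idl_rmult[OF I x] alg_closed alg_sum) auto
  also have "x * (scal c * (\<Sum>w\<in>W. vt w)) = scal c * (x * (\<Sum>w\<in>W. vt w))"
    by (rule scal_mult_left_commute)
  finally show ?thesis using idl_eqv[OF I eqv_scal[OF W(2)]] by simp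
qed

text \<open>Components are those of representatives in the free algebra; by \<open>hcomp_rel\<close>
  they are well defined modulo the relations.\<close>

definition graded_part :: "(('v, 'e) lpa_gen word \<Rightarrow>\<^sub>0 'k) set \<Rightarrow> (('v, 'e) lpa_gen word \<Rightarrow>\<^sub>0 'k) set" where
  "graded_part I = {f \<in> I. \<forall>n. hcomp n f \<in> I}"

text \<open>Multiplication by a generator merely shifts degrees, and induction on \<open>z\<close>
  reduces to that case.\<close>

lemma graded_part_lmult:
  assumes I: "idl I" and z: "z \<in> alg"
  shows "f \<in> graded_part I \<Longrightarrow> z * f \<in> graded_part I"
  using z
proof (induction arbitrary: f rule: free_algebra_induct)
  case zero
  then show ?case using idl_0[OF I] by (simp add: graded_part_def hcomp_0)
next
  case (add g h)
  then show ?case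
    by (auto simp: graded_part_def distrib_right hcomp_add intro: idl_add[OF I])
next
  case (scal c g)
  then show ?case
    by (auto simp: graded_part_def mult.assoc hcomp_scal intro: idl_scal[OF I])
next
  case (gen x)
  then show ?case
    by (auto simp: graded_part_def hcomp_gen_mult intro!: idl_lmult[OF I] free_algebra_gen)
next
  case (mult x g)
  then show ?case
    by (auto simp: graded_part_def mult.assoc hcomp_gen_mult intro!: idl_lmult[OF I] free_algebra_gen)
qed

lemma graded_part_rmult:
  assumes I: "idl I" and z: "z \<in> alg"
  shows "f \<in> graded_part I \<Longrightarrow> f * z \<in> graded_part I"
  using z
proof (induction arbitrary: f rule: free_algebra_induct)
  case zero
  then show ?case using idl_0[OF I] by (simp add: graded_part_def hcomp_0)
next
  case (add g h)
  then show ?case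
    by (auto simp: graded_part_def distrib_left hcomp_add intro: idl_add[OF I])
next
  case (scal c g)
  then show ?case
    by (auto simp: graded_part_def scal_mult_left_commute[of f] hcomp_scal intro: idl_scal[OF I])
next
  case (gen x)
  then show ?case
    by (auto simp: graded_part_def hcomp_mult_gen intro!: idl_rmult[OF I] free_algebra_gen)
next
  case (mult x g)
  have "f * gen x \<in> graded_part I"
    using mult by (auto simp: graded_part_def hcomp_mult_gen intro!: idl_rmult[OF I] free_algebra_gen)
  then have "f * gen x * g \<in> graded_part I" by (rule mult.IH)
  then show ?case by (simp add: mult.assoc)
qed

lemma idl_rel_self: "idl rel"
  using algebra_ideal_rel by (simp add: idl_def algebra_ideal_def)

lemma relations_homogeneous:
  assumes "r \<in> lpa_relations E"
  shows "hcomp n r \<in> rel"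
proof -
  have "hcomp n r = r \<or> hcomp n r = 0"
    using assms
  proof cases
    case (CK2 v)
    show ?thesis
      by (auto simp: CK2 hcomp_diff hcomp_sum hcomp_gen_mult hcomp_gen)
  qed (auto simp: hcomp_diff hcomp_gen_mult hcomp_gen)
  then show ?thesis using relation_in_rel[OF assms] by auto
qed

lemma algebra_ideal_graded_part:
  assumes I: "idl I"
  shows "algebra_ideal (graded_part I) (free_algebra (lpa_gens E))"
proof -
  have "scal c * x \<in> graded_part I" if "x \<in> graded_part I" for c x
    using that by (auto simp: graded_part_def hcomp_scal intro: idl_scal[OF I])
  moreover have "x + y \<in> graded_part I" if "x \<in> graded_part I" "y \<in> graded_part I" for x y
    using that by (auto simp: graded_part_def hcomp_add intro: idl_add[OF I])
  moreover have "- x \<in> graded_part I" if "x \<in> graded_part I" for x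
    using that by (auto simp: graded_part_def hcomp_uminus intro: idl_uminus[OF I])
  moreover have "0 \<in> graded_part I" using idl_0[OF I] by (simp add: graded_part_def hcomp_0)
  moreover have "graded_part I \<subseteq> alg" using idl_alg[OF I] by (auto simp: graded_part_def)
  ultimately show ?thesis
    unfolding algebra_ideal_def two_sided_ideal_free_algebra_iff smult_free_algebra
    using graded_part_lmult[OF I] graded_part_rmult[OF I] by simp
qed

text \<open>The graded part of \<open>rel\<close> is an algebra ideal that contains the homogeneous
  relations, so minimality of the hull applies.\<close>

lemma hcomp_rel:
  assumes "f \<in> rel"
  shows "hcomp n f \<in> rel"
proof -
  have "lpa_relations E \<subseteq> graded_part rel"
    using relation_in_rel relations_homogeneous by (auto simp: graded_part_def)
  then have "rel \<subseteq> graded_part rel"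
    using algebra_ideal_graded_part[OF idl_rel_self] unfolding lpa_ideal_def by (intro hull_minimal)
  with assms show ?thesis by (auto simp: graded_part_def)
qed

lemma idl_graded_part:
  assumes I: "idl I"
  shows "idl (graded_part I)"
proof -
  have "rel \<subseteq> graded_part I"
    using hcomp_rel idl_rel[OF I] by (auto simp: graded_part_def)
  then show ?thesis using algebra_ideal_graded_part[OF I] by (simp add: idl_def algebra_ideal_def)
qed

text \<open>Vertices and the elements \<open>v\<^sup>H\<close> have degree 0, so those in
  \<open>I\<close> lie in the graded part; the pair of \<open>I\<close> then leaves nothing by which
  \<open>I\<close> could exceed it.\<close>

lemma condition_K_graded:
  assumes K: "condition_K E" and I: "idl I"
  shows "graded_part I = I"
proof (rule ccontr)
  assume "graded_part I \<noteq> I"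
  then have not: "\<not> I \<subseteq> graded_part I" by (auto simp: graded_part_def)
  have HI: "vt v \<in> graded_part I" if "v \<in> vset I" for v
    using that idl_0[OF I] by (auto simp: vset_def graded_part_def hcomp_gen)
  have SI: "gap (vset I) v \<in> graded_part I" if "v \<in> gapset I" for v
  proof -
    have "hcomp n (gap (vset I) v) \<in> {gap (vset I) v, 0}" for n
      by (auto simp: gap_def hcomp_diff hcomp_sum hcomp_gen_mult hcomp_gen)
    moreover have g: "gap (vset I) v \<in> I" using that by (simp add: gapset_def)
    ultimately have "hcomp n (gap (vset I) v) \<in> I" for n using idl_0[OF I] by (metis empty_iff insert_iff)
    with g show ?thesis by (simp add: graded_part_def)
  qed
  show False
    using reduction[OF hereditary_vset[OF I] condition_K_has_exits[OF K hereditary_vset[OF I]]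
        idl_graded_part[OF I] I _ not HI SI] by (auto simp: vset_def gapset_def graded_part_def)
qed

lemma hcomp_pth_mult: "hcomp n (pth u p * f) = pth u p * hcomp (n - int (length p)) f"
  by (induction p arbitrary: u n) (simp_all add: mult.assoc hcomp_gen_mult algebra_simps)

lemma hcomp_pth: "hcomp n (pth u p) = (if n = int (length p) then pth u p else 0)"
  by (induction p arbitrary: u n) (auto simp: hcomp_gen_mult hcomp_gen)

end

section \<open>The ideals of the Leavitt path algebra\<close>

context lpa
begin

abbreviation lpalg :: "('k, (('v, 'e) lpa_gen word \<Rightarrow>\<^sub>0 'k) set) module" where
  "lpalg \<equiv> leavitt_path_algebra K E"

definition cls :: "(('v, 'e) lpa_gen word \<Rightarrow>\<^sub>0 'k) \<Rightarrow> (('v, 'e) lpa_gen word \<Rightarrow>\<^sub>0 'k) set" where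
  "cls x = rel +>\<^bsub>free_algebra (lpa_gens E)\<^esub> x"

lemma in_cls_iff: "y \<in> cls x \<longleftrightarrow> y \<approx> x"
proof -
  have "y \<in> cls x \<longleftrightarrow> (\<exists>r\<in>rel. y = r + x)"
    by (auto simp: cls_def a_r_coset_def' free_algebra_ops)
  also have "\<dots> \<longleftrightarrow> y \<approx> x"
    by (auto simp: eqv_def intro: bexI[of _ "y - x"])
  finally show ?thesis .
qed

lemma cls_eq_iff: "cls x = cls y \<longleftrightarrow> x \<approx> y"
proof
  assume "cls x = cls y"
  then show "x \<approx> y" using in_cls_iff[of x x] in_cls_iff[of x y] by simp
next
  assume xy: "x \<approx> y"
  have "z \<approx> x \<longleftrightarrow> z \<approx> y" for z
    using eqv_trans[of z x y] eqv_trans[of z y x] eqv_sym[OF xy] xy by blast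
  then show "cls x = cls y"
    by (simp add: in_cls_iff set_eq_iff)
qed

lemma carrier_lpalg: "carrier lpalg = cls ` alg"
  by (auto simp: leavitt_path_algebra_def quotient_algebra_def A_RCOSETS_def' cls_def)

lemma zero_lpalg: "\<zero>\<^bsub>lpalg\<^esub> = cls 0"
  by (auto simp: leavitt_path_algebra_def quotient_algebra_def in_cls_iff eqv_def)

lemma add_lpalg: "cls x \<oplus>\<^bsub>lpalg\<^esub> cls y = cls (x + y)"
proof -
  have "cls x \<oplus>\<^bsub>lpalg\<^esub> cls y = (\<Union>a\<in>cls x. \<Union>b\<in>cls y. {a + b})"
    by (simp add: leavitt_path_algebra_def quotient_algebra_def set_add_def' free_algebra_ops)
  also have "\<dots> = cls (x + y)"
  proof (intro Set.set_eqI iffI)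
    fix z assume "z \<in> (\<Union>a\<in>cls x. \<Union>b\<in>cls y. {a + b})"
    then show "z \<in> cls (x + y)" by (auto simp: in_cls_iff intro: eqv_add)
  next
    fix z assume "z \<in> cls (x + y)"
    then have "z - y \<in> cls x" by (simp add: in_cls_iff eqv_def algebra_simps)
    moreover have "y \<in> cls y" by (simp add: in_cls_iff)
    moreover have "z \<in> {(z - y) + y}" by simp
    ultimately show "z \<in> (\<Union>a\<in>cls x. \<Union>b\<in>cls y. {a + b})" by blast
  qed
  finally show ?thesis .
qed

lemma mult_lpalg:
  assumes "x \<in> alg" "y \<in> alg"
  shows "cls x \<otimes>\<^bsub>lpalg\<^esub> cls y = cls (x * y)"
proof -
  have "cls x \<otimes>\<^bsub>lpalg\<^esub> cls y = (\<Union>a\<in>cls x. \<Union>b\<in>cls y. cls (a * b))"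
    by (simp add: leavitt_path_algebra_def quotient_algebra_def rcoset_mult_def free_algebra_ops cls_def)
  also have "\<dots> = cls (x * y)"
  proof -
    have "cls (a * b) = cls (x * y)" if "a \<in> cls x" "b \<in> cls y" for a b
    proof -
      have ab: "a \<approx> x" "b \<approx> y" using that by (simp_all add: in_cls_iff)
      then have "a * b \<approx> x * b"
        using assms eqv_alg by (intro eqv_rmult) auto
      also have "\<dots> \<approx> x * y"
        using assms ab by (intro eqv_lmult)
      finally show ?thesis by (simp add: cls_eq_iff)
    qed
    moreover have "x \<in> cls x" "y \<in> cls y" by (simp_all add: in_cls_iff)
    ultimately show ?thesis by blast
  qed
  finally show ?thesis .
qed

lemma abelian_group_lpalg: "abelian_group lpalg"
proof (rule abelian_groupI)
  fix x assume "x \<in> carrier lpalg"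
  then obtain a where a: "x = cls a" "a \<in> alg" by (auto simp: carrier_lpalg)
  then show "\<exists>y\<in>carrier lpalg. y \<oplus>\<^bsub>lpalg\<^esub> x = \<zero>\<^bsub>lpalg\<^esub>"
    by (intro bexI[of _ "cls (- a)"]) (auto simp: add_lpalg zero_lpalg carrier_lpalg)
qed (auto simp: carrier_lpalg add_lpalg zero_lpalg algebra_simps)

lemma a_inv_lpalg:
  assumes "x \<in> alg"
  shows "\<ominus>\<^bsub>lpalg\<^esub> cls x = cls (- x)"
  by (rule abelian_group.minus_equality[OF abelian_group_lpalg])
     (use assms in \<open>auto simp: add_lpalg zero_lpalg carrier_lpalg\<close>)

lemma cls_in_image_iff:
  assumes "idl I"
  shows "cls x \<in> cls ` I \<longleftrightarrow> x \<in> I"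
  using idl_eqv[OF assms] by (auto simp: cls_eq_iff)

lemma two_sided_ideal_image:
  assumes I: "idl I"
  shows "two_sided_ideal (cls ` I) lpalg"
  unfolding two_sided_ideal_def additive_subgroup_iff[OF abelian_group_lpalg]
proof (intro conjI ballI)
  show "cls ` I \<subseteq> carrier lpalg" using idl_alg[OF I] by (auto simp: carrier_lpalg)
  show "\<zero>\<^bsub>lpalg\<^esub> \<in> cls ` I" using idl_0[OF I] by (simp add: zero_lpalg)
  show "x \<oplus>\<^bsub>lpalg\<^esub> y \<in> cls ` I" if "x \<in> cls ` I" "y \<in> cls ` I" for x y
    using that idl_add[OF I] by (auto simp: add_lpalg)
  show "\<ominus>\<^bsub>lpalg\<^esub> x \<in> cls ` I" if "x \<in> cls ` I" for x
    using that idl_uminus[OF I] idl_alg[OF I] by (auto simp: a_inv_lpalg)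
  show "x \<otimes>\<^bsub>lpalg\<^esub> a \<in> cls ` I" "a \<otimes>\<^bsub>lpalg\<^esub> x \<in> cls ` I" if ax: "a \<in> cls ` I" "x \<in> carrier lpalg" for a x
  proof -
    obtain b y where b: "a = cls b" "b \<in> I" "x = cls y" "y \<in> alg"
      using ax by (auto simp: carrier_lpalg)
    moreover have "b \<in> alg" using b idl_alg[OF I] by blast
    ultimately show "x \<otimes>\<^bsub>lpalg\<^esub> a \<in> cls ` I" "a \<otimes>\<^bsub>lpalg\<^esub> x \<in> cls ` I"
      using idl_lmult[OF I b(2,4)] idl_rmult[OF I b(2,4)] by (simp_all add: mult_lpalg)
  qed
qed

lemma ideal_image_cases:
  assumes "two_sided_ideal J lpalg"
  obtains I where "idl I" "J = cls ` I"
proof -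
  have J: "J \<subseteq> carrier lpalg" "\<zero>\<^bsub>lpalg\<^esub> \<in> J" "\<And>x y. x \<in> J \<Longrightarrow> y \<in> J \<Longrightarrow> x \<oplus>\<^bsub>lpalg\<^esub> y \<in> J"
    "\<And>x. x \<in> J \<Longrightarrow> \<ominus>\<^bsub>lpalg\<^esub> x \<in> J"
    "\<And>a x. a \<in> J \<Longrightarrow> x \<in> carrier lpalg \<Longrightarrow> x \<otimes>\<^bsub>lpalg\<^esub> a \<in> J"
    "\<And>a x. a \<in> J \<Longrightarrow> x \<in> carrier lpalg \<Longrightarrow> a \<otimes>\<^bsub>lpalg\<^esub> x \<in> J"
    using assms unfolding two_sided_ideal_def additive_subgroup_iff[OF abelian_group_lpalg]
    by simp_all
  define I where "I = {x \<in> alg. cls x \<in> J}"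
  have "idl I"
  proof (rule idlI)
    show "rel \<subseteq> I"
    proof
      fix r assume r: "r \<in> rel"
      then have "cls r = \<zero>\<^bsub>lpalg\<^esub>" by (simp add: zero_lpalg cls_eq_iff eqv_def)
      then show "r \<in> I" using J(2) r rel_subset_alg by (auto simp: I_def)
    qed
    show "I \<subseteq> alg" by (auto simp: I_def)
    show "x + y \<in> I" if "x \<in> I" "y \<in> I" for x y
      using that J(3)[of "cls x" "cls y"] by (simp add: I_def add_lpalg)
    show "- x \<in> I" if "x \<in> I" for x
      using that J(4)[of "cls x"] by (simp add: I_def a_inv_lpalg)
    show "z * x \<in> I" "x * z \<in> I" if "x \<in> I" "z \<in> alg" for x z
      using that J(5,6)[of "cls x" "cls z"] by (simp_all add: I_def mult_lpalg carrier_lpalg)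
  qed
  moreover have "J = cls ` I" using J(1) by (auto simp: I_def carrier_lpalg)
  ultimately show ?thesis by (rule that)
qed

lemma image_subset_image_iff:
  assumes "idl I" "idl J"
  shows "cls ` I \<subseteq> cls ` J \<longleftrightarrow> I \<subseteq> J"
proof
  assume *: "cls ` I \<subseteq> cls ` J"
  show "I \<subseteq> J"
  proof
    fix x assume "x \<in> I"
    then have "cls x \<in> cls ` J" using * by blast
    then show "x \<in> J" using cls_in_image_iff[OF assms(2)] by simp
  qed
qed blast

lemma idl_alg_self: "idl alg"
  by (rule idlI) (use rel_subset_alg in auto)

lemma proper_image_iff:
  assumes I: "idl I"
  shows "proper_ideal (cls ` I) lpalg \<longleftrightarrow> I \<noteq> alg"
  using two_sided_ideal_image[OF I] image_subset_image_iff[OF I idl_alg_self]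
    image_subset_image_iff[OF idl_alg_self I]
  unfolding proper_ideal_def carrier_lpalg by (metis subset_antisym order_refl)

lemma ideal_prod_subset_iff:
  assumes P: "idl P" and A: "idl A" and B: "idl B"
  shows "ideal_prod lpalg (cls ` A) (cls ` B) \<subseteq> cls ` P \<longleftrightarrow> (\<forall>a\<in>A. \<forall>b\<in>B. a * b \<in> P)"
proof
  assume *: "ideal_prod lpalg (cls ` A) (cls ` B) \<subseteq> cls ` P"
  show "\<forall>a\<in>A. \<forall>b\<in>B. a * b \<in> P"
  proof (intro ballI)
    fix a b assume ab: "a \<in> A" "b \<in> B"
    then have "cls a \<otimes>\<^bsub>lpalg\<^esub> cls b \<in> cls ` P"
      using * ideal_prod.prod[of "cls a" "cls ` A" "cls b" "cls ` B" lpalg] by blast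
    moreover have "a \<in> alg" "b \<in> alg" using ab idl_alg[OF A] idl_alg[OF B] by auto
    ultimately show "a * b \<in> P" using cls_in_image_iff[OF P] by (simp add: mult_lpalg)
  qed
next
  assume *: "\<forall>a\<in>A. \<forall>b\<in>B. a * b \<in> P"
  show "ideal_prod lpalg (cls ` A) (cls ` B) \<subseteq> cls ` P"
  proof
    fix x assume "x \<in> ideal_prod lpalg (cls ` A) (cls ` B)"
    then show "x \<in> cls ` P"
    proof induction
      case (prod i j)
      then obtain a b where ab: "i = cls a" "a \<in> A" "j = cls b" "b \<in> B" by blast
      moreover have "a \<in> alg" "b \<in> alg" using ab idl_alg[OF A] idl_alg[OF B] by auto
      ultimately show ?case using * by (auto simp: mult_lpalg)
    next
      case (sum x y)
      then obtain a b where "x = cls a" "a \<in> P" "y = cls b" "b \<in> P" by blast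
      then show ?case using idl_add[OF P] by (auto simp: add_lpalg)
    qed
  qed
qed

lemma prime_image_iff:
  assumes P: "idl P"
  shows "prime_ideal (cls ` P) lpalg \<longleftrightarrow> P \<noteq> alg \<and>
    (\<forall>A B. idl A \<and> idl B \<and> (\<forall>a\<in>A. \<forall>b\<in>B. a * b \<in> P) \<longrightarrow> A \<subseteq> P \<or> B \<subseteq> P)" (is "_ \<longleftrightarrow> _ \<and> ?R")
proof -
  have "(\<forall>A B. two_sided_ideal A lpalg \<and> two_sided_ideal B lpalg \<and> ideal_prod lpalg A B \<subseteq> cls ` P \<longrightarrow>
      A \<subseteq> cls ` P \<or> B \<subseteq> cls ` P) \<longleftrightarrow> ?R" (is "?L \<longleftrightarrow> ?R")
  proof
    assume L: ?L
    show ?R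
    proof (intro allI impI, elim conjE)
      fix A B assume A: "idl A" and B: "idl B" and "\<forall>a\<in>A. \<forall>b\<in>B. a * b \<in> P"
      then have "cls ` A \<subseteq> cls ` P \<or> cls ` B \<subseteq> cls ` P"
        using L two_sided_ideal_image ideal_prod_subset_iff[OF P A B] by blast
      then show "A \<subseteq> P \<or> B \<subseteq> P"
        using image_subset_image_iff[OF A P] image_subset_image_iff[OF B P] by blast
    qed
  next
    assume R: ?R
    show ?L
    proof (intro allI impI, elim conjE)
      fix A' B' assume AB: "two_sided_ideal A' lpalg" "two_sided_ideal B' lpalg" "ideal_prod lpalg A' B' \<subseteq> cls ` P"
      obtain A where A: "idl A" "A' = cls ` A" using AB(1) by (rule ideal_image_cases)
      obtain B where B: "idl B" "B' = cls ` B" using AB(2) by (rule ideal_image_cases)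
      have "\<forall>a\<in>A. \<forall>b\<in>B. a * b \<in> P"
        using AB(3) unfolding A(2) B(2) ideal_prod_subset_iff[OF P A(1) B(1)] .
      then have "A \<subseteq> P \<or> B \<subseteq> P" using R[rule_format, of A B] A(1) B(1) by simp
      then show "A' \<subseteq> cls ` P \<or> B' \<subseteq> cls ` P" using A B by blast
    qed
  qed
  then show ?thesis
    unfolding prime_ideal_def proper_image_iff[OF P] by simp
qed

lemma all_proper_ideals_iff:
  "(\<forall>I. proper_ideal I lpalg \<longrightarrow> Q I) \<longleftrightarrow> (\<forall>I. idl I \<and> I \<noteq> alg \<longrightarrow> Q (cls ` I))"
proof
  assume "\<forall>I. proper_ideal I lpalg \<longrightarrow> Q I"
  then show "\<forall>I. idl I \<and> I \<noteq> alg \<longrightarrow> Q (cls ` I)" using proper_image_iff by blast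
next
  assume *: "\<forall>I. idl I \<and> I \<noteq> alg \<longrightarrow> Q (cls ` I)"
  show "\<forall>I. proper_ideal I lpalg \<longrightarrow> Q I"
  proof (intro allI impI)
    fix J assume J: "proper_ideal J lpalg"
    then obtain I where "idl I" "J = cls ` I"
      unfolding proper_ideal_def by (elim conjE ideal_image_cases)
    then show "Q J" using * J proper_image_iff by blast
  qed
qed

lemma chain_iff:
  "chain\<^sub>\<subseteq> {I. proper_ideal I lpalg} \<longleftrightarrow> (\<forall>I J. idl I \<and> idl J \<longrightarrow> I \<subseteq> J \<or> J \<subseteq> I)"
proof -
  have "chain\<^sub>\<subseteq> {I. proper_ideal I lpalg} \<longleftrightarrow>
      (\<forall>I. proper_ideal I lpalg \<longrightarrow> (\<forall>J. proper_ideal J lpalg \<longrightarrow> I \<subseteq> J \<or> J \<subseteq> I))"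
    by (auto simp: chain_subset_def)
  also have "\<dots> \<longleftrightarrow> (\<forall>I. idl I \<and> I \<noteq> alg \<longrightarrow>
      (\<forall>J. idl J \<and> J \<noteq> alg \<longrightarrow> cls ` I \<subseteq> cls ` J \<or> cls ` J \<subseteq> cls ` I))"
    unfolding all_proper_ideals_iff ..
  also have "\<dots> \<longleftrightarrow> (\<forall>I. idl I \<and> I \<noteq> alg \<longrightarrow> (\<forall>J. idl J \<and> J \<noteq> alg \<longrightarrow> I \<subseteq> J \<or> J \<subseteq> I))"
    using image_subset_image_iff by metis
  also have "\<dots> \<longleftrightarrow> (\<forall>I J. idl I \<and> idl J \<longrightarrow> I \<subseteq> J \<or> J \<subseteq> I)"
    using idl_alg by blast
  finally show ?thesis .
qed

lemma hcomp_homogeneous: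
  assumes "\<forall>w\<in>Poly_Mapping.keys f. word_degree w = m"
  shows "hcomp n f = (if m = n then f else 0)"
  by (rule poly_mapping_eqI) (use assms in \<open>auto simp: lookup_hcomp in_keys_iff\<close>)

lemma lpa_component_altdef:
  "lpa_component K E n = cls ` {f \<in> alg. \<forall>w\<in>Poly_Mapping.keys f. word_degree w = n}"
  by (simp add: lpa_component_def cls_def)

lemma finsum_lpalg:
  assumes "finite N" "\<And>n. n \<in> N \<Longrightarrow> f n \<in> alg" "\<And>n. n \<in> N \<Longrightarrow> x n = cls (f n)"
  shows "finsum lpalg x N = cls (\<Sum>n\<in>N. f n)"
  using assms
proof (induction N)
  case empty
  then show ?case
    using abelian_monoid.finsum_empty[OF abelian_group.axioms(1)[OF abelian_group_lpalg]]
    by (simp add: zero_lpalg)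
next
  case (insert n N)
  then have "finsum lpalg x (insert n N) = x n \<oplus>\<^bsub>lpalg\<^esub> finsum lpalg x N"
    by (intro abelian_monoid.finsum_insert[OF abelian_group.axioms(1)[OF abelian_group_lpalg]])
       (auto simp: carrier_lpalg)
  then show ?case using insert by (simp add: add_lpalg)
qed

text \<open>Directness is automatic because \<open>rel\<close> is homogeneous; only the requirement
  that components stay in \<open>I\<close> has content.\<close>

lemma graded_ideal_image_iff:
  assumes I: "idl I"
  shows "graded_ideal K E (cls ` I) \<longleftrightarrow> graded_part I = I"
proof -
  let ?C = "\<lambda>n. cls ` I \<inter> lpa_component K E n"
  \<comment> \<open>Homogeneous representatives of elements of the image of \<open>I\<close> lie in
    \<open>I\<close>, as \<open>I\<close> is a union of classes.\<close>
  have repr: "\<exists>f. (\<forall>n\<in>N. f n \<in> I \<and> x n = cls (f n) \<and> (\<forall>w\<in>Poly_Mapping.keys (f n). word_degree w = n))"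
    if x: "x \<in> (\<Pi> n\<in>N. ?C n)" for x N
  proof -
    have "\<exists>f. f \<in> I \<and> x n = cls f \<and> (\<forall>w\<in>Poly_Mapping.keys f. word_degree w = n)" if n: "n \<in> N" for n
    proof -
      have xn: "x n \<in> cls ` I" "x n \<in> lpa_component K E n" using x n by (auto simp: Pi_iff)
      then obtain f where f: "x n = cls f" "\<forall>w\<in>Poly_Mapping.keys f. word_degree w = n"
        unfolding lpa_component_altdef by blast
      then show ?thesis using xn(1) cls_in_image_iff[OF I] by auto
    qed
    then show ?thesis by metis
  qed
  have hsum: "hcomp m (\<Sum>n\<in>N. f n) = (if m \<in> N then f m else 0)"
    if "finite N" "\<forall>n\<in>N. \<forall>w\<in>Poly_Mapping.keys (f n). word_degree w = n"
    for m N and f :: "int \<Rightarrow> ('v, 'e) lpa_gen word \<Rightarrow>\<^sub>0 'k"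
  proof -
    have "hcomp m (\<Sum>n\<in>N. f n) = (\<Sum>n\<in>N. if n = m then f n else 0)"
      unfolding hcomp_sum using that by (intro sum.cong refl hcomp_homogeneous) auto
    then show ?thesis using that(1) by (simp add: sum.delta)
  qed
  have independent: "\<forall>n\<in>N. x n = \<zero>\<^bsub>lpalg\<^esub>"
    if N: "finite N" "x \<in> (\<Pi> n\<in>N. ?C n)" "finsum lpalg x N = \<zero>\<^bsub>lpalg\<^esub>" for x N
  proof -
    obtain f where f: "\<forall>n\<in>N. f n \<in> I \<and> x n = cls (f n) \<and> (\<forall>w\<in>Poly_Mapping.keys (f n). word_degree w = n)"
      using repr[OF N(2)] by blast
    then have "finsum lpalg x N = cls (\<Sum>n\<in>N. f n)"
      using N(1) idl_alg[OF I] by (intro finsum_lpalg) auto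
    then have "cls (\<Sum>n\<in>N. f n) = cls 0"
      using N(3) by (simp only: zero_lpalg)
    then have sum: "(\<Sum>n\<in>N. f n) \<in> rel"
      by (simp add: cls_eq_iff eqv_def)
    show ?thesis
    proof
      fix n assume n: "n \<in> N"
      have "f n \<in> rel" using hcomp_rel[OF sum, of n] hsum[OF N(1), of f n] f n by simp
      then show "x n = \<zero>\<^bsub>lpalg\<^esub>" using f n by (simp add: zero_lpalg cls_eq_iff eqv_def)
    qed
  qed
  have sums: "cls ` I = {finsum lpalg x N | x N. finite N \<and> x \<in> (\<Pi> n\<in>N. ?C n)} \<longleftrightarrow> graded_part I = I"
    (is "_ = ?S \<longleftrightarrow> _")
  proof
    assume S: "cls ` I = ?S"
    have "hcomp n g \<in> I" if "g \<in> I" for g n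
    proof -
      have "cls g \<in> ?S" using that S by blast
      then obtain x N where xN: "cls g = finsum lpalg x N" "finite N" "x \<in> (\<Pi> n\<in>N. ?C n)" by blast
      obtain f where f: "\<forall>n\<in>N. f n \<in> I \<and> x n = cls (f n) \<and> (\<forall>w\<in>Poly_Mapping.keys (f n). word_degree w = n)"
        using repr[OF xN(3)] by blast
      then have "finsum lpalg x N = cls (\<Sum>n\<in>N. f n)"
        using xN(2) idl_alg[OF I] by (intro finsum_lpalg) auto
      then have "g - (\<Sum>n\<in>N. f n) \<in> rel" using xN(1) by (simp add: cls_eq_iff eqv_def)
      then have "hcomp n g - hcomp n (\<Sum>n\<in>N. f n) \<in> rel" using hcomp_rel by (metis hcomp_diff)
      then have "hcomp n g \<approx> hcomp n (\<Sum>n\<in>N. f n)" by (simp add: eqv_def)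
      moreover have "hcomp n (\<Sum>n\<in>N. f n) \<in> I"
        using hsum[OF xN(2), of f n] f idl_0[OF I] by auto
      ultimately show ?thesis using idl_eqv[OF I] by simp
    qed
    then show "graded_part I = I" by (auto simp: graded_part_def)
  next
    assume g: "graded_part I = I"
    show "cls ` I = ?S"
    proof (intro subset_antisym subsetI)
      fix y assume "y \<in> cls ` I"
      then obtain f where f: "y = cls f" "f \<in> I" by blast
      let ?N = "word_degree ` Poly_Mapping.keys f"
      have comps: "hcomp n f \<in> I" for n using f g by (auto simp: graded_part_def)
      have "finsum lpalg (\<lambda>n. cls (hcomp n f)) ?N = cls (\<Sum>n\<in>?N. hcomp n f)"
        using comps idl_alg[OF I] by (intro finsum_lpalg) auto
      then have "y = finsum lpalg (\<lambda>n. cls (hcomp n f)) ?N" by (simp add: sum_hcomp f)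
      moreover have "(\<lambda>n. cls (hcomp n f)) \<in> (\<Pi> n\<in>?N. ?C n)"
        using comps idl_alg[OF I] unfolding lpa_component_altdef
        by (auto simp: in_keys_iff lookup_hcomp intro!: imageI split: if_splits)
      ultimately show "y \<in> ?S"
        by (intro CollectI exI[of _ "\<lambda>n. cls (hcomp n f)"] exI[of _ ?N]) simp
    next
      fix y assume "y \<in> ?S"
      then obtain x N where xN: "y = finsum lpalg x N" "finite N" "x \<in> (\<Pi> n\<in>N. ?C n)" by blast
      obtain f where f: "\<forall>n\<in>N. f n \<in> I \<and> x n = cls (f n) \<and> (\<forall>w\<in>Poly_Mapping.keys (f n). word_degree w = n)"
        using repr[OF xN(3)] by blast
      then have "finsum lpalg x N = cls (\<Sum>n\<in>N. f n)"
        using xN(2) idl_alg[OF I] by (intro finsum_lpalg) auto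
      moreover have "(\<Sum>n\<in>N. f n) \<in> I" using f by (intro idl_sum[OF I]) auto
      ultimately show "y \<in> cls ` I" using xN(1) by blast
    qed
  qed
  show ?thesis
    unfolding graded_ideal_def internal_direct_sum_def sums using independent by blast
qed

end

section \<open>Primeness, the graph conditions and gradedness compared\<close>

theorem proposition2p7:
  fixes E :: "('v, 'e) pre_digraph" and K :: "'k::field itself"
  assumes "wf_digraph E"
  defines "L \<equiv> leavitt_path_algebra K E"
  defines "condition_a \<equiv> \<forall>I. proper_ideal I L \<longrightarrow> prime_ideal I L"
  defines "condition_b \<equiv>
    condition_K E \<and>
    (\<forall>p \<in> admissible_pairs E. \<forall>q \<in> admissible_pairs E. pair_le p q \<or> pair_le q p) \<and>
    (\<forall>H. hereditary E H \<and> saturated E H \<longrightarrow>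
       finite (breaking_vertices E H) \<and> card (breaking_vertices E H) \<le> 1) \<and>
    (\<forall>(H, S) \<in> admissible_pairs E.
       downward_directed (quotient_graph E H S) (verts (quotient_graph E H S)))"
  defines "condition_c \<equiv>
    (\<forall>I. proper_ideal I L \<longrightarrow> graded_ideal K E I) \<and> chain\<^sub>\<subseteq> {I. proper_ideal I L}"
  shows "(condition_a \<longleftrightarrow> condition_b) \<and> (condition_b \<longleftrightarrow> condition_c)"
proof -
  interpret lpa E K using assms(1) by (simp add: lpa_def)
  have a_iff: "condition_a \<longleftrightarrow> (\<forall>P. idl P \<and> P \<noteq> alg \<longrightarrow>
      (\<forall>A B. idl A \<and> idl B \<and> (\<forall>a\<in>A. \<forall>b\<in>B. a * b \<in> P) \<longrightarrow> A \<subseteq> P \<or> B \<subseteq> P))"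
    unfolding condition_a_def L_def all_proper_ideals_iff
    by (intro iff_allI imp_cong refl) (simp add: prime_image_iff)
  have c_iff: "condition_c \<longleftrightarrow> (\<forall>I. idl I \<and> I \<noteq> alg \<longrightarrow> graded_part I = I) \<and>
      (\<forall>I J. idl I \<and> idl J \<longrightarrow> I \<subseteq> J \<or> J \<subseteq> I)"
    unfolding condition_c_def L_def all_proper_ideals_iff chain_iff
    by (intro arg_cong2[where f = "(\<and>)"] iff_allI imp_cong refl) (simp add: graded_ideal_image_iff)
  have b_iff: "condition_b \<longleftrightarrow> condition_K E \<and>
      (\<forall>p \<in> admissible_pairs E. \<forall>q \<in> admissible_pairs E. pair_le p q \<or> pair_le q p)" (is "_ \<longleftrightarrow> _ \<and> ?chain")
  proof -
    have "finite (breaking_vertices E H) \<and> card (breaking_vertices E H) \<le> 1"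
      if ?chain "hereditary E H" "saturated E H" for H
    proof -
      have "breaking_vertices E H = {} \<or> (\<exists>v. breaking_vertices E H = {v})"
        using chain_breaking_vertices[OF that] by blast
      then show ?thesis by auto
    qed
    then show ?thesis
      unfolding condition_b_def using chain_downward_directed by blast
  qed
  have "condition_a" if b: "condition_b"
    unfolding a_iff using b condition_b_prime unfolding condition_b_def by blast
  moreover have "condition_c" if b: "condition_b"
    unfolding c_iff using b condition_K_graded condition_b_chain unfolding b_iff by blast
  moreover have "condition_b" if a: "condition_a"
  proof -
    have prime: "A \<subseteq> P \<or> B \<subseteq> P"
      if "idl P" "P \<noteq> alg" "idl A" "idl B" "\<And>a b. a \<in> A \<Longrightarrow> b \<in> B \<Longrightarrow> a * b \<in> P" for P A B
      using a that unfolding a_iff by blast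
    have "I \<subseteq> J \<or> J \<subseteq> I" if I: "idl I" and J: "idl J" for I J
    \<comment> \<open>Primeness is available only for proper ideals; if the intersection is
      everything, so are \<open>I\<close> and \<open>J\<close>.\<close>
    proof (cases "I \<inter> J = alg")
      case True
      then show ?thesis using idl_alg[OF I] by blast
    next
      case False
      have "a * b \<in> I \<inter> J" if "a \<in> I" "b \<in> J" for a b
        using that idl_alg[OF I] idl_alg[OF J] by (blast intro: idl_lmult[OF J] idl_rmult[OF I])
      then have "I \<subseteq> I \<inter> J \<or> J \<subseteq> I \<inter> J"
        using prime[OF idl_Int[OF I J] False I J] by blast
      then show ?thesis by blast
    qed
    moreover have "condition_K E"
    proof (rule ccontr)
      assume "\<not> condition_K E"
      then obtain P A B v c where P: "idl P" "idl A" "idl B" "\<And>a b. a \<in> A \<Longrightarrow> b \<in> B \<Longrightarrow> b * a \<in> P"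
        "\<not> A \<subseteq> P" "\<not> B \<subseteq> P" "vt v \<notin> P" "awalk v c v"
        by (rule not_condition_K_idl) blast
      then have "vt v \<in> alg" by auto
      then have "P \<noteq> alg" using P by blast
      \<comment> \<open>The products known to lie in \<open>P\<close> are \<open>b * a\<close>, so
        \<open>B\<close> is taken as the first ideal.\<close>
      then show False using prime[OF P(1) _ P(3,2)] P by blast
    qed
    ultimately show ?thesis
      unfolding b_iff using chain_idl_chain_pairs by blast
  qed
  moreover have "condition_b" if c: "condition_c"
  proof -
    have "condition_K E"
    proof (rule ccontr)
      assume "\<not> condition_K E"
      then obtain P v c where P: "idl P" "c \<noteq> []" "awalk v c v"
        "vt v - pth v c * pth v c \<in> P" "vt v \<notin> P"
        by (rule not_condition_K_idl) blast
      then have "vt v \<in> alg" by auto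
      then have "graded_part P = P" using P c unfolding c_iff by blast
      \<comment> \<open>\<open>c\<close> has positive length, so the component of degree 0 is
        \<open>v\<close> itself.\<close>
      then have "hcomp 0 (vt v - pth v c * pth v c) \<in> P"
        using P(4) by (auto simp: graded_part_def)
      then show False using P(2,5) by (simp add: hcomp_diff hcomp_gen hcomp_pth_mult hcomp_pth)
    qed
    moreover have "I \<subseteq> J \<or> J \<subseteq> I" if "idl I" "idl J" for I J
      using c that unfolding c_iff by simp
    ultimately show ?thesis
      unfolding b_iff using chain_idl_chain_pairs by blast
  qed
  ultimately show ?thesis by blast
qed

end
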